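(* Let $R$ be a commutative ring containing $\mathbb{Q}$, let $\mathfrak g$ be a Lie algebra over $R$ which is a free $R$-module of finite rank, and let $r\in\Lambda^2\mathfrak g$ be a non-degenerate classical $r$-matrix. Let $s\in \mathrm S^2\mathfrak g$ be such that there exists a symplectic torsion-free covariant derivative $\nabla$ on $\mathfrak g$ with $\nabla_X s=0$ for all $X\in\mathfrak g$ (fix such a $\nabla$), and put $\pi=r+s$. Let $\Omega\in t\,\Lambda^2\mathfrak g^*[[t]]$ be a formal series of $\delta_{CE}$-closed two-forms. Then for every associative $R$-algebra $\mathcal A$ with an action $\triangleright$ of $\mathfrak g$ by derivations, the formula $$ m_\star^{\mathcal A}(\xi,\eta)=\sigma\bigl(m_\pi^{\mathcal A}(\tau_{\mathcal A}(\xi),\tau_{\mathcal A}(\eta))\bigr),\qquad \xi,\eta\in\mathcal A[[t]], $$ defines an associative deformation $m_\star^{\mathcal A}:\mathcal A[[t]]\times\mathcal A[[t]]\to\mathcal A[[t]]$ of $\mathcal A$ (an associative $R[[t]]$-bilinear product agreeing with the product of $\mathcal A$ in order $t^0$). Moreover, writing $\xi\star\eta=m_\star^{\mathcal A}(\xi,\eta)$, one has for all $\xi,\eta\in\mathcal A$ $$ \xi\star\eta=\xi\cdot\eta+\frac t2\,\pi^{ij}(e_i\triangleright\xi)\cdot(e_j\triangleright\eta)+\mathcal O(t^2). $$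
   Context: Setting. $e_1,\dots,e_n$ is a basis of $\mathfrak g$, $e^1,\dots,e^n$ the dual basis; summation convention is used. $r=r^{ij}e_i\otimes e_j$ (antisymmetric) is a classical $r$-matrix if $[[r,r]]=0$ for the extension of the Lie bracket to a Gerstenhaber bracket on $\Lambda^\bullet\mathfrak g$; non-degenerate means the matrix $(r^{ij})$ is invertible over $R$. $\omega=\frac12\omega_{ij}e^i\wedge e^j$ with $r^{ij}\omega_{jk}=\delta^i_k$ is the inverse of $r$. $\delta_{CE}$ is the Chevalley-Eilenberg differential on $\Lambda^\bullet\mathfrak g^*$ (trivial coefficients, $(\delta_{CE}\alpha)(X,Y)=-\alpha([X,Y])$ on $\mathfrak g^*$). Covariant derivative: a bilinear map $\nabla:\mathfrak g\times\mathfrak g\to\mathfrak g$; torsion-free: $\nabla_XY-\nabla_YX=[X,Y]$. $\nabla_X$ is extended to $\mathfrak g^*$ by $(\nabla_X\alpha)(Y)=-\alpha(\nabla_XY)$ and to all tensors as a derivation; symplectic: $\nabla_X\omega=0$ for all $X$. Curvature: $\tilde R(X,Y)=\nabla_X\nabla_Y-\nabla_Y\nabla_X-\nabla_{[X,Y]}$, and $\mathsf R=\frac14\omega(e_k,\tilde R(e_i,e_j)e_l)\,e^k\vee e^l\otimes e^i\wedge e^j\in \mathrm S^2\mathfrak g^*\otimes\Lambda^2\mathfrak g^*$. Formal Weyl algebra: $\mathcal W\otimes\Lambda^\bullet=\bigl(\prod_{k\ge0}\mathrm S^k\mathfrak g^*\otimes\Lambda^\bullet\mathfrak g^*\bigr)[[t]]$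 with product $\mu$: $(f\otimes\alpha)(g\otimes\beta)=f\vee g\otimes\alpha\wedge\beta$. Total degree of $t^m\,\mathrm S^k\mathfrak g^*\otimes\Lambda^\ell\mathfrak g^*$ is $k+2m$; $\mathcal W_k\otimes\Lambda^\ell$ denotes elements of antisymmetric degree $\ell$ all of whose homogeneous components have total degree $\ge k$. $i_s(X)$, $i_a(X)$ are the symmetric and antisymmetric insertion derivations. $\delta=e^i\wedge i_s(e_i)$; $\delta^{-1}=\frac1{k+\ell}\,e^i\vee i_a(e_i)$ on $\mathrm S^k\mathfrak g^*\otimes\Lambda^\ell\mathfrak g^*$ if $k+\ell>0$ and $\delta^{-1}=0$ if $k=\ell=0$; $\sigma$ is the projection onto symmetric and antisymmetric degree $0$. With $\pi^{ij}=r^{ij}+s^{ij}$, $a\circ_\pi b=\mu\circ e^{\frac t2\mathcal P}(a\otimes b)$, $\mathcal P=\pi^{ij}i_s(e_i)\otimes i_s(e_j)$; $\mathrm{ad}(a)b=[a,b]$ is the graded $\circ_\pi$-commutator w.r.t. the antisymmetric degree. $D(f\otimes\alpha)=\nabla_{e_i}f\otimes e^i\wedge\alpha+f\otimes\delta_{CE}\alpha$. Given $\Omega$, there is a unique $\varrho\in\mathcal W_2\otimes\Lambda^1$ with $\delta\varrho=\mathsf R+D\varrho+\frac1t\varrho\circ_\pi\varrho+\Omega$ and $\delta^{-1}\varrho=0$. Extension by $\mathcal A$: $\mathcal A\otimes\mathcal W\otimes\Lambda^\bullet=\prod_k(\mathcal A\otimes \mathrm S^k\mathfrak g^*\otimes\Lambda^\bullet\mathfrak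 g^* )[[t]]$; all operators above act on the last two factors, so $\sigma$ takes values in $\mathcal A[[t]]$. $m^{\mathcal A}_\pi(\xi_1\otimes a_1,\xi_2\otimes a_2)=(\xi_1\cdot\xi_2)\otimes(a_1\circ_\pi a_2)$. $L_{\mathcal A}(\xi\otimes f\otimes\alpha)=e_i\triangleright\xi\otimes f\otimes e^i\wedge\alpha$. For $\xi\in\mathcal A[[t]]$, $$\tau_{\mathcal A}(\xi)=\sum_{k\ge0}\bigl[\delta^{-1},D+L_{\mathcal A}+\tfrac1t\mathrm{ad}(\varrho)\bigr]^k(\xi),$$ with $[\cdot,\cdot]$ the supercommutator of operators w.r.t. antisymmetric degree (here an anticommutator). *)

theory Defs
  imports
    "HOL-Computational_Algebra.Formal_Power_Series"
    "HOL-Library.Multiset"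
    "HOL-Library.Function_Algebras"
    "HOL-Library.Groups_Big_Fun"
begin

text \<open>
  Sums, differences and zero of functions are pointwise throughout.
\<close>

section \<open>Ground ring, Lie algebra, algebras with an action\<close>

text \<open>The embedding of the rationals supplies scalars such as 1/2 and 1/k! in the ground ring.\<close>

locale rational_ring =
  fixes q :: "rat \<Rightarrow> 'r::comm_ring_1"
  assumes q_inj: "inj q"
    and q_one: "q 1 = 1"
    and q_add: "q (x + y) = q x + q y"
    and q_mult: "q (x * y) = q x * q y"

locale lie_algebra = module scG
  for scG :: "'r::comm_ring_1 \<Rightarrow> 'g::ab_group_add \<Rightarrow> 'g" +
  fixes br :: "'g \<Rightarrow> 'g \<Rightarrow> 'g"
  assumes br_linear_left: "module_hom scG scG (\<lambda>x. br x y)"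
    and br_linear_right: "module_hom scG scG (br x)"
    and br_alternating: "br x x = 0"
    and jacobi: "br x (br y z) + br y (br z x) + br z (br x y) = 0"

text \<open>The basis is \<open>e 0, \<dots>, e (n - 1)\<close>; values \<open>e i\<close> for \<open>i \<ge> n\<close> are irrelevant.\<close>

locale based_lie_algebra = lie_algebra scG br
  for scG :: "'r::comm_ring_1 \<Rightarrow> 'g::ab_group_add \<Rightarrow> 'g" and br +
  fixes n :: nat and e :: "nat \<Rightarrow> 'g"
  assumes basis_inj: "inj_on e {..<n}"
    and basis_independent: "independent (e ` {..<n})"
    and basis_span: "span (e ` {..<n}) = UNIV"
begin

text \<open>The dual basis \<open>e\<^sup>i\<close>.\<close>
definition coord :: "nat \<Rightarrow> 'g \<Rightarrow> 'r" where
  "coord i x = representation (e ` {..<n}) x (e i)"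

end

text \<open>Associative, not necessarily unital, algebras on which a Lie algebra acts by derivations.\<close>

locale lie_algebra_action = lie_algebra scG br + A: module scA
  for scG :: "'r::comm_ring_1 \<Rightarrow> 'g::ab_group_add \<Rightarrow> 'g" and br
    and scA :: "'r \<Rightarrow> 'a::ring \<Rightarrow> 'a" +
  fixes act :: "'g \<Rightarrow> 'a \<Rightarrow> 'a"
  assumes scA_mult_left: "scA c (a * b) = scA c a * b"
    and scA_mult_right: "scA c (a * b) = a * scA c b"
    and act_linear_left: "module_hom scG scA (\<lambda>x. act x a)"
    and act_linear_right: "module_hom scA scA (act x)"
    and act_bracket: "act (br x y) a = act x (act y a) - act y (act x a)"
    and act_derivation: "act x (a * b) = act x a * b + a * act x b"


section \<open>Exterior algebra\<close>

text \<open>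
  An element of the exterior algebra on n generators with coefficients in a module is the family
  of its coefficients: \<open>P S\<close> is the coefficient of the increasing wedge product of the generators
  with index in \<open>S\<close>.  This serves both for forms (generators \<open>e\<^sup>i\<close>) and for multivectors
  (generators \<open>e\<^sub>i\<close>).
\<close>

type_synonym 'c ext = "nat set \<Rightarrow> 'c"

text \<open>The sign of the permutation sorting \<open>T\<close> followed by \<open>U\<close>, for disjoint \<open>T\<close> and \<open>U\<close>.\<close>

definition ext_sign :: "nat set \<Rightarrow> nat set \<Rightarrow> 'c::ab_group_add \<Rightarrow> 'c" where
  "ext_sign T U x = (if even (card {(i, j). i \<in> T \<and> j \<in> U \<and> j < i}) then x else - x)"

text \<open>Here \<open>f\<close> is the bilinear map multiplying the coefficients.\<close>

definition ext_mult :: "('a \<Rightarrow> 'b \<Rightarrow> 'c::ab_group_add) \<Rightarrow> 'a ext \<Rightarrow> 'b ext \<Rightarrow> 'c ext" where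
  "ext_mult f P Q = (\<lambda>S. \<Sum>T\<in>Pow S. ext_sign T (S - T) (f (P T) (Q (S - T))))"

definition ext_gen :: "nat \<Rightarrow> 'c::zero_neq_one ext" where
  "ext_gen i = (\<lambda>S. if S = {i} then 1 else 0)"

text \<open>Insertion of the vector dual to the i-th generator, a left antiderivation.\<close>

definition ext_insert :: "nat \<Rightarrow> 'c::ab_group_add ext \<Rightarrow> 'c ext" where
  "ext_insert i P = (\<lambda>S. if i \<in> S then 0 else ext_sign {i} S (P (insert i S)))"


section \<open>Formal Weyl algebra\<close>

text \<open>
  \<open>a m M S\<close> is the coefficient of \<open>t\<^sup>m\<close> times the symmetric product of the \<open>e\<^sup>i\<close>, \<open>i \<in># M\<close>,
  tensored with the increasing wedge product of the \<open>e\<^sup>i\<close>, \<open>i \<in> S\<close>.  Coefficients are in the ground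
  ring for the Weyl algebra itself and in \<open>\<A>\<close> for its extension by \<open>\<A>\<close>.  Since the dual of
  the Lie algebra is free of rank n, arbitrary families supported on indices below n
  are exactly the elements of the product over k, completed in t.
\<close>

type_synonym 'c weyl = "nat \<Rightarrow> nat multiset \<Rightarrow> 'c ext"

text \<open>Antisymmetric degree l and total degree at least k.\<close>

definition weyl_filt :: "nat \<Rightarrow> nat \<Rightarrow> nat \<Rightarrow> 'c::zero weyl set" where
  "weyl_filt n k l = {a. \<forall>m M S. a m M S \<noteq> 0 \<longrightarrow>
     set_mset M \<subseteq> {..<n} \<and> S \<subseteq> {..<n} \<and> card S = l \<and> k \<le> size M + 2 * m}"

definition sym_gen :: "nat \<Rightarrow> 'c::zero_neq_one weyl" where
  "sym_gen i = (\<lambda>m M S. if m = 0 \<and> M = {#i#} \<and> S = {} then 1 else 0)"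

definition asym_gen :: "nat \<Rightarrow> 'c::zero_neq_one weyl" where
  "asym_gen i = (\<lambda>m M S. if m = 0 \<and> M = {#} \<and> S = {i} then 1 else 0)"

definition weyl_mult :: "('a \<Rightarrow> 'b \<Rightarrow> 'c::ab_group_add) \<Rightarrow> 'a weyl \<Rightarrow> 'b weyl \<Rightarrow> 'c weyl" where
  "weyl_mult f a b = (\<lambda>m M. \<Sum>p\<le>m. \<Sum>N\<in>{N. N \<subseteq># M}. ext_mult f (a p N) (b (m - p) (M - N)))"

text \<open>The sum adds up \<open>count M i + 1\<close> equal terms, as for a partial derivative of a polynomial.\<close>

definition ins_sym :: "nat \<Rightarrow> 'c::ab_group_add weyl \<Rightarrow> 'c weyl" where
  "ins_sym i a = (\<lambda>m M S. \<Sum>_\<in>{..count M i}. a m (add_mset i M) S)"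

definition ins_asym :: "nat \<Rightarrow> 'c::ab_group_add weyl \<Rightarrow> 'c weyl" where
  "ins_asym i a = (\<lambda>m M. ext_insert i (a m M))"

definition weyl_map :: "('b \<Rightarrow> 'c) \<Rightarrow> 'b weyl \<Rightarrow> 'c weyl" where
  "weyl_map h a = (\<lambda>m M S. h (a m M S))"

text \<open>Division by t, applied only to elements whose t-constant part vanishes.\<close>

definition div_t :: "'c weyl \<Rightarrow> 'c weyl" where
  "div_t a = (\<lambda>m. a (Suc m))"

definition asym_part :: "nat \<Rightarrow> 'c::zero weyl \<Rightarrow> 'c weyl" where
  "asym_part l a = (\<lambda>m M S. if card S = l then a m M S else 0)"

text \<open>The embedding of formal power series over the coefficients, and the projection \<open>\<sigma>\<close>.\<close>

definition weyl_const :: "'c::zero fps \<Rightarrow> 'c weyl" where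
  "weyl_const \<xi> = (\<lambda>m M S. if M = {#} \<and> S = {} then fps_nth \<xi> m else 0)"

definition sigma :: "'c weyl \<Rightarrow> 'c fps" where
  "sigma a = Abs_fps (\<lambda>m. a m {#} {})"


section \<open>The Fedosov construction\<close>

text \<open>
  Tensors are given by their components: \<open>r = r i j e\<^sub>i \<otimes> e\<^sub>j\<close> and \<open>s = s i j e\<^sub>i \<otimes> e\<^sub>j\<close>, where
  only indices below n matter.  \<open>\<Omega> m\<close> is the coefficient of \<open>t\<^sup>m\<close>.

  For operators on the extension by an algebra, the parameter \<open>sc\<close> is the scalar
  multiplication of the coefficient module; it is \<open>(*)\<close> for the Weyl algebra itself.
\<close>

locale fedosov = rational_ring q + based_lie_algebra scG br n e
  for q :: "rat \<Rightarrow> 'r::comm_ring_1"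
    and scG :: "'r \<Rightarrow> 'g::ab_group_add \<Rightarrow> 'g" and br n e +
  fixes r s :: "nat \<Rightarrow> nat \<Rightarrow> 'r"
    and nabla :: "'g \<Rightarrow> 'g \<Rightarrow> 'g"
    and Omega :: "nat \<Rightarrow> 'r ext"
begin

subsection \<open>Classical r-matrices\<close>

text \<open>
  With \<open>x \<and> y = x \<otimes> y - y \<otimes> x\<close>, an antisymmetric \<open>\<beta> i j\<close> corresponds to
  \<open>1/2 \<beta> i j g\<^sub>i \<and> g\<^sub>j\<close>, where the \<open>g\<^sub>i\<close> are the generators.
\<close>

definition ext_two :: "(nat \<Rightarrow> nat \<Rightarrow> 'r) \<Rightarrow> 'r ext" where
  "ext_two \<beta> = (\<lambda>S. \<Sum>i<n. \<Sum>j<n. q (1/2) * \<beta> i j * ext_mult (*) (ext_gen i) (ext_gen j) S)"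

definition ext_vec :: "'g \<Rightarrow> 'r ext" where
  "ext_vec x = (\<lambda>S. \<Sum>c<n. coord c x * ext_gen c S)"

text \<open>
  The Gerstenhaber bracket on multivectors.  The sum over all a, b of \<open>[e\<^sub>a, e\<^sub>b]\<close>, wedged with
  the insertion of \<open>e\<^sup>a\<close> into P and then with that of \<open>e\<^sup>b\<close> into Q, takes on decomposable
  elements \<open>x\<^sub>1 \<and> \<dots> \<and> x\<^sub>k\<close> and \<open>y\<^sub>1 \<and> \<dots> \<and> y\<^sub>l\<close> the value
  \<open>\<Sum>i j. (-1)^(i+j) [x\<^sub>i, y\<^sub>j] \<and> x\<^sub>1 \<dots> omit x\<^sub>i \<dots> x\<^sub>k \<and> y\<^sub>1 \<dots> omit y\<^sub>j \<dots> y\<^sub>l\<close>.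
\<close>

definition gerstenhaber :: "'r ext \<Rightarrow> 'r ext \<Rightarrow> 'r ext" where
  "gerstenhaber P Q = (\<Sum>a<n. \<Sum>b<n.
     ext_mult (*) (ext_mult (*) (ext_vec (br (e a) (e b))) (ext_insert a P)) (ext_insert b Q))"

definition classical_r_matrix :: bool where
  "classical_r_matrix \<longleftrightarrow>
     (\<forall>i<n. \<forall>j<n. r i j = - r j i) \<and> gerstenhaber (ext_two r) (ext_two r) = 0"

definition inverse_matrices :: "(nat \<Rightarrow> nat \<Rightarrow> 'r) \<Rightarrow> (nat \<Rightarrow> nat \<Rightarrow> 'r) \<Rightarrow> bool" where
  "inverse_matrices u w \<longleftrightarrow> (\<forall>i<n. \<forall>k<n.
     (\<Sum>j<n. u i j * w j k) = (if i = k then 1 else 0) \<and>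
     (\<Sum>j<n. w i j * u j k) = (if i = k then 1 else 0))"

definition nondegenerate :: bool where
  "nondegenerate \<longleftrightarrow> (\<exists>w. inverse_matrices r w)"

text \<open>The choice is unique on indices below n.\<close>
definition omega_mat :: "nat \<Rightarrow> nat \<Rightarrow> 'r" where
  "omega_mat = (SOME w. inverse_matrices r w)"

definition omega :: "'g \<Rightarrow> 'g \<Rightarrow> 'r" where
  "omega x y = (\<Sum>i<n. \<Sum>j<n. omega_mat i j * coord i x * coord j y)"

definition symmetric_s :: bool where
  "symmetric_s \<longleftrightarrow> (\<forall>i<n. \<forall>j<n. s i j = s j i)"

definition pi_mat :: "nat \<Rightarrow> nat \<Rightarrow> 'r" where
  "pi_mat i j = r i j + s i j"


subsection \<open>Covariant derivative\<close>

definition covariant_derivative :: bool where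
  "covariant_derivative \<longleftrightarrow>
     (\<forall>Y. module_hom scG scG (\<lambda>X. nabla X Y)) \<and> (\<forall>X. module_hom scG scG (nabla X))"

definition torsion_free :: bool where
  "torsion_free \<longleftrightarrow> (\<forall>X Y. nabla X Y - nabla Y X = br X Y)"

definition nabla_bilinear_form :: "'g \<Rightarrow> ('g \<Rightarrow> 'g \<Rightarrow> 'r) \<Rightarrow> 'g \<Rightarrow> 'g \<Rightarrow> 'r" where
  "nabla_bilinear_form X \<beta> Y Z = - \<beta> (nabla X Y) Z - \<beta> Y (nabla X Z)"

definition symplectic :: bool where
  "symplectic \<longleftrightarrow> (\<forall>X Y Z. nabla_bilinear_form X omega Y Z = 0)"

text \<open>
  Components of \<open>\<nabla>\<^sub>X\<close> of the contravariant tensor \<open>u i j e\<^sub>i \<otimes> e\<^sub>j\<close>.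
\<close>

definition nabla_tensor :: "'g \<Rightarrow> (nat \<Rightarrow> nat \<Rightarrow> 'r) \<Rightarrow> nat \<Rightarrow> nat \<Rightarrow> 'r" where
  "nabla_tensor X u i j =
     (\<Sum>k<n. u k j * coord i (nabla X (e k))) + (\<Sum>k<n. u i k * coord j (nabla X (e k)))"

definition s_parallel :: bool where
  "s_parallel \<longleftrightarrow> (\<forall>X. \<forall>i<n. \<forall>j<n. nabla_tensor X s i j = 0)"

definition curv :: "'g \<Rightarrow> 'g \<Rightarrow> 'g \<Rightarrow> 'g" where
  "curv X Y Z = nabla X (nabla Y Z) - nabla Y (nabla X Z) - nabla (br X Y) Z"

definition curv_R :: "'r weyl" where
  "curv_R = (\<Sum>k<n. \<Sum>l<n. \<Sum>i<n. \<Sum>j<n.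
     weyl_map ((*) (q (1/4) * omega (e k) (curv (e i) (e j) (e l))))
       (weyl_mult (*) (weyl_mult (*) (sym_gen k) (sym_gen l))
                      (weyl_mult (*) (asym_gen i) (asym_gen j))))"


subsection \<open>Operators on the Weyl algebra\<close>

definition delta :: "('r \<Rightarrow> 'c::ab_group_add \<Rightarrow> 'c) \<Rightarrow> 'c weyl \<Rightarrow> 'c weyl" where
  "delta sc a = (\<Sum>i<n. weyl_mult sc (asym_gen i) (ins_sym i a))"

definition delta_inv :: "('r \<Rightarrow> 'c::ab_group_add \<Rightarrow> 'c) \<Rightarrow> 'c weyl \<Rightarrow> 'c weyl" where
  "delta_inv sc a = (\<Sum>i<n. weyl_mult sc (sym_gen i) (ins_asym i
     (\<lambda>m M S. if size M + card S = 0 then 0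
              else sc (q (1 / of_nat (size M + card S))) (a m M S))))"

text \<open>
  The Chevalley-Eilenberg differential as the antiderivation extending its values
  \<open>ce_gen k\<close> on the generators \<open>e\<^sup>k\<close>.
\<close>

definition ce_gen :: "nat \<Rightarrow> 'r ext" where
  "ce_gen k = ext_two (\<lambda>i j. - coord k (br (e i) (e j)))"

definition delta_CE :: "('r \<Rightarrow> 'c::ab_group_add \<Rightarrow> 'c) \<Rightarrow> 'c ext \<Rightarrow> 'c ext" where
  "delta_CE sc P = (\<Sum>k<n. ext_mult sc (ce_gen k) (ext_insert k P))"

definition closed_two_forms :: bool where
  "closed_two_forms \<longleftrightarrow> Omega 0 = 0 \<and>
     (\<forall>m. (\<forall>S. Omega m S \<noteq> 0 \<longrightarrow> S \<subseteq> {..<n} \<and> card S = 2) \<and> delta_CE (*) (Omega m) = 0)"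

text \<open>
  \<open>(\<nabla>\<^sub>X e\<^sup>k)(e\<^sub>l) = - e\<^sup>k(\<nabla>\<^sub>X e\<^sub>l)\<close>, extended to the symmetric algebra as a derivation.
\<close>

definition nabla_gen :: "'g \<Rightarrow> nat \<Rightarrow> 'r weyl" where
  "nabla_gen X k = (\<Sum>l<n. weyl_map ((*) (- coord k (nabla X (e l)))) (sym_gen l))"

definition nabla_sym :: "('r \<Rightarrow> 'c::ab_group_add \<Rightarrow> 'c) \<Rightarrow> 'g \<Rightarrow> 'c weyl \<Rightarrow> 'c weyl" where
  "nabla_sym sc X a = (\<Sum>k<n. weyl_mult sc (nabla_gen X k) (ins_sym k a))"

definition D_op :: "('r \<Rightarrow> 'c::ab_group_add \<Rightarrow> 'c) \<Rightarrow> 'c weyl \<Rightarrow> 'c weyl" where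
  "D_op sc a = (\<Sum>i<n. weyl_mult sc (asym_gen i) (nabla_sym sc (e i) a))
               + (\<lambda>m M. delta_CE sc (a m M))"

text \<open>\<open>\<mu> \<circ> \<P>\<^sup>k\<close>, where \<open>\<P> = \<pi>\<^sup>i\<^sup>j i\<^sub>s(e\<^sub>i) \<otimes> i\<^sub>s(e\<^sub>j)\<close> and \<open>f\<close> multiplies the coefficients.\<close>

fun mu_P :: "('a::ab_group_add \<Rightarrow> 'b::ab_group_add \<Rightarrow> 'c::ab_group_add) \<Rightarrow> ('r \<Rightarrow> 'c \<Rightarrow> 'c)
    \<Rightarrow> nat \<Rightarrow> 'a weyl \<Rightarrow> 'b weyl \<Rightarrow> 'c weyl" where
  "mu_P f sc 0 a b = weyl_mult f a b"
| "mu_P f sc (Suc k) a b =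
     (\<Sum>i<n. \<Sum>j<n. weyl_map (sc (pi_mat i j)) (mu_P f sc k (ins_sym i a) (ins_sym j b)))"

text \<open>\<open>a \<circ>\<^sub>\<pi> b\<close>, the k-th summand being \<open>(t/2)\<^sup>k / k!\<close> times the above.\<close>

definition circ :: "('a::ab_group_add \<Rightarrow> 'b::ab_group_add \<Rightarrow> 'c::ab_group_add) \<Rightarrow> ('r \<Rightarrow> 'c \<Rightarrow> 'c)
    \<Rightarrow> 'a weyl \<Rightarrow> 'b weyl \<Rightarrow> 'c weyl" where
  "circ f sc a b = (\<lambda>m M S. \<Sum>k\<le>m. sc (q (1 / (2 ^ k * fact k))) (mu_P f sc k a b (m - k) M S))"

text \<open>The graded commutator of an element of the Weyl algebra and one of its extension.\<close>

definition ad_op :: "('r \<Rightarrow> 'c::ab_group_add \<Rightarrow> 'c) \<Rightarrow> 'r weyl \<Rightarrow> 'c weyl \<Rightarrow> 'c weyl" where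
  "ad_op sc a b = (\<Sum>k\<le>n. \<Sum>l\<le>n.
     circ sc sc (asym_part k a) (asym_part l b)
     - weyl_map (\<lambda>x. if even (k * l) then x else - x)
         (circ (\<lambda>x c. sc c x) sc (asym_part l b) (asym_part k a)))"


subsection \<open>The Fedosov element, the Taylor series, the deformed product\<close>

definition is_varrho :: "'r weyl \<Rightarrow> bool" where
  "is_varrho \<rho> \<longleftrightarrow> \<rho> \<in> weyl_filt n 2 1 \<and>
     delta (*) \<rho> = curv_R + D_op (*) \<rho> + div_t (circ (*) (*) \<rho> \<rho>)
                   + (\<lambda>m M. if M = {#} then Omega m else 0) \<and>
     delta_inv (*) \<rho> = 0"

definition varrho :: "'r weyl" where
  "varrho = (THE \<rho>. is_varrho \<rho>)"

context
  fixes scA :: "'r \<Rightarrow> 'a::ring \<Rightarrow> 'a"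
    and act :: "'g \<Rightarrow> 'a \<Rightarrow> 'a"
begin

definition L_op :: "'a weyl \<Rightarrow> 'a weyl" where
  "L_op a = (\<Sum>i<n. weyl_mult scA (asym_gen i) (weyl_map (act (e i)) a))"

definition taylor_inner :: "'a weyl \<Rightarrow> 'a weyl" where
  "taylor_inner a = D_op scA a + L_op a + div_t (ad_op scA varrho a)"

text \<open>Both operators are odd, so their supercommutator is an anticommutator.\<close>

definition taylor_step :: "'a weyl \<Rightarrow> 'a weyl" where
  "taylor_step a = delta_inv scA (taylor_inner a) + taylor_inner (delta_inv scA a)"

text \<open>
  The operator \<open>taylor_step\<close> raises the total degree, so each coefficient of the sum over all
  its powers has only finitely many nonzero summands.
\<close>

definition tau :: "'a fps \<Rightarrow> 'a weyl" where
  "tau \<xi> = (\<lambda>m M S. Sum_any (\<lambda>k. (taylor_step ^^ k) (weyl_const \<xi>) m M S))"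

definition star :: "'a fps \<Rightarrow> 'a fps \<Rightarrow> 'a fps" where
  "star \<xi> \<eta> = sigma (circ (*) scA (tau \<xi>) (tau \<eta>))"

end

end


section \<open>Associative deformations\<close>

definition fps_scale :: "('r \<Rightarrow> 'a \<Rightarrow> 'a) \<Rightarrow> 'r fps \<Rightarrow> 'a::comm_monoid_add fps \<Rightarrow> 'a fps" where
  "fps_scale sc c \<xi> = Abs_fps (\<lambda>m. \<Sum>k\<le>m. sc (fps_nth c k) (fps_nth \<xi> (m - k)))"

definition associative_deformation ::
    "('r::comm_ring_1 \<Rightarrow> 'a::ring \<Rightarrow> 'a) \<Rightarrow> ('a fps \<Rightarrow> 'a fps \<Rightarrow> 'a fps) \<Rightarrow> bool" where
  "associative_deformation sc m \<longleftrightarrow>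
     (\<forall>\<xi> \<eta> \<zeta>. m (\<xi> + \<eta>) \<zeta> = m \<xi> \<zeta> + m \<eta> \<zeta>) \<and>
     (\<forall>\<xi> \<eta> \<zeta>. m \<xi> (\<eta> + \<zeta>) = m \<xi> \<eta> + m \<xi> \<zeta>) \<and>
     (\<forall>c \<xi> \<eta>. m (fps_scale sc c \<xi>) \<eta> = fps_scale sc c (m \<xi> \<eta>)) \<and>
     (\<forall>c \<xi> \<eta>. m \<xi> (fps_scale sc c \<eta>) = fps_scale sc c (m \<xi> \<eta>)) \<and>
     (\<forall>\<xi> \<eta> \<zeta>. m (m \<xi> \<eta>) \<zeta> = m \<xi> (m \<eta> \<zeta>)) \<and>
     (\<forall>\<xi> \<eta>. fps_nth (m \<xi> \<eta>) 0 = fps_nth \<xi> 0 * fps_nth \<eta> 0)"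

end

theory Submission
  imports Defs "HOL-Library.Product_Plus"
begin

text \<open>The operator \<open>-\<delta> + D + L + ad \<varrho> / t\<close> is an odd derivation of the fibrewise product
  \<open>\<circ>\<^sub>\<pi>\<close>. It squares to the inner derivation by
  \<open>C = - \<delta> \<varrho> + \<R> + D \<varrho> + \<varrho> \<circ>\<^sub>\<pi> \<varrho> / t + \<Omega>\<close> (up to the factor \<open>1 / t\<close>), because \<open>\<nabla>\<close> is
  torsion-free and preserves \<open>\<omega>\<close> and \<open>s\<close>, so that its curvature acts as a commutator with \<open>\<R>\<close>. The
  Fedosov equation says \<open>C = 0\<close>: it has a solution since \<open>\<delta>\<^bsup>-1\<^esup>\<close> turns it into a fixed point equation
  of a contraction, and a fixed point satisfies it because the Bianchi identities kill the
  remaining obstruction. The flat elements of antisymmetric degree 0 therefore form a subalgebra.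
  By the homotopy formula for \<open>\<delta>\<close>, \<open>\<sigma>\<close> maps it bijectively onto \<open>\<A>[[t]]\<close>, with the Neumann series
  \<open>\<tau>\<close> as inverse; so the star product is \<open>\<circ>\<^sub>\<pi>\<close> transported along \<open>\<tau>\<close>. As \<open>\<A>\<close> need not have a
  unit, all of this is carried out in the unitization \<open>R \<oplus> \<A>\<close>, into which \<open>\<varrho>\<close>, \<open>\<Omega>\<close> and the
  curvature also embed, so that only one kind of product occurs.\<close>

text \<open>The obstacle is the symmetric part \<open>s\<close>: the curvature has to act as a
  commutator for a product that is not of Weyl-Moyal type. Multiplication by a linear generator is
  split into half an anticommutator, which carries \<open>s\<close>, and half a commutator, which
  carries only \<open>r\<close>. In the commutator with the quadratic curvature element,
  \<open>s\<close> then survives only as an antisymmetric tensor contracted with second derivatives,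
  because the curvature preserves \<open>s\<close>, and so it drops out. The Bianchi identity is not
  computed in components. The derivation commutes with its own square, so its value on the curvature
  graded-commutes with every generator; invertibility of \<open>r\<close> confines it to symmetric
  degree 0, and there the total degree excludes it.\<close>

lemma sum_fun_apply: "(\<Sum>i\<in>I. g i) x = (\<Sum>i\<in>I. g i x)"
  by (induction I rule: infinite_finite_induct) auto

text \<open>Coefficient products occur as ring product, as scalar action in either order and as
  algebra product, between up to three different types. Additivity in each argument is the common
  property on which the bookkeeping of signs and indices relies.\<close>

definition biadditive :: "('a::ab_group_add \<Rightarrow> 'b::ab_group_add \<Rightarrow> 'c::ab_group_add) \<Rightarrow> bool" where
  "biadditive f \<longleftrightarrow> (\<forall>x. additive (f x)) \<and> (\<forall>y. additive (\<lambda>x. f x y))"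

lemma biadditiveI:
  assumes "\<And>x x' y. f (x + x') y = f x y + f x' y" "\<And>x y y'. f x (y + y') = f x y + f x y'"
  shows "biadditive f"
  using assms by (simp add: biadditive_def additive_def)

lemma biadditive_simps:
  assumes "biadditive f"
  shows "f (x + x') y = f x y + f x' y" "f x (y + y') = f x y + f x y'"
    "f 0 y = 0" "f x 0 = 0" "f (- x) y = - f x y" "f x (- y) = - f x y"
    "f (x - x') y = f x y - f x' y" "f x (y - y') = f x y - f x y'"
    "f (sum g I) y = (\<Sum>i\<in>I. f (g i) y)" "f x (sum h J) = (\<Sum>i\<in>J. f x (h i))"
proof -
  interpret l: additive "\<lambda>x. f x y" for y using assms by (simp add: biadditive_def)
  interpret r: additive "f x" for x using assms by (simp add: biadditive_def)
  show "f (x + x') y = f x y + f x' y" "f x (y + y') = f x y + f x y'"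
    "f 0 y = 0" "f x 0 = 0" "f (- x) y = - f x y" "f x (- y) = - f x y"
    "f (x - x') y = f x y - f x' y" "f x (y - y') = f x y - f x y'"
    "f (sum g I) y = (\<Sum>i\<in>I. f (g i) y)" "f x (sum h J) = (\<Sum>i\<in>J. f x (h i))"
    by (simp_all add: l.add r.add l.zero r.zero l.minus r.minus l.diff r.diff l.sum r.sum)
qed

lemma biadditive_flip: "biadditive f \<Longrightarrow> biadditive (\<lambda>x y. f y x)"
  by (simp add: biadditive_def)

section \<open>Koszul signs as parities of inversion numbers\<close>

section \<open>Signs\<close>

definition alt :: "nat \<Rightarrow> 'c::ab_group_add \<Rightarrow> 'c" where
  "alt k x = (if even k then x else - x)"

lemma alt_simps [simp]: "alt 0 x = x" "alt k 0 = 0" "alt (Suc k) x = - alt k x"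
  "alt k (- x) = - alt k x" "alt k (alt l x) = alt (k + l) x"
  by (auto simp: alt_def)

lemma alt_add: "alt k (x + y) = alt k x + alt k y"
  and alt_diff: "alt k (x - y) = alt k x - alt k y"
  by (auto simp: alt_def)

lemma alt_sum: "alt k (sum g I) = (\<Sum>i\<in>I. alt k (g i))"
  by (auto simp: alt_def sum_negf)

lemma alt_cong: "even (k + l) \<Longrightarrow> alt k x = alt l x"
  by (auto simp: alt_def)

lemma alt_zero_iff [simp]: "alt k x = 0 \<longleftrightarrow> x = 0"
  by (auto simp: alt_def)

lemma biadditive_alt:
  assumes "biadditive f"
  shows "f (alt k x) y = alt k (f x y)" "f x (alt k y) = alt k (f x y)"
  by (auto simp: alt_def biadditive_simps[OF assms])

definition ninv :: "nat set \<Rightarrow> nat set \<Rightarrow> nat" where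
  "ninv T U = card {(i, j). i \<in> T \<and> j \<in> U \<and> j < i}"

lemma ext_sign_alt: "ext_sign T U x = alt (ninv T U) x"
  by (simp add: ext_sign_def alt_def ninv_def)

lemma finite_inversions:
  assumes "finite T" shows "finite {(i::nat, j). i \<in> T \<and> j \<in> U \<and> j < i}"
proof (rule finite_subset)
  show "{(i, j). i \<in> T \<and> j \<in> U \<and> j < i} \<subseteq> (SIGMA i:T. {..<i})" by auto
qed (use assms in auto)

lemma ninv_Un_left:
  assumes "finite T" "finite T'" "T \<inter> T' = {}"
  shows "ninv (T \<union> T') U = ninv T U + ninv T' U"
proof -
  have "{(i, j). i \<in> T \<union> T' \<and> j \<in> U \<and> j < i}
    = {(i, j). i \<in> T \<and> j \<in> U \<and> j < i} \<union> {(i, j). i \<in> T' \<and> j \<in> U \<and> j < i}" by auto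
  moreover have "{(i, j). i \<in> T \<and> j \<in> U \<and> j < i} \<inter> {(i, j). i \<in> T' \<and> j \<in> U \<and> j < i} = {}"
    using assms by auto
  ultimately show ?thesis
    unfolding ninv_def using assms by (simp add: card_Un_disjoint finite_inversions)
qed

lemma ninv_Un_right:
  assumes "finite T" "U \<inter> U' = {}"
  shows "ninv T (U \<union> U') = ninv T U + ninv T U'"
proof -
  have "{(i, j). i \<in> T \<and> j \<in> U \<union> U' \<and> j < i}
    = {(i, j). i \<in> T \<and> j \<in> U \<and> j < i} \<union> {(i, j). i \<in> T \<and> j \<in> U' \<and> j < i}" by auto
  moreover have "{(i, j). i \<in> T \<and> j \<in> U \<and> j < i} \<inter> {(i, j). i \<in> T \<and> j \<in> U' \<and> j < i} = {}"
    using assms by auto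
  ultimately show ?thesis
    unfolding ninv_def using assms by (simp add: card_Un_disjoint finite_inversions)
qed

lemma ninv_singleton_left: "ninv {i} S = card {j \<in> S. j < i}"
proof -
  have "{(i', j). i' \<in> {i} \<and> j \<in> S \<and> j < i'} = Pair i ` {j \<in> S. j < i}" by auto
  then show ?thesis unfolding ninv_def by (simp add: card_image inj_on_def)
qed

text \<open>Each pair in \<open>T \<times> U\<close> is an inversion in exactly one of the two
  orders. This is the source of graded commutativity.\<close>

lemma ninv_swap:
  assumes "finite T" "finite U" "T \<inter> U = {}"
  shows "ninv T U + ninv U T = card T * card U"
proof -
  have "{(i, j). i \<in> U \<and> j \<in> T \<and> j < i} = prod.swap ` {(i, j). i \<in> T \<and> j \<in> U \<and> i < j}"
    by (auto simp: image_iff)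
  then have "ninv U T = card {(i, j). i \<in> T \<and> j \<in> U \<and> i < j}"
    unfolding ninv_def by (simp add: card_image)
  moreover have "{(i, j). i \<in> T \<and> j \<in> U \<and> j < i} \<union> {(i, j). i \<in> T \<and> j \<in> U \<and> i < j} = T \<times> U"
    using assms(3) by (auto simp: disjoint_iff) (metis nat_neq_iff)
  moreover have "finite {(i, j). i \<in> T \<and> j \<in> U \<and> i < j}"
    by (rule finite_subset[of _ "T \<times> U"]) (use assms in auto)
  moreover have "{(i, j). i \<in> T \<and> j \<in> U \<and> j < i} \<inter> {(i, j). i \<in> T \<and> j \<in> U \<and> i < j} = {}"
    by auto
  ultimately have "card {(i, j). i \<in> T \<and> j \<in> U \<and> j < i} + ninv U T = card (T \<times> U)"
    using finite_inversions[OF assms(1)] by (metis (no_types, lifting) card_Un_disjoint)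
  then show ?thesis by (simp add: ninv_def card_cartesian_product)
qed

section \<open>Associativity of the undeformed product\<close>

section \<open>The undeformed product\<close>

lemma finite_submultisets [simp]: "finite {N. N \<subseteq># (M::'x multiset)}"
proof (induction M)
  case (add x M)
  have "{N. N \<subseteq># add_mset x M} \<subseteq> {N. N \<subseteq># M} \<union> add_mset x ` {N. N \<subseteq># M}"
  proof
    fix N assume "N \<in> {N. N \<subseteq># add_mset x M}"
    then have N: "N \<subseteq># add_mset x M" by simp
    show "N \<in> {N. N \<subseteq># M} \<union> add_mset x ` {N. N \<subseteq># M}"
    proof (cases "x \<in># N")
      case True
      then obtain N' where "N = add_mset x N'" by (meson multi_member_split)
      then show ?thesis using N by auto
    next
      case False
      then have "N \<subseteq># M" using N
        by (metis add_mset_remove_trivial diff_subset_eq_self diff_single_trivial subset_eq_diff_conv subset_mset.dual_order.trans add_mset_add_single)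
      then show ?thesis by auto
    qed
  qed
  then show ?case using add by (meson finite_Un finite_imageI finite_subset)
qed simp

text \<open>A power of t, a monomial and a set of exterior generators are treated as one index. With
  \<open>parts\<close> for its sub-indices and \<open>rest\<close> for the complement, the three
  nested convolutions in \<open>weyl_mult\<close> become a single sum.\<close>

definition parts :: "nat \<times> 'x multiset \<times> 'y set \<Rightarrow> (nat \<times> 'x multiset \<times> 'y set) set" where
  "parts = (\<lambda>(m, M, S). {..m} \<times> {N. N \<subseteq># M} \<times> Pow S)"

definition rest :: "nat \<times> 'x multiset \<times> 'y set \<Rightarrow> nat \<times> 'x multiset \<times> 'y set \<Rightarrow> nat \<times> 'x multiset \<times> 'y set" where
  "rest = (\<lambda>(m, M, S) (p, N, T). (m - p, M - N, S - T))"

lemma weyl_mult_parts: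
  assumes "finite S"
  shows "weyl_mult f a b m M S = (\<Sum>(p, N, T)\<in>parts (m, M, S).
    alt (ninv T (S - T)) (f (a p N T) (b (m - p) (M - N) (S - T))))"
  by (simp add: weyl_mult_def ext_mult_def ext_sign_alt sum_fun_apply parts_def assms sum.cartesian_product')

lemma weyl_mult_infinite [simp]: "infinite S \<Longrightarrow> weyl_mult f a b m M S = 0"
  by (simp add: weyl_mult_def ext_mult_def sum_fun_apply)

lemma finite_parts: "finite S \<Longrightarrow> finite (parts (m, M, S))"
  by (simp add: parts_def)

text \<open>Both sides run over the decompositions of \<open>X\<close> into three ordered blocks:
  the pair (first two together, first) is exchanged for the pair (first, second).\<close>

lemma parts_reindex:
  fixes X :: "nat \<times> 'x multiset \<times> 'y set"
  assumes S: "finite (snd (snd X))"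
  shows "(\<Sum>x\<in>parts X. \<Sum>y\<in>parts x. G y (rest x y) (rest X x))
    = (\<Sum>y\<in>parts X. \<Sum>z\<in>parts (rest X y). G y z (rest (rest X y) z))"
proof -
  obtain m M S where X: "X = (m, M, S)" by (cases X)
  have fS: "T \<subseteq> S \<Longrightarrow> finite T" for T using S X by (auto intro: finite_subset)
  have f: "finite (parts X)" using fS by (simp add: X finite_parts)
  have f1: "\<forall>x\<in>parts X. finite (parts x)"
    using fS by (auto simp: X finite_parts) (auto simp: parts_def dest!: fS)
  have f2: "\<forall>y\<in>parts X. finite (parts (rest X y))"
    using fS by (auto simp: X rest_def finite_parts)
  have m1: "N' \<subseteq># N \<Longrightarrow> N \<subseteq># M \<Longrightarrow> N - N' \<subseteq># M - N'" for N N' :: "'x multiset"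
    by (simp add: subseteq_mset_def diff_le_mono)
  have m2: "N' \<subseteq># M - N \<Longrightarrow> N \<subseteq># M \<Longrightarrow> N + N' \<subseteq># M" for N N' :: "'x multiset"
    by (metis add.commute subset_mset.le_diff_conv2)
  have m3: "N' \<subseteq># N \<Longrightarrow> M - N' - (N - N') = M - N" for N N' :: "'x multiset"
    by (simp add: diff_diff_add_mset subset_mset.add_diff_inverse)
  have m4: "N' \<subseteq># N \<Longrightarrow> N' + (N - N') = N" for N N' :: "'x multiset"
    by (simp add: subset_mset.add_diff_inverse)
  show ?thesis unfolding sum.Sigma[OF f f1] sum.Sigma[OF f f2]
  proof (rule sum.reindex_bij_witness[of _
          "\<lambda>((p, N, T), (p', N', T')). ((p + p', N + N', T \<union> T'), (p, N, T))" "\<lambda>(x, y). (y, rest x y)"])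
    fix a assume "a \<in> Sigma (parts X) parts"
    then obtain p N T p' N' T' where a: "a = ((p, N, T), (p', N', T'))" "p \<le> m" "N \<subseteq># M" "T \<subseteq> S"
        "p' \<le> p" "N' \<subseteq># N" "T' \<subseteq> T"
      by (auto simp: X parts_def)
    have "S - T' - (T - T') = S - T" "T' \<union> (T - T') = T" "T' \<subseteq> S" "N' \<subseteq># M" using a by auto
    then show "(case case a of (x, y) \<Rightarrow> (y, rest x y) of (x, y) \<Rightarrow>
          (case x of (p, N, T) \<Rightarrow> \<lambda>(p', N', T'). ((p + p', N + N', T \<union> T'), p, N, T)) y) = a"
      "(case a of (x, y) \<Rightarrow> (y, rest x y)) \<in> (SIGMA y:parts X. parts (rest X y))"
      "(case case a of (x, y) \<Rightarrow> (y, rest x y) of (y, z) \<Rightarrow> G y z (rest (rest X y) z))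
        = (case a of (x, y) \<Rightarrow> G y (rest x y) (rest X x))"
      using a m1 m3 m4 by (auto simp: rest_def X parts_def)
  next
    fix b assume "b \<in> (SIGMA y:parts X. parts (rest X y))"
    then obtain p N T p' N' T' where b: "b = ((p, N, T), (p', N', T'))" "p \<le> m" "N \<subseteq># M" "T \<subseteq> S"
        "p' \<le> m - p" "N' \<subseteq># M - N" "T' \<subseteq> S - T"
      by (auto simp: X parts_def rest_def)
    have "T \<union> T' - T = T'" using b by auto
    then show "(case case b of (x, y) \<Rightarrow> (case x of (p, N, T) \<Rightarrow> \<lambda>(p', N', T'). ((p + p', N + N', T \<union> T'), p, N, T)) y of
          (x, y) \<Rightarrow> (y, rest x y)) = b"
      "(case b of (x, y) \<Rightarrow> (case x of (p, N, T) \<Rightarrow> \<lambda>(p', N', T'). ((p + p', N + N', T \<union> T'), p, N, T)) y)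
        \<in> Sigma (parts X) parts"
      using b m2 by (auto simp: rest_def X parts_def)
  qed
qed

text \<open>Four coefficient maps are allowed because the same statement serves the product of an
  algebra and the action of scalars on a module.\<close>

lemma weyl_mult_assoc:
  assumes "biadditive f1" "biadditive f3"
    and f: "\<And>x y z. f1 (f2 x y) z = f3 x (f4 y z)"
  shows "weyl_mult f1 (weyl_mult f2 a b) c = weyl_mult f3 a (weyl_mult f4 b c)"
proof (intro ext)
  fix m M and S :: "nat set"
  show "weyl_mult f1 (weyl_mult f2 a b) c m M S = weyl_mult f3 a (weyl_mult f4 b c) m M S"
  proof (cases "finite S")
    case S: True
    let ?X = "(m, M, S)"
    let ?t = "snd \<circ> snd"
    define ev where "ev d x = d (fst x) (fst (snd x)) (snd (snd x))" for d :: "'x weyl" and x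
    \<comment> \<open>The exponent counts the inversions between each two of the three blocks;
      additivity of \<open>ninv\<close> produces it from either bracketing.\<close>
    define G where "G x y z = alt (ninv (?t x) (?t y) + ninv (?t x) (?t z) + ninv (?t y) (?t z))
      (f3 (a (fst x) (fst (snd x)) (?t x)) (f4 (b (fst y) (fst (snd y)) (?t y)) (c (fst z) (fst (snd z)) (?t z))))" for x y z
    have "weyl_mult f1 (weyl_mult f2 a b) c m M S = (\<Sum>x\<in>parts ?X. \<Sum>y\<in>parts x. G y (rest x y) (rest ?X x))"
      unfolding weyl_mult_parts[OF S]
    proof (rule sum.cong[OF refl], clarify)
      fix p N T assume x: "(p, N, T) \<in> parts ?X"
      then have T: "T \<subseteq> S" "finite T" using S by (auto simp: parts_def intro: finite_subset)
      have "ninv T (S - T) + ninv U (T - U) = ninv U (T - U) + ninv U (S - T) + ninv (T - U) (S - T)"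
        if "U \<subseteq> T" for U
        using ninv_Un_left[of U "T - U" "S - T"] that T finite_subset[OF that T(2)]
        by (simp add: Un_absorb1)
      then show "alt (ninv T (S - T)) (f1 (weyl_mult f2 a b p N T) (c (m - p) (M - N) (S - T)))
          = (\<Sum>y\<in>parts (p, N, T). G y (rest (p, N, T) y) (rest ?X (p, N, T)))"
        unfolding weyl_mult_parts[OF T(2)]
        by (auto simp: biadditive_simps[OF assms(1)] alt_sum G_def biadditive_alt[OF assms(1)] rest_def f
          parts_def add_ac intro!: sum.cong)
    qed
    also have "\<dots> = (\<Sum>y\<in>parts ?X. \<Sum>z\<in>parts (rest ?X y). G y z (rest (rest ?X y) z))"
      by (rule parts_reindex) (use S in simp)
    also have "\<dots> = weyl_mult f3 a (weyl_mult f4 b c) m M S"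
      unfolding weyl_mult_parts[OF S]
    proof (rule sum.cong[OF refl], clarify)
      fix p N U assume x: "(p, N, U) \<in> parts ?X"
      then have T: "finite U" "finite (S - U)" using S by (auto simp: parts_def intro: finite_subset)
      have "ninv U (S - U) + ninv V (S - U - V) = ninv U V + ninv U (S - U - V) + ninv V (S - U - V)"
        if "V \<subseteq> S - U" for V
        using ninv_Un_right[of U V "S - U - V"] that T
        by (auto simp: Un_absorb1)
      then show "(\<Sum>z\<in>parts (rest ?X (p, N, U)). G (p, N, U) z (rest (rest ?X (p, N, U)) z)) =
          alt (ninv U (S - U)) (f3 (a p N U) (weyl_mult f4 b c (m - p) (M - N) (S - U)))"
        unfolding weyl_mult_parts[OF T(2)]
        by (auto simp: biadditive_simps[OF assms(2)] alt_sum G_def biadditive_alt[OF assms(2)] rest_def 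
          parts_def intro!: sum.cong)
    qed
    finally show ?thesis .
  qed simp
qed

lemma biadditive_weyl_mult:
  assumes "biadditive f" shows "biadditive (weyl_mult f)"
proof (rule biadditiveI; intro ext)
  fix a a' :: "'a weyl" and b b' :: "'b weyl" and m M and S :: "nat set"
  show "weyl_mult f (a + a') b m M S = (weyl_mult f a b + weyl_mult f a' b) m M S"
    by (cases "finite S") (auto simp: weyl_mult_parts biadditive_simps[OF assms] alt_add sum.distrib case_prod_unfold)
  show "weyl_mult f a (b + b') m M S = (weyl_mult f a b + weyl_mult f a b') m M S"
    by (cases "finite S") (auto simp: weyl_mult_parts biadditive_simps[OF assms] alt_add sum.distrib case_prod_unfold)
qed

lemma weyl_map_weyl_mult:
  assumes "additive h" "\<And>x y. h (f x y) = f' (h1 x) (h2 y)"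
  shows "weyl_map h (weyl_mult f a b) = weyl_mult f' (weyl_map h1 a) (weyl_map h2 b)"
proof (intro ext)
  interpret additive h by fact
  have h: "h (alt k x) = alt k (h x)" for k x by (simp add: alt_def minus)
  fix m M and S :: "nat set"
  show "weyl_map h (weyl_mult f a b) m M S = weyl_mult f' (weyl_map h1 a) (weyl_map h2 b) m M S"
    by (cases "finite S") (auto simp: weyl_map_def weyl_mult_parts sum h assms case_prod_unfold zero)
qed

section \<open>Leibniz rule for the symmetric insertions\<close>

section \<open>Symmetric derivatives\<close>

text \<open>The multiplicity weight removes the submultisets without \<open>i\<close> in the first
  identity, and those that use up every \<open>i\<close> in the second; the remaining ones
  correspond to submultisets of \<open>M\<close>. Constant sums stand for integer multiples, as in
  \<open>ins_sym\<close>.\<close>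

lemma sum_submultisets_insert:
  fixes h :: "'x multiset \<Rightarrow> 'x multiset \<Rightarrow> 'c::comm_monoid_add"
  shows "(\<Sum>N | N \<subseteq># add_mset i M. \<Sum>_<count N i. h N (add_mset i M - N))
    = (\<Sum>N | N \<subseteq># M. \<Sum>_\<in>{..count N i}. h (add_mset i N) (M - N))"
    (is "?L = ?R")
    and "(\<Sum>N | N \<subseteq># add_mset i M. \<Sum>_<count (add_mset i M - N) i. h N (add_mset i M - N))
    = (\<Sum>N | N \<subseteq># M. \<Sum>_\<in>{..count (M - N) i}. h N (add_mset i (M - N)))" (is "?L' = ?R'")
proof -
  have "?L = (\<Sum>N\<in>add_mset i ` {N. N \<subseteq># M}. \<Sum>_<count N i. h N (add_mset i M - N))"
  proof (rule sum.mono_neutral_right)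
    show "\<forall>N\<in>{N. N \<subseteq># add_mset i M} - add_mset i ` {N. N \<subseteq># M}. (\<Sum>_<count N i. h N (add_mset i M - N)) = 0"
    proof
      fix N assume N: "N \<in> {N. N \<subseteq># add_mset i M} - add_mset i ` {N. N \<subseteq># M}"
      have "i \<notin># N"
      proof
        assume "i \<in># N"
        then obtain N' where "N = add_mset i N'" by (meson multi_member_split)
        then show False using N by auto
      qed
      then show "(\<Sum>_<count N i. h N (add_mset i M - N)) = 0" by (simp add: not_in_iff)
    qed
  qed auto
  also have "\<dots> = ?R"
    by (subst sum.reindex) (auto simp: lessThan_Suc_atMost inj_on_def)
  finally show "?L = ?R" .
  have "?L' = (\<Sum>N | N \<subseteq># M. \<Sum>_<count (add_mset i M - N) i. h N (add_mset i M - N))"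
  proof (rule sum.mono_neutral_right)
    show "{N. N \<subseteq># M} \<subseteq> {N. N \<subseteq># add_mset i M}"
      using subset_mset.order_trans by fastforce
    show "\<forall>N\<in>{N. N \<subseteq># add_mset i M} - {N. N \<subseteq># M}. (\<Sum>_<count (add_mset i M - N) i. h N (add_mset i M - N)) = 0"
    proof
      fix N assume N: "N \<in> {N. N \<subseteq># add_mset i M} - {N. N \<subseteq># M}"
      then obtain K where K: "add_mset i M = N + K" by (auto simp: subset_mset.le_iff_add)
      have "i \<notin># K"
      proof
        assume "i \<in># K"
        then obtain K' where "K = add_mset i K'" by (meson multi_member_split)
        then show False using N K by auto
      qed
      then show "(\<Sum>_<count (add_mset i M - N) i. h N (add_mset i M - N)) = 0" 
        using K by (simp add: not_in_iff)
    qed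
  qed simp
  also have "\<dots> = ?R'"
  proof (rule sum.cong[OF refl])
    fix N assume "N \<in> {N. N \<subseteq># M}"
    then obtain K where K: "M = N + K" by (auto simp: subset_mset.le_iff_add)
    have "add_mset i M - N = add_mset i K" unfolding K
      by (metis add_diff_cancel_left' union_mset_add_mset_right)
    then show "(\<Sum>_<count (add_mset i M - N) i. h N (add_mset i M - N)) = (\<Sum>_\<in>{..count (M - N) i}. h N (add_mset i (M - N)))"
      by (simp add: K lessThan_Suc_atMost)
  qed
  finally show "?L' = ?R'" .
qed

text \<open>The multiplicity of \<open>i\<close> in \<open>add_mset i M\<close> is the sum of its
  multiplicities in the two factors.\<close>

lemma sum_submultisets_Leibniz:
  fixes h :: "'x multiset \<Rightarrow> 'x multiset \<Rightarrow> 'c::comm_monoid_add"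
  shows "(\<Sum>_\<in>{..count M i}. \<Sum>N | N \<subseteq># add_mset i M. h N (add_mset i M - N))
    = (\<Sum>N | N \<subseteq># M. \<Sum>_\<in>{..count N i}. h (add_mset i N) (M - N))
      + (\<Sum>N | N \<subseteq># M. \<Sum>_\<in>{..count (M - N) i}. h N (add_mset i (M - N)))"
proof -
  have split: "(\<Sum>_<(k::nat) + l. x) = (\<Sum>_<k. x) + (\<Sum>_<l. x)" for k l and x :: 'c
    by (induction k) (auto simp: ac_simps)
  have "(\<Sum>_\<in>{..count M i}. \<Sum>N | N \<subseteq># add_mset i M. h N (add_mset i M - N))
    = (\<Sum>N | N \<subseteq># add_mset i M. \<Sum>_<count (add_mset i M) i. h N (add_mset i M - N))"
    by (subst sum.swap) (simp add: lessThan_Suc_atMost)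
  also have "\<dots> = (\<Sum>N | N \<subseteq># add_mset i M. (\<Sum>_<count N i. h N (add_mset i M - N))
      + (\<Sum>_<count (add_mset i M - N) i. h N (add_mset i M - N)))"
    by (rule sum.cong) (auto simp: split[symmetric] subset_mset.le_iff_add simp del: count_add_mset)
  also note sum.distrib
  also note sum_submultisets_insert(1)
  also note sum_submultisets_insert(2)
  finally show ?thesis .
qed

lemma ins_sym_weyl_mult:
  assumes f: "biadditive f"
  shows "ins_sym i (weyl_mult f a b) = weyl_mult f (ins_sym i a) b + weyl_mult f a (ins_sym i b)"
proof (intro ext)
  fix m M and S :: "nat set"
  define h where "h N K = (\<Sum>p\<le>m. \<Sum>T\<in>Pow S. alt (ninv T (S - T)) (f (a p N T) (b (m - p) K (S - T))))" for N K
  have *: "weyl_mult f a b m M S = (\<Sum>N | N \<subseteq># M. h N (M - N))" for M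
    unfolding h_def weyl_mult_def sum_fun_apply ext_mult_def ext_sign_alt
    by (rule sum.swap)
  have "ins_sym i (weyl_mult f a b) m M S =  (\<Sum>N | N \<subseteq># M. \<Sum>_\<in>{..count N i}. h (add_mset i N) (M - N))
      + (\<Sum>N | N \<subseteq># M. \<Sum>_\<in>{..count (M - N) i}. h N (add_mset i (M - N)))"
    unfolding ins_sym_def * by (rule sum_submultisets_Leibniz)
  moreover have "weyl_mult f (ins_sym i a) b m M S = (\<Sum>N | N \<subseteq># M. \<Sum>_\<in>{..count N i}. h (add_mset i N) (M - N))"
  proof -
    have "(\<Sum>_\<in>{..count N i}. h (add_mset i N) K) = (\<Sum>p\<le>m. \<Sum>T\<in>Pow S. alt (ninv T (S - T)) (f (ins_sym i a p N T) (b (m - p) K (S - T))))" for N K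
      unfolding h_def ins_sym_def biadditive_simps[OF f] alt_sum
      apply (subst sum.swap, rule sum.cong[OF refl])
      apply (subst sum.swap, rule sum.cong[OF refl]) ..
    then show ?thesis
      unfolding weyl_mult_def sum_fun_apply ext_mult_def ext_sign_alt
      by (subst sum.swap) simp
  qed
  moreover have "weyl_mult f a (ins_sym i b) m M S = (\<Sum>N | N \<subseteq># M. \<Sum>_\<in>{..count (M - N) i}. h N (add_mset i (M - N)))"
  proof -
    have "(\<Sum>_\<in>{..count K i}. h N (add_mset i K)) = (\<Sum>p\<le>m. \<Sum>T\<in>Pow S. alt (ninv T (S - T)) (f (a p N T) (ins_sym i b (m - p) K (S - T))))" for N K
      unfolding h_def ins_sym_def biadditive_simps[OF f] alt_sum
      apply (subst sum.swap, rule sum.cong[OF refl])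
      apply (subst sum.swap, rule sum.cong[OF refl]) ..
    then show ?thesis
      unfolding weyl_mult_def sum_fun_apply ext_mult_def ext_sign_alt
      by (subst sum.swap) (simp del: count_diff)
  qed
  ultimately show "ins_sym i (weyl_mult f a b) m M S = (weyl_mult f (ins_sym i a) b + weyl_mult f a (ins_sym i b)) m M S"
    by simp
qed

section \<open>Multiplication by generators, insertions, and their relations\<close>

section \<open>Generators of the canonical (anti)commutation relations\<close>

definition below :: "nat \<Rightarrow> nat set \<Rightarrow> nat" where
  "below i S = card {j \<in> S. j < i}"

lemma below_insert: "j \<notin> S \<Longrightarrow> below i (insert j S) = (if j < i then Suc (below i S) else below i S)"
proof -
  assume "j \<notin> S"
  have "{k \<in> insert j S. k < i} = (if j < i then insert j {k \<in> S. k < i} else {k \<in> S. k < i})" by auto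
  then show ?thesis using \<open>j \<notin> S\<close> by (simp add: below_def)
qed

lemma below_remove: "j \<in> S \<Longrightarrow> below i S = (if j < i then Suc (below i (S - {j})) else below i (S - {j}))"
  using below_insert[of j "S - {j}" i] by (simp add: insert_absorb)

lemma below_ninv: "ninv {i} S = below i S"
  by (simp add: ninv_singleton_left below_def)

lemma below_disjoint: "finite S \<Longrightarrow> T \<subseteq> S \<Longrightarrow> below i T + below i (S - T) = below i S"
  using ninv_Un_right[of "{i}" T "S - T"] by (simp add: below_ninv Un_absorb1)

text \<open>Left exterior multiplication by the \<open>i\<close>-th generator, which has to be moved
  past the smaller ones.\<close>

definition wedge_gen :: "nat \<Rightarrow> 'c::ab_group_add ext \<Rightarrow> 'c ext" where
  "wedge_gen i P = (\<lambda>S. if i \<in> S then alt (below i S) (P (S - {i})) else 0)"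

lemma ext_insert_below: "ext_insert i P = (\<lambda>S. if i \<in> S then 0 else alt (below i S) (P (insert i S)))"
  by (auto simp: ext_insert_def ext_sign_alt below_ninv fun_eq_iff)

text \<open>The grading involution; it replaces homogeneity assumptions in the graded Leibniz
  rules.\<close>

definition parity :: "'c::ab_group_add ext \<Rightarrow> 'c ext" where
  "parity P = (\<lambda>S. alt (card S) (P S))"

definition theta :: "nat \<Rightarrow> 'c::ab_group_add weyl \<Rightarrow> 'c weyl" where
  "theta i a = (\<lambda>m M. wedge_gen i (a m M))"

definition eps :: "'c::ab_group_add weyl \<Rightarrow> 'c weyl" where
  "eps a = (\<lambda>m M. parity (a m M))"

text \<open>Multiplication by the symmetric generator \<open>i\<close>, the partner of
  \<open>ins_sym\<close> in the canonical commutation relations.\<close>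

definition ymul :: "nat \<Rightarrow> 'c::ab_group_add weyl \<Rightarrow> 'c weyl" where
  "ymul i a = (\<lambda>m M S. if i \<in># M then a m (M - {#i#}) S else 0)"

text \<open>Multiplication by t. Unlike \<open>div_t\<close> it is injective, so it is the operator
  in which identities are stated.\<close>

definition tshift :: "'c::zero weyl \<Rightarrow> 'c weyl" where
  "tshift a = (\<lambda>m. if m = 0 then 0 else a (m - 1))"

lemma wedge_gen_same: "wedge_gen i (wedge_gen i P) = 0"
  by (simp add: wedge_gen_def fun_eq_iff)

lemma wedge_gen_anticommute: "wedge_gen i (wedge_gen j P) = - wedge_gen j (wedge_gen i P)"
proof (cases "i = j")
  case False
  show ?thesis
  proof (rule ext)
    fix S
    have *: "S - {i} - {j} = S - {j} - {i}" by auto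
    show "wedge_gen i (wedge_gen j P) S = (- wedge_gen j (wedge_gen i P)) S"
      using False below_remove[of i S j] below_remove[of j S i]
      by (cases "i < j") (auto simp: wedge_gen_def * add.commute)
  qed
qed (simp add: wedge_gen_same)

lemma ext_insert_same: "ext_insert i (ext_insert i P) = 0"
  by (simp add: ext_insert_below fun_eq_iff)

lemma ext_insert_anticommute: "ext_insert i (ext_insert j P) = - ext_insert j (ext_insert i P)"
proof -
  have *: "ext_insert i (ext_insert j P) S = - ext_insert j (ext_insert i P) S" if "i < j" for i j and P :: "'a ext" and S
    using below_insert[of i S j] below_insert[of j S i] that
    by (simp add: ext_insert_below insert_commute add.commute)
  consider "i = j" | "i < j" | "j < i" by linarith
  then show ?thesis
  proof cases
    case 1
    show ?thesis unfolding 1 ext_insert_same by simp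
  next
    case 2
    show ?thesis by (rule ext, subst *[OF 2]) simp
  next
    case 3
    show ?thesis by (rule ext, simp, subst *[OF 3]) simp
  qed
qed

text \<open>For \<open>i = j\<close> only one of the two compositions can contribute at a given
  \<open>S\<close>, and the sign occurs in it twice. For \<open>i \<noteq> j\<close> exactly one of
  the two positions is shifted, by one.\<close>

lemma ext_insert_wedge_gen:
  "ext_insert i (wedge_gen j P) = (if i = j then P else 0) - wedge_gen j (ext_insert i P)"
proof (rule ext)
  fix S
  show "ext_insert i (wedge_gen j P) S = ((if i = j then P else 0) - wedge_gen j (ext_insert i P)) S"
  proof (cases "i = j")
    case True
    have double: "alt (k + k) x = x" for k and x :: 'a by (simp add: alt_def)
    show ?thesis
    proof (cases "i \<in> S")
      case inS: True
      have b: "below i (S - {i}) = below i S" using below_remove[OF inS, of i] by simp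
      have "insert i (S - {i}) = S" using inS by auto
      then show ?thesis unfolding True[symmetric] by (simp add: ext_insert_below wedge_gen_def inS b double)
    next
      case False
      have b: "below i (insert i S) = below i S" using below_insert[OF False, of i] by simp
      show ?thesis unfolding True[symmetric] by (simp add: ext_insert_below wedge_gen_def False b double)
    qed
  next
    case False
    have *: "insert i (S - {j}) = insert i S - {j}" using False by auto
    show ?thesis using False below_insert[of i S j] below_remove[of j S i] 
      by (cases "i < j") (auto simp: ext_insert_below wedge_gen_def * add.commute)
  qed
qed

lemma sum_Pow_insert:
  assumes "finite U" "i \<notin> U"
  shows "(\<Sum>T\<in>Pow (insert i U). g T) = (\<Sum>T\<in>Pow U. g T) + (\<Sum>T\<in>Pow U. g (insert i T))"
proof -
  have "inj_on (insert i) (Pow U)" using assms(2) by (auto simp: inj_on_def)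
  then show ?thesis using assms
    by (subst Pow_insert, subst sum.union_disjoint) (auto simp: sum.reindex)
qed

lemma ext_mult_infinite: "infinite S \<Longrightarrow> ext_mult f P Q S = 0"
  by (simp add: ext_mult_def)

lemma ext_mult_wedge_left:
  assumes f: "biadditive f"
  shows "ext_mult f (wedge_gen i P) Q = wedge_gen i (ext_mult f P Q)"
proof (rule ext)
  fix S
  show "ext_mult f (wedge_gen i P) Q S = wedge_gen i (ext_mult f P Q) S"
  proof (cases "finite S")
    case S: True
    show ?thesis
    proof (cases "i \<in> S")
      case False
      then show ?thesis
        by (auto simp: ext_mult_def wedge_gen_def biadditive_simps[OF f] ext_sign_alt intro!: sum.neutral)
    next
      case True
      define U where "U = S - {i}"
      have U: "S = insert i U" "i \<notin> U" "finite U" using True S by (auto simp: U_def)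
      have "ext_mult f (wedge_gen i P) Q S =
        (\<Sum>T\<in>Pow U. alt (ninv (insert i T) (U - T) + below i T) (f (P T) (Q (U - T))))"
      proof -
        have "ext_sign T (S - T) (f (wedge_gen i P T) (Q (S - T))) = 0" if "T \<in> Pow U" for T
        proof -
          have "i \<notin> T" using that U by auto
          then show ?thesis by (simp add: wedge_gen_def biadditive_simps[OF f] ext_sign_alt)
        qed
        moreover have "ext_sign (insert i T) (S - insert i T) (f (wedge_gen i P (insert i T)) (Q (S - insert i T)))
          = alt (ninv (insert i T) (U - T) + below i T) (f (P T) (Q (U - T)))" if "T \<in> Pow U" for T
        proof -
          have "i \<notin> T" "S - insert i T = U - T" using that U by auto
          then show ?thesis by (simp add: wedge_gen_def biadditive_alt[OF f] ext_sign_alt below_insert)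
        qed
        ultimately show ?thesis
          unfolding ext_mult_def U(1) sum_Pow_insert[OF U(3,2)] by simp
      qed
      also have "\<dots> = (\<Sum>T\<in>Pow U. alt (below i U + ninv T (U - T)) (f (P T) (Q (U - T))))"
      proof (rule sum.cong[OF refl])
        fix T assume "T \<in> Pow U"
        then have T: "T \<subseteq> U" "finite T" "i \<notin> T" using U by (auto intro: finite_subset)
        have "ninv (insert i T) (U - T) = below i (U - T) + ninv T (U - T)"
          using ninv_Un_left[of "{i}" T "U - T"] T by (simp add: below_ninv)
        then show "alt (ninv (insert i T) (U - T) + below i T) (f (P T) (Q (U - T))) =
          alt (below i U + ninv T (U - T)) (f (P T) (Q (U - T)))"
          using below_disjoint[OF U(3) T(1), of i] by (intro alt_cong) presburger
      qed
      also have "\<dots> = wedge_gen i (ext_mult f P Q) S"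
        using U by (simp add: wedge_gen_def ext_mult_def ext_sign_alt alt_sum below_insert)
      finally show ?thesis .
    qed
  qed (simp add: ext_mult_infinite wedge_gen_def)
qed

text \<open>Moving the generator to the front costs the degree of the left factor, which
  \<open>parity\<close> records component by component.\<close>

lemma ext_mult_wedge_right:
  assumes f: "biadditive f"
  shows "ext_mult f P (wedge_gen i Q) = wedge_gen i (ext_mult f (parity P) Q)"
proof (rule ext)
  fix S
  show "ext_mult f P (wedge_gen i Q) S = wedge_gen i (ext_mult f (parity P) Q) S"
  proof (cases "finite S")
    case S: True
    show ?thesis
    proof (cases "i \<in> S")
      case False
      then show ?thesis
        by (auto simp: ext_mult_def wedge_gen_def biadditive_simps[OF f] ext_sign_alt intro!: sum.neutral)
    next
      case True
      define U where "U = S - {i}"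
      have U: "S = insert i U" "i \<notin> U" "finite U" using True S by (auto simp: U_def)
      have "ext_mult f P (wedge_gen i Q) S =
        (\<Sum>T\<in>Pow U. alt (ninv T (insert i (U - T)) + below i (U - T)) (f (P T) (Q (U - T))))"
      proof -
        have "ext_sign T (S - T) (f (P T) (wedge_gen i Q (S - T))) =
          alt (ninv T (insert i (U - T)) + below i (U - T)) (f (P T) (Q (U - T)))" if "T \<in> Pow U" for T
        proof -
          have "S - T = insert i (U - T)" "i \<notin> U - T" using that U by auto
          then show ?thesis by (simp add: wedge_gen_def biadditive_alt[OF f] ext_sign_alt below_insert)
        qed
        moreover have "ext_sign (insert i T) (S - insert i T) (f (P (insert i T)) (wedge_gen i Q (S - insert i T)))
          = 0" if "T \<in> Pow U" for T
          by (simp add: wedge_gen_def biadditive_simps[OF f] ext_sign_alt)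
        ultimately show ?thesis
          unfolding ext_mult_def U(1) sum_Pow_insert[OF U(3,2)] by simp
      qed
      also have "\<dots> = (\<Sum>T\<in>Pow U. alt (below i U + ninv T (U - T) + card T) (f (P T) (Q (U - T))))"
      proof (rule sum.cong[OF refl])
        fix T assume "T \<in> Pow U"
        then have T: "T \<subseteq> U" "finite T" "i \<notin> T" using U by (auto intro: finite_subset)
        have "ninv T (insert i (U - T)) = ninv T {i} + ninv T (U - T)"
          using ninv_Un_right[of T "{i}" "U - T"] T U by simp
        moreover have "ninv T {i} + below i T = card T"
          using ninv_swap[of T "{i}"] T by (simp add: below_ninv)
        ultimately show "alt (ninv T (insert i (U - T)) + below i (U - T)) (f (P T) (Q (U - T))) =
          alt (below i U + ninv T (U - T) + card T) (f (P T) (Q (U - T)))"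
          using below_disjoint[OF U(3) T(1), of i] by (intro alt_cong) presburger
      qed
      also have "\<dots> = wedge_gen i (ext_mult f (parity P) Q) S"
        using U by (simp add: wedge_gen_def ext_mult_def ext_sign_alt alt_sum below_insert parity_def biadditive_alt[OF f]
            add_ac)
      finally show ?thesis .
    qed
  qed (simp add: ext_mult_infinite wedge_gen_def)
qed

text \<open>If \<open>i\<close> lies in \<open>S\<close>, the two summands on the right cancel.
  Otherwise the subsets of \<open>insert i S\<close> with and without \<open>i\<close> account for
  one summand each.\<close>

lemma ext_insert_ext_mult:
  assumes f: "biadditive f"
  shows "ext_insert i (ext_mult f P Q) = ext_mult f (ext_insert i P) Q + ext_mult f (parity P) (ext_insert i Q)"
proof (rule ext)
  fix S
  show "ext_insert i (ext_mult f P Q) S = (ext_mult f (ext_insert i P) Q + ext_mult f (parity P) (ext_insert i Q)) S"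
  proof (cases "finite S")
    case S: True
    show ?thesis
    proof (cases "i \<in> S")
      case True
      define U where "U = S - {i}"
      have U: "S = insert i U" "i \<notin> U" "finite U" using True S by (auto simp: U_def)
      have "ext_mult f (ext_insert i P) Q S =
        (\<Sum>T\<in>Pow U. alt (card T + ninv T (U - T)) (f (P (insert i T)) (Q (insert i (U - T)))))"
      proof -
        have "ext_sign T (S - T) (f (ext_insert i P T) (Q (S - T))) =
          alt (card T + ninv T (U - T)) (f (P (insert i T)) (Q (insert i (U - T))))" if "T \<in> Pow U" for T
        proof -
          have T: "S - T = insert i (U - T)" "i \<notin> T" "finite T" using that U by (auto intro: finite_subset)
          have "ninv T (insert i (U - T)) = ninv T {i} + ninv T (U - T)"
            using ninv_Un_right[of T "{i}" "U - T"] T U by simp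
          moreover have "ninv T {i} + below i T = card T"
            using ninv_swap[of T "{i}"] T by (simp add: below_ninv)
          ultimately show ?thesis unfolding T(1) using T(2)
            by (simp add: ext_insert_below biadditive_alt[OF f] ext_sign_alt) (rule alt_cong, presburger)
        qed
        moreover have "ext_sign (insert i T) (S - insert i T) (f (ext_insert i P (insert i T)) (Q (S - insert i T)))
          = 0" for T
          by (simp add: ext_insert_below biadditive_simps[OF f] ext_sign_alt)
        ultimately show ?thesis
          unfolding ext_mult_def U(1) sum_Pow_insert[OF U(3,2)] by simp
      qed
      moreover have "ext_mult f (parity P) (ext_insert i Q) S =
        (\<Sum>T\<in>Pow U. - alt (card T + ninv T (U - T)) (f (P (insert i T)) (Q (insert i (U - T)))))"
      proof -
        have "ext_sign (insert i T) (S - insert i T) (f (parity P (insert i T)) (ext_insert i Q (S - insert i T))) =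
          - alt (card T + ninv T (U - T)) (f (P (insert i T)) (Q (insert i (U - T))))" if "T \<in> Pow U" for T
        proof -
          have T: "S - insert i T = U - T" "i \<notin> T" "i \<notin> U - T" "finite T" using that U by (auto intro: finite_subset)
          have "ninv (insert i T) (U - T) = below i (U - T) + ninv T (U - T)"
            using ninv_Un_left[of "{i}" T "U - T"] T by (simp add: below_ninv)
          then show ?thesis unfolding T(1) using T(2-4)
            by (simp add: ext_insert_below biadditive_alt[OF f] biadditive_simps[OF f] ext_sign_alt parity_def) (rule alt_cong, presburger)
        qed
        moreover have "ext_sign T (S - T) (f (parity P T) (ext_insert i Q (S - T))) = 0" if "T \<in> Pow U" for T
        proof -
          have "i \<in> S - T" using that U by auto
          then show ?thesis by (simp add: ext_insert_below biadditive_simps[OF f] ext_sign_alt)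
        qed
        ultimately show ?thesis
          unfolding ext_mult_def U(1) sum_Pow_insert[OF U(3,2)] by simp
      qed
      ultimately show ?thesis using True by (simp add: sum_negf ext_insert_below)
    next
      case False
      have "ext_insert i (ext_mult f P Q) S = alt (below i S) (\<Sum>T\<in>Pow (insert i S). alt (ninv T (insert i S - T)) (f (P T) (Q (insert i S - T))))"
        using False by (simp add: ext_insert_below ext_mult_def ext_sign_alt)
      also have "\<dots> = (\<Sum>T\<in>Pow S. alt (below i S + ninv T (insert i (S - T))) (f (P T) (Q (insert i (S - T)))))
        + (\<Sum>T\<in>Pow S. alt (below i S + ninv (insert i T) (S - T)) (f (P (insert i T)) (Q (S - T))))"
        unfolding sum_Pow_insert[OF S False] alt_add alt_sum
        using False by (intro arg_cong2[where f = "(+)"] sum.cong refl) (auto simp: insert_Diff_if)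
      also have "(\<Sum>T\<in>Pow S. alt (below i S + ninv T (insert i (S - T))) (f (P T) (Q (insert i (S - T)))))
        = ext_mult f (parity P) (ext_insert i Q) S"
        unfolding ext_mult_def
      proof (rule sum.cong[OF refl])
        fix T assume "T \<in> Pow S"
        then have T: "T \<subseteq> S" "finite T" "i \<notin> T" using S False by (auto intro: finite_subset)
        have "ninv T (insert i (S - T)) = ninv T {i} + ninv T (S - T)"
          using ninv_Un_right[of T "{i}" "S - T"] T False by simp
        moreover have "ninv T {i} + below i T = card T"
          using ninv_swap[of T "{i}"] T by (simp add: below_ninv)
        ultimately show "alt (below i S + ninv T (insert i (S - T))) (f (P T) (Q (insert i (S - T)))) =
          ext_sign T (S - T) (f (parity P T) (ext_insert i Q (S - T)))"
          using below_disjoint[OF S T(1), of i] False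
          by (auto simp: ext_sign_alt ext_insert_below parity_def biadditive_alt[OF f] intro!: alt_cong) presburger+
      qed
      also have "(\<Sum>T\<in>Pow S. alt (below i S + ninv (insert i T) (S - T)) (f (P (insert i T)) (Q (S - T))))
        = ext_mult f (ext_insert i P) Q S"
        unfolding ext_mult_def
      proof (rule sum.cong[OF refl])
        fix T assume "T \<in> Pow S"
        then have T: "T \<subseteq> S" "finite T" "i \<notin> T" using S False by (auto intro: finite_subset)
        have "ninv (insert i T) (S - T) = below i (S - T) + ninv T (S - T)"
          using ninv_Un_left[of "{i}" T "S - T"] T by (simp add: below_ninv)
        then show "alt (below i S + ninv (insert i T) (S - T)) (f (P (insert i T)) (Q (S - T))) =
          ext_sign T (S - T) (f (ext_insert i P T) (Q (S - T)))"
          using below_disjoint[OF S T(1), of i] T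
          by (auto simp: ext_sign_alt ext_insert_below parity_def biadditive_alt[OF f] intro!: alt_cong) presburger+
      qed
      finally show ?thesis by simp
    qed
  qed (simp add: ext_mult_infinite ext_insert_below)
qed

lemma parity_ext_mult:
  assumes f: "biadditive f"
  shows "parity (ext_mult f P Q) = ext_mult f (parity P) (parity Q)"
proof (rule ext)
  fix S
  show "parity (ext_mult f P Q) S = ext_mult f (parity P) (parity Q) S"
  proof (cases "finite S")
    case True
    have "card T + card (S - T) = card S" if "T \<subseteq> S" for T
      using card_Diff_subset[OF finite_subset[OF that True] that] card_mono[OF True that] by simp
    then show ?thesis
      by (auto simp: parity_def ext_mult_def alt_sum biadditive_alt[OF f] ext_sign_alt add_ac intro!: sum.cong)
         (metis add.commute add.left_commute)
  qed (simp add: ext_mult_infinite parity_def)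
qed

text \<open>Graded commutativity. Only the left factor has to be homogeneous, since the sign of the
  right one is applied coefficientwise; the coefficient map is flipped because coefficients need not
  commute.\<close>

lemma ext_mult_swap:
  assumes f: "biadditive f" and P: "\<And>S. P S \<noteq> 0 \<Longrightarrow> card S = k"
  shows "ext_mult f P Q = ext_mult (\<lambda>x y. f y x) (\<lambda>S. alt (k * card S) (Q S)) P"
proof (rule ext)
  fix S
  show "ext_mult f P Q S = ext_mult (\<lambda>x y. f y x) (\<lambda>S. alt (k * card S) (Q S)) P S"
  proof (cases "finite S")
    case True
    show ?thesis unfolding ext_mult_def
    proof (rule sum.reindex_bij_witness[of _ "\<lambda>T. S - T" "\<lambda>T. S - T"])
      fix T assume "T \<in> Pow S"
      then have T: "T \<subseteq> S" "finite T" "S - (S - T) = T" using True by (auto intro: finite_subset)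
      show "ext_sign (S - T) (S - (S - T)) (f (P (S - (S - T))) (alt (k * card (S - T)) (Q (S - T)))) =
         ext_sign T (S - T) (f (P T) (Q (S - T)))"
      proof (cases "P T = 0")
        case False
        with P have "card T = k" by blast
        then have "ninv T (S - T) + ninv (S - T) T = k * card (S - T)"
          using ninv_swap[of T "S - T"] T True by auto
        then show ?thesis by (simp add: T(3) ext_sign_alt biadditive_alt[OF f]) (rule alt_cong, presburger)
      qed (simp add: T(3) biadditive_simps[OF f] ext_sign_alt)
    qed auto
  qed (simp add: ext_mult_infinite)
qed

section \<open>Generators acting on products, and operators acting on each power of t
  separately\<close>

section \<open>Operators on the Weyl algebra\<close>

lemma weyl_mult_sum_ext:
  "weyl_mult f a b m M = (\<Sum>p\<le>m. \<Sum>N | N \<subseteq># M. ext_mult f (a p N) (b (m - p) (M - N)))"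
  by (simp add: weyl_mult_def)

lemma additive_wedge_gen: "additive (wedge_gen i)"
  by (auto simp: additive_def wedge_gen_def alt_add fun_eq_iff)

lemma additive_ext_insert: "additive (ext_insert i)"
  by (auto simp: additive_def ext_insert_below alt_add fun_eq_iff)

lemma additive_parity: "additive parity"
  by (auto simp: additive_def parity_def alt_add fun_eq_iff)

lemma theta_weyl_mult_left: 
  assumes "biadditive f" shows "weyl_mult f (theta i a) b = theta i (weyl_mult f a b)"
  by (simp add: fun_eq_iff theta_def weyl_mult_sum_ext additive.sum[OF additive_wedge_gen] ext_mult_wedge_left[OF assms])

lemma theta_weyl_mult_right: 
  assumes "biadditive f" shows "weyl_mult f a (theta i b) = theta i (weyl_mult f (eps a) b)"
  by (simp add: fun_eq_iff theta_def eps_def weyl_mult_sum_ext additive.sum[OF additive_wedge_gen] ext_mult_wedge_right[OF assms])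

lemma ins_asym_weyl_mult: 
  assumes "biadditive f"
  shows "ins_asym i (weyl_mult f a b) = weyl_mult f (ins_asym i a) b + weyl_mult f (eps a) (ins_asym i b)"
  by (simp add: fun_eq_iff ins_asym_def eps_def weyl_mult_sum_ext additive.sum[OF additive_ext_insert]
      ext_insert_ext_mult[OF assms] sum.distrib)

lemma eps_weyl_mult: 
  assumes "biadditive f"
  shows "eps (weyl_mult f a b) = weyl_mult f (eps a) (eps b)"
  by (simp add: fun_eq_iff eps_def weyl_mult_sum_ext additive.sum[OF additive_parity] parity_ext_mult[OF assms])

lemma double_diff_mset: "N \<subseteq># M \<Longrightarrow> M - (M - N) = N"
  by (simp add: multiset_eq_iff subseteq_mset_def)

lemma sum_submultisets_reflect: "(\<Sum>N | N \<subseteq># M. h N (M - N)) = (\<Sum>N | N \<subseteq># M. h (M - N) N)"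
  by (rule sum.reindex_bij_witness[of _ "\<lambda>N. M - N" "\<lambda>N. M - N"]) (auto simp: double_diff_mset)

lemma weyl_mult_swap:
  assumes f: "biadditive f" and a: "\<And>m M S. a m M S \<noteq> 0 \<Longrightarrow> card S = k"
  shows "weyl_mult f a b = weyl_mult (\<lambda>x y. f y x) (\<lambda>m M S. alt (k * card S) (b m M S)) a"
proof (intro ext)
  fix m M S
  let ?b = "\<lambda>m M S. alt (k * card S) (b m M S)"
  have *: "ext_mult f (a p N) Q = ext_mult (\<lambda>x y. f y x) (\<lambda>S. alt (k * card S) (Q S)) (a p N)" for p N Q
    by (rule ext_mult_swap[OF f]) (use a in blast)
  have "weyl_mult f a b m M = (\<Sum>p\<le>m. \<Sum>N | N \<subseteq># M. ext_mult (\<lambda>x y. f y x) (?b (m - p) (M - N)) (a p N))"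
    unfolding weyl_mult_sum_ext * ..
  also have "\<dots> = (\<Sum>p\<le>m. \<Sum>N | N \<subseteq># M. ext_mult (\<lambda>x y. f y x) (?b (m - p) N) (a p (M - N)))"
    by (rule sum.cong[OF refl], rule sum_submultisets_reflect[symmetric])
  also have "\<dots> = weyl_mult (\<lambda>x y. f y x) ?b a m M"
    unfolding weyl_mult_sum_ext
    by (rule sum.reindex_bij_witness[of _ "\<lambda>p. m - p" "\<lambda>p. m - p"]) auto
  finally show "weyl_mult f a b m M S = weyl_mult (\<lambda>x y. f y x) ?b a m M S" by simp
qed

lemma sum_submultisets_remove:
  fixes h :: "'x multiset \<Rightarrow> 'x multiset \<Rightarrow> 'c::comm_monoid_add"
  shows "(\<Sum>N | N \<subseteq># M. if i \<in># N then h (N - {#i#}) (M - N) else 0)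
    = (if i \<in># M then \<Sum>N | N \<subseteq># M - {#i#}. h N (M - {#i#} - N) else 0)"
proof (cases "i \<in># M")
  case False
  then have "i \<notin># N" if "N \<subseteq># M" for N using that by (meson mset_subset_eqD)
  then show ?thesis using False by (auto intro!: sum.neutral)
next
  case True
  then obtain M' where M: "M = add_mset i M'" by (meson multi_member_split)
  have "(\<Sum>N | N \<subseteq># M. if i \<in># N then h (N - {#i#}) (M - N) else 0)
    = (\<Sum>N\<in>add_mset i ` {N. N \<subseteq># M'}. if i \<in># N then h (N - {#i#}) (M - N) else 0)"
  proof (rule sum.mono_neutral_right)
    show "\<forall>N\<in>{N. N \<subseteq># M} - add_mset i ` {N. N \<subseteq># M'}. (if i \<in># N then h (N - {#i#}) (M - N) else 0) = 0"
    proof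
      fix N assume N: "N \<in> {N. N \<subseteq># M} - add_mset i ` {N. N \<subseteq># M'}"
      have "i \<notin># N"
      proof
        assume "i \<in># N"
        then obtain N' where "N = add_mset i N'" by (meson multi_member_split)
        then show False using N by (auto simp: M)
      qed
      then show "(if i \<in># N then h (N - {#i#}) (M - N) else 0) = 0" by simp
    qed
  qed (auto simp: M)
  also have "\<dots> = (\<Sum>N | N \<subseteq># M'. h N (M' - N))"
    by (subst sum.reindex) (auto simp: inj_on_def M)
  finally show ?thesis by (simp add: M)
qed

lemma ymul_apply: "ymul i a m M = (if i \<in># M then a m (M - {#i#}) else 0)"
  by (auto simp: ymul_def)

lemma ext_mult_zero:
  assumes "biadditive f" shows "ext_mult f 0 Q = 0" "ext_mult f P 0 = 0"
  by (auto simp: ext_mult_def biadditive_simps[OF assms] ext_sign_alt fun_eq_iff)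

lemma ymul_weyl_mult_left:
  assumes "biadditive f" shows "weyl_mult f (ymul i a) b = ymul i (weyl_mult f a b)"
proof (intro ext)
  fix m M S
  have *: "ext_mult f (ymul i a p N) Q = (if i \<in># N then ext_mult f (a p (N - {#i#})) Q else 0)" for p N Q
    by (simp add: ymul_apply ext_mult_zero[OF assms])
  have "weyl_mult f (ymul i a) b m M = ymul i (weyl_mult f a b) m M"
    unfolding weyl_mult_sum_ext ymul_apply[of i "weyl_mult f a b"] *
    by (subst sum_submultisets_remove) auto
  then show "weyl_mult f (ymul i a) b m M S = ymul i (weyl_mult f a b) m M S" by simp
qed

lemma ymul_weyl_mult_right:
  assumes "biadditive f" shows "weyl_mult f a (ymul i b) = ymul i (weyl_mult f a b)"
proof (intro ext)
  fix m M S
  have *: "ext_mult f P (ymul i b p N) = (if i \<in># N then ext_mult f P (b p (N - {#i#})) else 0)" for p N P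
    by (simp add: ymul_apply ext_mult_zero[OF assms])
  have r: "(\<Sum>N | N \<subseteq># M. ext_mult f (a p N) (ymul i b q (M - N))) =
    (\<Sum>N | N \<subseteq># M. ext_mult f (a p (M - N)) (ymul i b q N))" for p q
    by (rule sum_submultisets_reflect)
  have r': "(\<Sum>N | N \<subseteq># K. ext_mult f (a p N) (b q (K - N))) =
    (\<Sum>N | N \<subseteq># K. ext_mult f (a p (K - N)) (b q N))" for p q K
    by (rule sum_submultisets_reflect)
  have "weyl_mult f a (ymul i b) m M = ymul i (weyl_mult f a b) m M"
    unfolding weyl_mult_sum_ext ymul_apply[of i "weyl_mult f a b"] unfolding r r' unfolding *
    by (subst sum_submultisets_remove) auto
  then show "weyl_mult f a (ymul i b) m M S = ymul i (weyl_mult f a b) m M S" by simp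
qed

lemma tshift_weyl_mult_left: 
  assumes "biadditive f" shows "weyl_mult f (tshift a) b = tshift (weyl_mult f a b)"
proof (intro ext)
  fix m M S
  show "weyl_mult f (tshift a) b m M S = tshift (weyl_mult f a b) m M S"
    by (cases m) (simp_all add: tshift_def weyl_mult_sum_ext sum.atMost_Suc_shift ext_mult_zero[OF assms] sum_fun_apply
       del: sum.atMost_Suc)
qed

lemma tshift_weyl_mult_right: 
  assumes "biadditive f" shows "weyl_mult f a (tshift b) = tshift (weyl_mult f a b)"
proof (intro ext)
  fix m M S
  show "weyl_mult f a (tshift b) m M S = tshift (weyl_mult f a b) m M S"
    by (cases m) (auto simp add: tshift_def weyl_mult_sum_ext ext_mult_zero[OF assms] sum_fun_apply Suc_diff_le
       intro!: sum.cong)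
qed

lemma weyl_mult_const_left:
  assumes f: "biadditive f" and S: "finite S"
  shows "weyl_mult f (weyl_const \<xi>) a m M S = (\<Sum>p\<le>m. f (fps_nth \<xi> p) (a (m - p) M S))"
proof -
  have 1: "ext_mult f (weyl_const \<xi> p N) Q S = (if N = {#} then f (fps_nth \<xi> p) (Q S) else 0)" for p N Q
  proof -
    have "ext_mult f (weyl_const \<xi> p N) Q S = (\<Sum>T\<in>Pow S. if T = {} then if N = {#} then f (fps_nth \<xi> p) (Q S) else 0 else 0)"
      unfolding ext_mult_def
      by (rule sum.cong) (auto simp: weyl_const_def biadditive_simps[OF f] ext_sign_alt ninv_def)
    then show ?thesis using S by (simp add: sum.delta)
  qed
  show ?thesis unfolding weyl_mult_sum_ext sum_fun_apply 1
    by (simp add: sum.delta)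
qed

lemma theta_anticommute: "theta i (theta j a) = - theta j (theta i a)"
  by (simp add: theta_def fun_eq_iff) (simp add: wedge_gen_anticommute[of i j])

lemma ins_asym_anticommute: "ins_asym i (ins_asym j a) = - ins_asym j (ins_asym i a)"
  by (simp add: ins_asym_def fun_eq_iff) (simp add: ext_insert_anticommute[of i j])

lemma ins_asym_theta: "ins_asym i (theta j a) = (if i = j then a else 0) - theta j (ins_asym i a)"
  by (auto simp: ins_asym_def theta_def fun_eq_iff ext_insert_wedge_gen)

lemma in_remove1_mset: "i \<noteq> j \<Longrightarrow> j \<in># M - {#i#} \<longleftrightarrow> j \<in># M"
  by (simp add: in_diff_count)

lemma ymul_commute: "ymul i (ymul j a) = ymul j (ymul i a)"
  by (cases "i = j", simp) (simp add: ymul_def fun_eq_iff diff_right_commute in_remove1_mset add_mset_commute)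

lemma ins_sym_commute: "ins_sym i (ins_sym j a) = ins_sym j (ins_sym i a)"
  by (cases "i = j") (auto simp: ins_sym_def fun_eq_iff add_mset_commute intro: sum.swap)

lemma ins_sym_ymul: "ins_sym i (ymul j a) = (if i = j then a else 0) + ymul j (ins_sym i a)"
proof (intro ext)
  fix m M S
  show "ins_sym i (ymul j a) m M S = ((if i = j then a else 0) + ymul j (ins_sym i a)) m M S"
  proof (cases "j \<in># M")
    case True
    then obtain M' where M: "M = add_mset j M'" by (meson multi_member_split)
    then show ?thesis by (auto simp: ins_sym_def ymul_def add_mset_commute)
  next
    case False
    then have "count M j = 0" by (simp add: not_in_iff)
    then show ?thesis using False by (simp add: ins_sym_def ymul_def)
  qed
qed

lemma theta_ymul: "theta i (ymul j a) = ymul j (theta i a)"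
  by (auto simp: theta_def ymul_def wedge_gen_def fun_eq_iff)

lemma theta_ins_sym: "theta i (ins_sym j a) = ins_sym j (theta i a)"
  by (auto simp: theta_def ins_sym_def wedge_gen_def fun_eq_iff alt_sum)

lemma ins_asym_ymul: "ins_asym i (ymul j a) = ymul j (ins_asym i a)"
  by (auto simp: ins_asym_def ymul_def ext_insert_below fun_eq_iff)

lemma ins_asym_ins_sym: "ins_asym i (ins_sym j a) = ins_sym j (ins_asym i a)"
  by (auto simp: ins_asym_def ins_sym_def ext_insert_below fun_eq_iff alt_sum)

lemma eps_ymul: "eps (ymul i a) = ymul i (eps a)"
  by (auto simp: eps_def parity_def ymul_def fun_eq_iff)

lemma eps_ins_sym: "eps (ins_sym i a) = ins_sym i (eps a)"
  by (auto simp: eps_def parity_def ins_sym_def fun_eq_iff alt_sum)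

lemma eps_eps: "eps (eps a) = a"
  by (auto simp: eps_def parity_def fun_eq_iff alt_def)

lemma tshift_commute:
  "theta i (tshift a) = tshift (theta i a)" "ins_asym i (tshift a) = tshift (ins_asym i a)"
  "ymul i (tshift a) = tshift (ymul i a)" "ins_sym i (tshift a) = tshift (ins_sym i a)"
  "eps (tshift a) = tshift (eps a)"
  by (auto simp: theta_def ins_asym_def ymul_def ins_sym_def eps_def parity_def tshift_def wedge_gen_def
      ext_insert_below fun_eq_iff)

lemma tshift_inject [simp]: "tshift a = tshift b \<longleftrightarrow> a = b"
proof
  assume "tshift a = tshift b"
  then have "tshift a (Suc m) = tshift b (Suc m)" for m by simp
  then show "a = b" by (simp add: tshift_def fun_eq_iff)
qed simp

lemma tshift_div_t: "a 0 = 0 \<Longrightarrow> tshift (div_t a) = a"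
  by (auto simp: tshift_def div_t_def fun_eq_iff)

lemma tshift_funpow: "(tshift ^^ l) a p = (if l \<le> p then a (p - l) else 0)"
proof (induction l arbitrary: p)
  case (Suc l)
  then show ?case by (cases p) (auto simp: tshift_def)
qed simp

lemma additive_operators:
  "additive (theta i)" "additive (ins_asym i)" "additive (ymul i)" "additive (ins_sym i)"
  "additive eps" "additive tshift"
  by (auto simp: additive_def theta_def ins_asym_def ymul_def ins_sym_def eps_def parity_def tshift_def wedge_gen_def
      ext_insert_below fun_eq_iff alt_add sum.distrib)

lemmas operator_zero = additive_operators[THEN additive.zero]
lemmas operator_add = additive_operators[THEN additive.add]
lemmas operator_minus = additive_operators[THEN additive.minus]
lemmas operator_diff = additive_operators[THEN additive.diff]
lemmas operator_sum = additive_operators[THEN additive.sum]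

lemma tshift_zero_iff: "tshift (a :: 'c::ab_group_add weyl) = 0 \<longleftrightarrow> a = 0"
  using tshift_inject[of a 0] by (simp add: operator_zero del: tshift_inject)

lemma weyl_map_commute:
  assumes "additive h"
  shows "theta i (weyl_map h a) = weyl_map h (theta i a)" "ins_asym i (weyl_map h a) = weyl_map h (ins_asym i a)"
  "ymul i (weyl_map h a) = weyl_map h (ymul i a)" "ins_sym i (weyl_map h a) = weyl_map h (ins_sym i a)"
  "eps (weyl_map h a) = weyl_map h (eps a)" "tshift (weyl_map h a) = weyl_map h (tshift a)"
proof -
  interpret additive h by fact
  have alt: "alt k (h x) = h (alt k x)" for k x by (simp add: alt_def minus)
  show "theta i (weyl_map h a) = weyl_map h (theta i a)" "ins_asym i (weyl_map h a) = weyl_map h (ins_asym i a)"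
  "ymul i (weyl_map h a) = weyl_map h (ymul i a)" "ins_sym i (weyl_map h a) = weyl_map h (ins_sym i a)"
  "eps (weyl_map h a) = weyl_map h (eps a)" "tshift (weyl_map h a) = weyl_map h (tshift a)"
  by (auto simp: theta_def ins_asym_def ymul_def ins_sym_def eps_def parity_def tshift_def wedge_gen_def weyl_map_def
      ext_insert_below fun_eq_iff alt zero sum)
qed

lemma additive_weyl_map:
  assumes "additive h" shows "additive (weyl_map h)"
  using assms by (auto simp: additive_def weyl_map_def fun_eq_iff)

text \<open>Operators that act on the coefficient of each power of t by one and the same additive
  map, compatibly with scalars. Such operators commute with t and can be carried through the series
  in t that defines \<open>circ\<close>.\<close>

definition slicewise :: "('r \<Rightarrow> 'c \<Rightarrow> 'c) \<Rightarrow> ('c::ab_group_add weyl \<Rightarrow> 'c weyl) \<Rightarrow> bool" where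
  "slicewise sc X \<longleftrightarrow> additive X \<and> (\<forall>a b m m'. a m = b m' \<longrightarrow> X a m = X b m') \<and>
     (\<forall>c a. X (weyl_map (sc c) a) = weyl_map (sc c) (X a))"

lemma slicewiseI:
  assumes "additive X" "\<And>a b m m'. a m = b m' \<Longrightarrow> X a m = X b m'"
    "\<And>c a. X (weyl_map (sc c) a) = weyl_map (sc c) (X a)"
  shows "slicewise sc X"
  using assms unfolding slicewise_def by blast

lemma slicewiseD:
  assumes "slicewise sc X"
  shows "additive X" "a m = b m' \<Longrightarrow> X a m = X b m'" "X (weyl_map (sc c) a) = weyl_map (sc c) (X a)"
  using assms unfolding slicewise_def by blast+

lemma slicewise_operators:
  fixes sc :: "'r::comm_ring_1 \<Rightarrow> 'c::ab_group_add \<Rightarrow> 'c"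
  assumes "module sc"
  shows "slicewise sc (theta i)" "slicewise sc (ins_asym i)" "slicewise sc (ymul i)" "slicewise sc (ins_sym i)"
    "slicewise sc eps"
proof -
  interpret module sc by fact
  have a: "additive (sc c)" for c by (simp add: additive_def scale_right_distrib)
  note [simp] = additive_operators weyl_map_commute[OF a]
  show "slicewise sc (theta i)" by (rule slicewiseI) (simp, simp add: theta_def, simp)
  show "slicewise sc (ins_asym i)" by (rule slicewiseI) (simp, simp add: ins_asym_def, simp)
  show "slicewise sc (ins_sym i)" by (rule slicewiseI) (simp, simp add: ins_sym_def, simp)
  show "slicewise sc eps" by (rule slicewiseI) (simp, simp add: eps_def, simp)
  show "slicewise sc (ymul i)" 
  proof (rule slicewiseI)
    show "ymul i a m = ymul i b m'" if "a m = b m'" for a b :: "'c weyl" and m m'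
      by (rule ext) (simp add: ymul_apply that)
  qed simp_all
qed

lemma slicewise_weyl_map:
  assumes "additive h" "\<And>c x. h (sc c x) = sc c (h x)"
  shows "slicewise sc (weyl_map h)"
  by (rule slicewiseI) (simp_all add: assms additive_weyl_map, simp_all add: weyl_map_def assms)

lemma slicewise_comp:
  assumes "slicewise sc X" "slicewise sc Y" shows "slicewise sc (\<lambda>a. X (Y a))"
proof (rule slicewiseI)
  show "additive (\<lambda>a. X (Y a))"
    using slicewiseD(1)[OF assms(1)] slicewiseD(1)[OF assms(2)] by (simp add: additive_def)
  show "X (Y a) m = X (Y b) m'" if "a m = b m'" for a b m m'
    by (rule slicewiseD(2)[OF assms(1)], rule slicewiseD(2)[OF assms(2)], rule that)
  show "X (Y (weyl_map (sc c) a)) = weyl_map (sc c) (X (Y a))" for c a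
    by (simp only: slicewiseD(3)[OF assms(1)] slicewiseD(3)[OF assms(2)])
qed

lemma slicewise_add:
  assumes "module sc" "slicewise sc X" "slicewise sc Y" shows "slicewise sc (\<lambda>a. X a + Y a)"
proof (rule slicewiseI)
  interpret module sc by fact
  show "additive (\<lambda>a. X a + Y a)"
    using slicewiseD(1)[OF assms(2)] slicewiseD(1)[OF assms(3)] by (simp add: additive_def add_ac)
  show "(X a + Y a) m = (X b + Y b) m'" if "a m = b m'" for a b m m'
    using slicewiseD(2)[where a = a and m = m and b = b and m' = m', OF assms(2) that]
      slicewiseD(2)[where a = a and m = m and b = b and m' = m', OF assms(3) that] by simp
  have "weyl_map (sc c) (a + b) = weyl_map (sc c) a + weyl_map (sc c) b" for c a b
    by (simp add: weyl_map_def fun_eq_iff scale_right_distrib)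
  then show "X (weyl_map (sc c) a) + Y (weyl_map (sc c) a) = weyl_map (sc c) (X a + Y a)" for c a
    by (simp only: slicewiseD(3)[OF assms(2)] slicewiseD(3)[OF assms(3)])
qed

lemma slicewise_zero: "module sc \<Longrightarrow> slicewise sc (\<lambda>a. 0)"
  by (rule slicewiseI) (simp_all add: additive_def weyl_map_def fun_eq_iff module.scale_zero_right)

lemma slicewise_sum:
  assumes "module sc" "\<And>i. i \<in> I \<Longrightarrow> slicewise sc (X i)" shows "slicewise sc (\<lambda>a. \<Sum>i\<in>I. X i a)"
  using assms(2)
proof (induction I rule: infinite_finite_induct)
  case (insert i I)
  then show ?case using slicewise_add[OF assms(1), of "X i" "\<lambda>a. \<Sum>i\<in>I. X i a"]
    by (simp only: sum.insert insertI1 insertI2 simp_thms)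
qed (simp_all add: slicewise_zero[OF assms(1)])

lemma slicewise_tshift:
  assumes "slicewise sc X" shows "X (tshift a) = tshift (X a)"
proof (rule ext)
  fix m
  have X: "X a m = X b m'" if "a m = b m'" for a b m m'
    by (rule slicewiseD(2)[where a = a and m = m and b = b and m' = m', OF assms that])
  have X0: "X 0 = 0" by (rule additive.zero[OF slicewiseD(1)[OF assms]])
  show "X (tshift a) m = tshift (X a) m"
  proof (cases m)
    case 0
    have "X (tshift a) 0 = X 0 0" by (rule X) (simp add: tshift_def)
    then show ?thesis using 0 X0 by (simp add: tshift_def)
  next
    case (Suc k)
    have "X (tshift a) (Suc k) = X a k" by (rule X) (simp add: tshift_def)
    then show ?thesis using Suc by (simp add: tshift_def)
  qed
qed

section \<open>The fibrewise product and its associativity\<close>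

section \<open>The deformed product\<close>

text \<open>The algebra product is a parameter \<open>f\<close> with unit \<open>u\<close>, not a
  type class operation, so that both the ground ring and the unitization on a product type are
  instances.\<close>

locale fedosov_algebra = fedosov q scG br n e r s nabla Omega + B: module sc
  for q :: "rat \<Rightarrow> 'r::comm_ring_1"
    and scG :: "'r \<Rightarrow> 'g::ab_group_add \<Rightarrow> 'g" and br n e r s nabla Omega
    and sc :: "'r \<Rightarrow> 'b::ab_group_add \<Rightarrow> 'b" +
  fixes f :: "'b \<Rightarrow> 'b \<Rightarrow> 'b" and u :: 'b and act :: "'g \<Rightarrow> 'b \<Rightarrow> 'b"
  assumes f_biadditive: "biadditive f"
    and f_sc_left: "f (sc c x) y = sc c (f x y)"
    and f_sc_right: "f x (sc c y) = sc c (f x y)"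
    and f_assoc: "f (f x y) z = f x (f y z)"
    and f_unit: "f u x = x" "f x u = x"
    and act_hom_left: "module_hom scG sc (\<lambda>X. act X x)"
    and act_hom_right: "module_hom sc sc (act X)"
    and act_bracket: "act (br X Y) x = act X (act Y x) - act Y (act X x)"
    and act_derivation: "act X (f x y) = f (act X x) y + f x (act X y)"
begin

lemma q_zero [simp]: "q 0 = 0"
  using q_add[of 0 0] by simp

lemma q_of_nat: "q (of_nat k) = of_nat k"
  by (induction k) (auto simp: q_add q_one add.commute)

abbreviation smul :: "'r \<Rightarrow> 'b weyl \<Rightarrow> 'b weyl" where
  "smul c \<equiv> weyl_map (sc c)"

lemma smul_apply: "smul c a m M S = sc c (a m M S)"
  by (simp add: weyl_map_def)

sublocale W: module smul
  by unfold_locales (auto simp: weyl_map_def fun_eq_iff B.scale_right_distrib B.scale_left_distrib)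

lemma additive_sc: "additive (sc c)"
  by (simp add: additive_def B.scale_right_distrib)

lemmas smul_commute = weyl_map_commute[OF additive_sc]
lemmas slice = slicewise_operators[OF B.module_axioms]

lemma slicewise_smul: "slicewise sc (smul c)"
  by (rule slicewise_weyl_map) (auto simp: additive_sc mult.commute)

lemma smul_of_nat_cancel:
  assumes "smul (of_nat (Suc k)) a = smul (of_nat (Suc k)) b" shows "a = b"
proof -
  have "q (1 / of_nat (Suc k)) * of_nat (Suc k) = 1"
    unfolding q_of_nat[symmetric] q_mult[symmetric] by (simp add: q_one del: of_nat_Suc)
  then show ?thesis using arg_cong[OF assms, of "smul (q (1 / of_nat (Suc k)))"]
    by (simp del: of_nat_Suc)
qed

lemma weyl_mult_smul:
  "weyl_mult f (smul c a) b = smul c (weyl_mult f a b)"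
  "weyl_mult f a (smul c b) = smul c (weyl_mult f a b)"
  using weyl_map_weyl_mult[of "sc c" f f "sc c" id a b] weyl_map_weyl_mult[of "sc c" f f id "sc c" a b]
  by (simp_all add: additive_sc f_sc_left f_sc_right) (simp_all add: weyl_map_def)

abbreviation mu :: "nat \<Rightarrow> 'b weyl \<Rightarrow> 'b weyl \<Rightarrow> 'b weyl" where
  "mu \<equiv> mu_P f sc"

lemma biadditive_mu: "biadditive (mu k)"
proof (induction k)
  case 0
  have "mu 0 = weyl_mult f" by (simp add: fun_eq_iff)
  then show ?case using biadditive_weyl_mult[OF f_biadditive] by simp
next
  case (Suc k)
  show ?case
    by (simp add: biadditive_def additive_def operator_add biadditive_simps[OF Suc] W.scale_right_distrib sum.distrib)
qed

lemma mu_smul: "mu k (smul c a) b = smul c (mu k a b)" "mu k a (smul c b) = smul c (mu k a b)"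
  by (induction k arbitrary: a b)
    (simp_all add: weyl_mult_smul smul_commute W.scale_sum_right mult.commute)

lemma mu_intertwine:
  assumes "\<And>a b. X (weyl_mult f a b) = weyl_mult f (Y a) (Z b)"
    and "additive X" "\<And>c a. X (smul c a) = smul c (X a)"
    and "\<And>i a. Y (ins_sym i a) = ins_sym i (Y a)" "\<And>i a. Z (ins_sym i a) = ins_sym i (Z a)"
  shows "X (mu k a b) = mu k (Y a) (Z b)"
  by (induction k arbitrary: a b) (simp_all add: assms additive.sum[OF assms(2)])

lemma mu_twisted_derivation:
  assumes "\<And>a b. X (weyl_mult f a b) = weyl_mult f (X a) b + weyl_mult f (Y a) (X b)"
    and X: "additive X" "\<And>c a. X (smul c a) = smul c (X a)"
    and Y: "\<And>i a. Y (ins_sym i a) = ins_sym i (Y a)"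
    and D: "\<And>i a. X (ins_sym i a) = ins_sym i (X a)"
  shows "X (mu k a b) = mu k (X a) b + mu k (Y a) (X b)"
  by (induction k arbitrary: a b)
    (simp_all add: assms additive.sum[OF X(1)] W.scale_right_distrib sum.distrib)

text \<open>A linear vector field does not commute with the derivatives. The correction terms in the
  two arguments of the bidifferential operator cancel because \<open>inv\<close> states that
  \<open>pi_mat\<close> is invariant under \<open>x\<close>.\<close>

lemma mu_derivation:
  assumes "\<And>a b. X (weyl_mult f a b) = weyl_mult f (X a) b + weyl_mult f a (X b)"
    and X: "additive X" "\<And>c a. X (smul c a) = smul c (X a)"
    and D: "\<And>i a. i < n \<Longrightarrow> X (ins_sym i a) = ins_sym i (X a) + (\<Sum>k<n. smul (x k i) (ins_sym k a))"
    and inv: "\<And>k j. k < n \<Longrightarrow> j < n \<Longrightarrow> (\<Sum>i<n. pi_mat i j * x k i) + (\<Sum>i<n. pi_mat k i * x j i) = 0"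
  shows "X (mu k a b) = mu k (X a) b + mu k a (X b)"
proof (induction k arbitrary: a b)
  case (Suc k)
  have IH: "X (mu k a b) = mu k (X a) b + mu k a (X b)" for a b by (rule Suc.IH)
  let ?m = "\<lambda>i j. mu k (ins_sym i a) (ins_sym j b)"
  have A: "(\<Sum>i<n. \<Sum>j<n. smul (pi_mat i j) (mu k (\<Sum>p<n. smul (x p i) (ins_sym p a)) (ins_sym j b)))
    = (\<Sum>p<n. \<Sum>j<n. smul (\<Sum>i<n. pi_mat i j * x p i) (?m p j))"
    unfolding biadditive_simps[OF biadditive_mu] mu_smul W.scale_sum_right W.scale_sum_left W.scale_scale
    by (subst sum.swap, subst sum.swap, rule sum.cong[OF refl], subst sum.swap) (rule refl)
  have B: "(\<Sum>i<n. \<Sum>j<n. smul (pi_mat i j) (mu k (ins_sym i a) (\<Sum>p<n. smul (x p j) (ins_sym p b))))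
    = (\<Sum>i<n. \<Sum>p<n. smul (\<Sum>j<n. pi_mat i j * x p j) (?m i p))"
    unfolding biadditive_simps[OF biadditive_mu] mu_smul W.scale_sum_right W.scale_sum_left W.scale_scale
    by (rule sum.cong[OF refl], subst sum.swap) (rule refl)
  have AB: "(\<Sum>i<n. \<Sum>j<n. smul (pi_mat i j) (mu k (\<Sum>p<n. smul (x p i) (ins_sym p a)) (ins_sym j b)))
    + (\<Sum>i<n. \<Sum>j<n. smul (pi_mat i j) (mu k (ins_sym i a) (\<Sum>p<n. smul (x p j) (ins_sym p b)))) = 0"
    unfolding A B sum.distrib[symmetric] W.scale_left_distrib[symmetric]
    by (intro sum.neutral ballI) (simp add: inv sum.distrib)
  have "X (mu (Suc k) a b) = (\<Sum>i<n. \<Sum>j<n. smul (pi_mat i j)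
    (mu k (X (ins_sym i a)) (ins_sym j b) + mu k (ins_sym i a) (X (ins_sym j b))))"
    by (simp add: additive.sum[OF X(1)] X(2) IH)
  also have "\<dots> = (\<Sum>i<n. \<Sum>j<n. smul (pi_mat i j)
    (mu k (ins_sym i (X a)) (ins_sym j b) + mu k (ins_sym i a) (ins_sym j (X b))))
    + ((\<Sum>i<n. \<Sum>j<n. smul (pi_mat i j) (mu k (\<Sum>p<n. smul (x p i) (ins_sym p a)) (ins_sym j b)))
    + (\<Sum>i<n. \<Sum>j<n. smul (pi_mat i j) (mu k (ins_sym i a) (\<Sum>p<n. smul (x p j) (ins_sym p b)))))"
    by (simp add: D biadditive_simps(1,2)[OF biadditive_mu] W.scale_right_distrib sum.distrib add_ac)
  also have "\<dots> = mu (Suc k) (X a) b + mu (Suc k) a (X b)"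
    unfolding AB by (simp add: W.scale_right_distrib sum.distrib)
  finally have "X (mu (Suc k) a b) = mu (Suc k) (X a) b + mu (Suc k) a (X b)" .
  then show ?case .
qed (simp add: assms)

lemma mu_local:
  assumes "\<And>p. p \<le> m \<Longrightarrow> a p = a' p" "\<And>p. p \<le> m \<Longrightarrow> b p = b' p"
  shows "mu k a b m = mu k a' b' m"
  using assms
proof (induction k arbitrary: a a' b b')
  case 0
  show ?case by (rule ext) (auto simp: weyl_mult_sum_ext 0 intro!: sum.cong)
next
  case (Suc k)
  have "mu k (ins_sym i a) (ins_sym j b) m = mu k (ins_sym i a') (ins_sym j b') m" for i j
    by (rule Suc.IH) (simp_all add: ins_sym_def Suc.prems)
  then show ?case by (simp add: sum_fun_apply weyl_map_def)
qed

abbreviation wprod (infixl "\<odot>" 70) where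
  "a \<odot> b \<equiv> circ f sc a b"

text \<open>The coefficient of t^k in the exponential, so that \<open>circ\<close> is the series of
  the \<open>mu_c k\<close> weighted with t^k.\<close>

definition mu_c :: "nat \<Rightarrow> 'b weyl \<Rightarrow> 'b weyl \<Rightarrow> 'b weyl" where
  "mu_c k a b = smul (q (1 / (2 ^ k * fact k))) (mu k a b)"

lemma circ_mu_c: "(a \<odot> b) m = (\<Sum>k\<le>m. mu_c k a b (m - k))"
  by (simp add: circ_def mu_c_def weyl_map_def sum_fun_apply fun_eq_iff)

lemma biadditive_mu_c: "biadditive (mu_c k)"
  by (simp add: biadditive_def additive_def mu_c_def biadditive_simps[OF biadditive_mu] W.scale_right_distrib)

lemma mu_c_smul: "mu_c k (smul c a) b = smul c (mu_c k a b)" "mu_c k a (smul c b) = smul c (mu_c k a b)"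
  by (simp_all add: mu_c_def mu_smul mult.commute)

lemma biadditive_circ: "biadditive (circ f sc)"
  unfolding biadditive_def additive_def by (intro conjI allI ext) (simp_all add: circ_mu_c biadditive_simps[OF biadditive_mu_c] sum.distrib)

lemmas circ_simps = biadditive_simps[OF biadditive_circ]

lemma circ_smul: "smul c a \<odot> b = smul c (a \<odot> b)" "a \<odot> smul c b = smul c (a \<odot> b)"
  by (intro ext; simp add: circ_mu_c mu_c_smul smul_apply B.scale_sum_right sum_fun_apply)+

text \<open>Reduces an identity for \<open>circ\<close> to the same identity for each
  \<open>mu k\<close>.\<close>

lemma slicewise_circ:
  assumes "slicewise sc X" "\<And>k. X (mu k a b) = (\<Sum>j\<in>J. mu k (A j) (C j))"
  shows "X (a \<odot> b) = (\<Sum>j\<in>J. A j \<odot> C j)"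
proof (rule ext)
  fix m
  note X = slicewiseD(1)[OF assms(1)] slicewiseD(3)[OF assms(1)]
  have X3: "X a m = X b m'" if "a m = b m'" for a b m m'
    by (rule slicewiseD(2)[where a = a and m = m and b = b and m' = m', OF assms(1) that])
  have mc: "X (mu_c k a b) = (\<Sum>j\<in>J. mu_c k (A j) (C j))" for k
    by (simp add: mu_c_def X assms W.scale_sum_right)
  \<comment> \<open>\<open>h k\<close> repeats one slice of \<open>mu_c k a b\<close> at every
    index. The sum over \<open>k\<close>, which mixes different slices, then becomes a single slice
    of a sum, to which \<open>X\<close> can be applied.\<close>
  define h where "h = (\<lambda>k (p::nat). mu_c k a b (m - k))"
  have "(a \<odot> b) m = (\<Sum>k\<le>m. h k) m" by (simp add: circ_mu_c h_def sum_fun_apply)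
  then have "X (a \<odot> b) m = X (\<Sum>k\<le>m. h k) m" by (rule X3)
  also have "\<dots> = (\<Sum>k\<le>m. X (h k) m)" by (simp add: additive.sum[OF X(1)] sum_fun_apply)
  also have "\<dots> = (\<Sum>k\<le>m. X (mu_c k a b) (m - k))"
    by (rule sum.cong[OF refl], rule X3) (simp add: h_def)
  also have "\<dots> = (\<Sum>j\<in>J. A j \<odot> C j) m"
    by (simp add: mc sum_fun_apply circ_mu_c) (rule sum.swap)
  finally show "X (a \<odot> b) m = (\<Sum>j\<in>J. A j \<odot> C j) m" .
qed

lemma slicewise_circ1:
  assumes "slicewise sc X" "\<And>k. X (mu k a b) = mu k a1 b1"
  shows "X (a \<odot> b) = a1 \<odot> b1"
  using slicewise_circ[OF assms(1), where J = "{()}" and A = "\<lambda>_. a1" and C = "\<lambda>_. b1"] assms(2) by simp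

lemma slicewise_circ2:
  assumes "slicewise sc X" "\<And>k. X (mu k a b) = mu k a1 b1 + mu k a2 b2"
  shows "X (a \<odot> b) = a1 \<odot> b1 + a2 \<odot> b2"
  using slicewise_circ[OF assms(1), where J = UNIV and A = "\<lambda>x. if x then a1 else a2" and C = "\<lambda>x. if x then b1 else b2"] assms(2)
  by (simp add: UNIV_bool)

lemma ins_sym_mu: "ins_sym i (mu k a b) = mu k (ins_sym i a) b + mu k a (ins_sym i b)"
  by (rule mu_twisted_derivation[where X = "ins_sym i" and Y = "\<lambda>a. a"])
    (simp_all add: ins_sym_weyl_mult[OF f_biadditive] additive_operators smul_commute ins_sym_commute)

lemma ins_sym_circ: "ins_sym i (a \<odot> b) = ins_sym i a \<odot> b + a \<odot> ins_sym i b"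
  by (rule slicewise_circ2[OF slice(4)]) (rule ins_sym_mu)

lemma ins_asym_circ: "ins_asym i (a \<odot> b) = ins_asym i a \<odot> b + eps a \<odot> ins_asym i b"
  by (rule slicewise_circ2[OF slice(2)], rule mu_twisted_derivation[where X = "ins_asym i" and Y = eps])
    (simp_all add: ins_asym_weyl_mult[OF f_biadditive] additive_operators smul_commute ins_asym_ins_sym eps_ins_sym)

lemma theta_circ_left: "theta i a \<odot> b = theta i (a \<odot> b)"
  by (rule slicewise_circ1[OF slice(1), symmetric], rule mu_intertwine[where X = "theta i" and Y = "theta i" and Z = "\<lambda>b. b"])
    (simp_all add: theta_weyl_mult_left[OF f_biadditive] additive_operators smul_commute theta_ins_sym)

lemma eps_circ: "eps (a \<odot> b) = eps a \<odot> eps b"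
  by (rule slicewise_circ1[OF slice(5)], rule mu_intertwine[where X = eps and Y = eps and Z = eps])
    (simp_all add: eps_weyl_mult[OF f_biadditive] additive_operators smul_commute eps_ins_sym)

lemma theta_circ_right: "a \<odot> theta i b = theta i (eps a \<odot> b)"
proof -
  have "theta i (eps a \<odot> b) = eps (eps a) \<odot> theta i b"
    by (rule slicewise_circ1[OF slice(1)], rule mu_intertwine[where X = "theta i" and Y = eps and Z = "theta i"])
    (simp_all add: theta_weyl_mult_right[OF f_biadditive] additive_operators smul_commute theta_ins_sym eps_ins_sym eps_eps)
  then show ?thesis by (simp add: eps_eps)
qed

lemma tshift_mu: "mu k (tshift a) b = tshift (mu k a b)" "mu k a (tshift b) = tshift (mu k a b)"
proof -
  show "mu k (tshift a) b = tshift (mu k a b)"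
    by (rule mu_intertwine[where X = tshift and Y = tshift and Z = "\<lambda>b. b", symmetric])
    (simp_all add: tshift_weyl_mult_left[OF f_biadditive] additive_operators smul_commute tshift_commute)
  show "mu k a (tshift b) = tshift (mu k a b)"
    by (rule mu_intertwine[where X = tshift and Z = tshift and Y = "\<lambda>b. b", symmetric])
    (simp_all add: tshift_weyl_mult_right[OF f_biadditive] additive_operators smul_commute tshift_commute)
qed

lemma tshift_mu_c: "mu_c k (tshift a) b = tshift (mu_c k a b)" "mu_c k a (tshift b) = tshift (mu_c k a b)"
  by (simp_all add: mu_c_def tshift_mu smul_commute)

lemma tshift_circ: "tshift a \<odot> b = tshift (a \<odot> b)" "a \<odot> tshift b = tshift (a \<odot> b)"
proof -
  have *: "(\<Sum>k\<le>m. tshift (mu_c k a b) (m - k)) = tshift (a \<odot> b) m" for m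
    by (cases m) (auto simp: tshift_def circ_mu_c Suc_diff_le intro!: sum.cong)
  show "tshift a \<odot> b = tshift (a \<odot> b)" "a \<odot> tshift b = tshift (a \<odot> b)"
    by (rule ext; simp add: circ_mu_c[of "tshift a"] circ_mu_c[of a "tshift b"] tshift_mu_c *)+
qed

text \<open>The exponent (t/2) P without its factor t, applied to a family of products.\<close>

definition half_pi :: "(nat \<Rightarrow> nat \<Rightarrow> 'b weyl) \<Rightarrow> 'b weyl" where
  "half_pi h = smul (q (1/2)) (\<Sum>i<n. \<Sum>j<n. smul (pi_mat i j) (h i j))"

lemma half_pi_add: "half_pi (\<lambda>i j. h i j + h' i j) = half_pi h + half_pi h'"
  unfolding half_pi_def W.scale_right_distrib sum.distrib ..

lemma half_pi_zero: "half_pi (\<lambda>i j. 0) = 0"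
  unfolding half_pi_def by simp

lemma half_pi_sum: "half_pi (\<lambda>i j. \<Sum>k\<in>K. h k i j) = (\<Sum>k\<in>K. half_pi (h k))"
proof (induction K rule: infinite_finite_induct)
  case (insert k K)
  have "half_pi (\<lambda>i j. \<Sum>k\<in>insert k K. h k i j) = half_pi (\<lambda>i j. h k i j + (\<Sum>k\<in>K. h k i j))"
    by (simp only: sum.insert[OF insert(1,2)])
  then show ?case by (simp only: half_pi_add insert(3) sum.insert[OF insert(1,2)])
qed (simp_all only: sum.infinite sum.empty half_pi_zero not_False_eq_True)

lemma mu_c_half_pi:
  "mu_c k (half_pi h) c = half_pi (\<lambda>i j. mu_c k (h i j) c)"
  "mu_c k c (half_pi h) = half_pi (\<lambda>i j. mu_c k c (h i j))"
  unfolding half_pi_def by (simp_all add: mu_c_smul biadditive_simps[OF biadditive_mu_c])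

lemma ins_sym_mu_c: "ins_sym i (mu_c k a b) = mu_c k (ins_sym i a) b + mu_c k a (ins_sym i b)"
  by (simp add: mu_c_def smul_commute ins_sym_mu W.scale_right_distrib)

text \<open>The differential equation of the exponential, in coefficients.\<close>

lemma mu_c_Suc: "smul (of_nat (Suc k)) (mu_c (Suc k) a b) = half_pi (\<lambda>i j. mu_c k (ins_sym i a) (ins_sym j b))"
proof -
  have "of_nat (Suc k) * q (1 / (2 ^ Suc k * fact (Suc k))) = q (1 / 2) * q (1 / (2 ^ k * fact k))"
    unfolding q_of_nat[symmetric] q_mult[symmetric]
    by (rule arg_cong[of _ _ q]) (simp add: divide_simps del: of_nat_Suc)
  then have "of_nat (Suc k) * (q (1 / (2 ^ Suc k * fact (Suc k))) * p) = q (1 / 2) * (p * q (1 / (2 ^ k * fact k)))" for p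
    by (subst mult.assoc[symmetric]) (simp only: mult_ac)
  then show ?thesis
    unfolding half_pi_def mu_c_def by (simp only: mu_P.simps W.scale_sum_right W.scale_scale)
qed

text \<open>The two bracketings are compared order by order in \<open>t\<close>. Both satisfy the recursion in \<open>m\<close> that comes
  from differentiating \<open>exp (t / 2 (P\<^sub>1\<^sub>2 + P\<^sub>1\<^sub>3 + P\<^sub>2\<^sub>3))\<close> with respect to \<open>t\<close>.\<close>

definition triple_left :: "nat \<Rightarrow> 'b weyl \<Rightarrow> 'b weyl \<Rightarrow> 'b weyl \<Rightarrow> 'b weyl" where
  "triple_left m a b c = (\<Sum>k\<le>m. mu_c k (mu_c (m - k) a b) c)"

definition triple_right :: "nat \<Rightarrow> 'b weyl \<Rightarrow> 'b weyl \<Rightarrow> 'b weyl \<Rightarrow> 'b weyl" where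
  "triple_right m a b c = (\<Sum>k\<le>m. mu_c k a (mu_c (m - k) b c))"

text \<open>The weight \<open>m + 1\<close> is split into \<open>k\<close> and
  \<open>m + 1 - k\<close>: the Leibniz rule for the t-derivative of a product of two
  series.\<close>

lemma sum_weighted:
  fixes g :: "nat \<Rightarrow> 'b weyl"
  shows "smul (of_nat (Suc m)) (\<Sum>k\<le>Suc m. g k)
    = (\<Sum>k\<le>m. smul (of_nat (Suc k)) (g (Suc k))) + (\<Sum>k\<le>m. smul (of_nat (Suc (m - k))) (g k))"
proof -
  have "smul (of_nat (Suc m)) (\<Sum>k\<le>Suc m. g k)
    = (\<Sum>k\<le>Suc m. smul (of_nat k) (g k) + smul (of_nat (Suc m - k)) (g k))"
    unfolding W.scale_sum_right
    by (rule sum.cong[OF refl]) (simp only: W.scale_left_distrib[symmetric] of_nat_add[symmetric] atMost_iff le_add_diff_inverse)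
  also have "\<dots> = (\<Sum>k\<le>Suc m. smul (of_nat k) (g k)) + (\<Sum>k\<le>Suc m. smul (of_nat (Suc m - k)) (g k))"
    by (rule sum.distrib)
  also have "(\<Sum>k\<le>Suc m. smul (of_nat k) (g k)) = (\<Sum>k\<le>m. smul (of_nat (Suc k)) (g (Suc k)))"
    unfolding sum.atMost_Suc_shift by simp
  also have "(\<Sum>k\<le>Suc m. smul (of_nat (Suc m - k)) (g k)) = (\<Sum>k\<le>m. smul (of_nat (Suc (m - k))) (g k))"
    unfolding sum.atMost_Suc by (simp add: Suc_diff_le cong: sum.cong_simp del: of_nat_Suc)
  finally show ?thesis .
qed

text \<open>Differentiating the outer product contracts \<open>c\<close> with \<open>a\<close> or
  with \<open>b\<close>, by the Leibniz rule for the insertion; differentiating the inner one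
  contracts \<open>a\<close> with \<open>b\<close>.\<close>

lemma triple_left_Suc:
  "smul (of_nat (Suc m)) (triple_left (Suc m) a b c) = half_pi (\<lambda>i j.
     triple_left m (ins_sym i a) b (ins_sym j c) + triple_left m a (ins_sym i b) (ins_sym j c)
     + triple_left m (ins_sym i a) (ins_sym j b) c)"
proof -
  have 1: "(\<Sum>k\<le>m. smul (of_nat (Suc k)) (mu_c (Suc k) (mu_c (Suc m - Suc k) a b) c))
    = half_pi (\<lambda>i j. triple_left m (ins_sym i a) b (ins_sym j c)) + half_pi (\<lambda>i j. triple_left m a (ins_sym i b) (ins_sym j c))"
    unfolding triple_left_def half_pi_sum mu_c_Suc ins_sym_mu_c biadditive_simps[OF biadditive_mu_c] half_pi_add sum.distrib
    by simp
  have 2: "(\<Sum>k\<le>m. smul (of_nat (Suc (m - k))) (mu_c k (mu_c (Suc m - k) a b) c))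
    = half_pi (\<lambda>i j. triple_left m (ins_sym i a) (ins_sym j b) c)"
    unfolding triple_left_def half_pi_sum
  proof (rule sum.cong[OF refl])
    fix k assume "k \<in> {..m}"
    then have k: "Suc m - k = Suc (m - k)" by (simp add: Suc_diff_le)
    have "smul (of_nat (Suc (m - k))) (mu_c k (mu_c (Suc (m - k)) a b) c) = mu_c k (smul (of_nat (Suc (m - k))) (mu_c (Suc (m - k)) a b)) c"
      by (simp only: mu_c_smul)
    then show "smul (of_nat (Suc (m - k))) (mu_c k (mu_c (Suc m - k) a b) c)
        = half_pi (\<lambda>i j. mu_c k (mu_c (m - k) (ins_sym i a) (ins_sym j b)) c)"
      unfolding k by (simp only: mu_c_Suc mu_c_half_pi)
  qed
  show ?thesis unfolding half_pi_add
    unfolding triple_left_def[of "Suc m"] sum_weighted 1 2 ..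
qed

lemma triple_right_Suc:
  "smul (of_nat (Suc m)) (triple_right (Suc m) a b c) = half_pi (\<lambda>i j.
     triple_right m (ins_sym i a) b (ins_sym j c) + triple_right m a (ins_sym i b) (ins_sym j c)
     + triple_right m (ins_sym i a) (ins_sym j b) c)"
proof -
  have 1: "(\<Sum>k\<le>m. smul (of_nat (Suc k)) (mu_c (Suc k) a (mu_c (Suc m - Suc k) b c)))
    = half_pi (\<lambda>i j. triple_right m (ins_sym i a) (ins_sym j b) c) + half_pi (\<lambda>i j. triple_right m (ins_sym i a) b (ins_sym j c))"
    unfolding triple_right_def half_pi_sum mu_c_Suc ins_sym_mu_c biadditive_simps[OF biadditive_mu_c] half_pi_add sum.distrib
    by simp
  have 2: "(\<Sum>k\<le>m. smul (of_nat (Suc (m - k))) (mu_c k a (mu_c (Suc m - k) b c)))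
    = half_pi (\<lambda>i j. triple_right m a (ins_sym i b) (ins_sym j c))"
    unfolding triple_right_def half_pi_sum
  proof (rule sum.cong[OF refl])
    fix k assume "k \<in> {..m}"
    then have k: "Suc m - k = Suc (m - k)" by (simp add: Suc_diff_le)
    have "smul (of_nat (Suc (m - k))) (mu_c k a (mu_c (Suc (m - k)) b c)) = mu_c k a (smul (of_nat (Suc (m - k))) (mu_c (Suc (m - k)) b c))"
      by (simp only: mu_c_smul)
    then show "smul (of_nat (Suc (m - k))) (mu_c k a (mu_c (Suc m - k) b c))
        = half_pi (\<lambda>i j. mu_c k a (mu_c (m - k) (ins_sym i b) (ins_sym j c)))"
      unfolding k by (simp only: mu_c_Suc mu_c_half_pi)
  qed
  show ?thesis unfolding half_pi_add
    unfolding triple_right_def[of "Suc m"] sum_weighted 1 2 by (simp only: add_ac)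
qed

lemma triple_left_right: "triple_left m a b c = triple_right m a b c"
proof (induction m arbitrary: a b c)
  case 0
  have "weyl_mult f (weyl_mult f a b) c = weyl_mult f a (weyl_mult f b c)"
    by (rule weyl_mult_assoc) (auto simp: f_biadditive f_assoc)
  then show ?case by (simp add: triple_left_def triple_right_def mu_c_def q_one)
next
  case (Suc m)
  have IH: "triple_left m a b c = triple_right m a b c" for a b c by (rule Suc)
  show ?case
    by (rule smul_of_nat_cancel[of m]) (simp only: triple_left_Suc triple_right_Suc IH)
qed

lemma tshift_funpow_mu_c: "mu_c k ((tshift ^^ l) a) b = (tshift ^^ l) (mu_c k a b)"
  "mu_c k a ((tshift ^^ l) b) = (tshift ^^ l) (mu_c k a b)"
  by (induction l) (simp_all add: tshift_mu_c)

lemma mu_c_local: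
  assumes "\<And>p. p \<le> m \<Longrightarrow> a p = a' p" "\<And>p. p \<le> m \<Longrightarrow> b p = b' p"
  shows "mu_c k a b m = mu_c k a' b' m"
  using mu_local[of m a a' b b', OF assms] by (simp add: mu_c_def weyl_map_def)

text \<open>Up to order \<open>m\<close> the product is a finite sum of multiples by powers of t, to
  which biadditivity of \<open>mu_c\<close> applies.\<close>

lemma circ_tshift: "p \<le> m \<Longrightarrow> (a \<odot> b) p = (\<Sum>l\<le>m. (tshift ^^ l) (mu_c l a b)) p"
proof -
  assume p: "p \<le> m"
  have "(\<Sum>l\<le>m. (tshift ^^ l) (mu_c l a b)) p = (\<Sum>l\<le>m. if l \<le> p then mu_c l a b (p - l) else 0)"
    by (simp add: sum_fun_apply tshift_funpow)
  also have "\<dots> = (\<Sum>l\<le>p. mu_c l a b (p - l))"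
    using p by (intro sum.mono_neutral_cong_right) auto
  finally show ?thesis by (simp add: circ_mu_c)
qed

lemma triangle: "(\<Sum>k\<le>(m::nat). \<Sum>l\<le>m - k. g k l) = (\<Sum>j\<le>m. \<Sum>k\<le>j. (g k (j - k) :: 'x::comm_monoid_add))"
proof -
  have "(\<Sum>k\<le>m. \<Sum>l\<le>m - k. g k l) = (\<Sum>(k,l)\<in>{(i,j). i + j \<le> m}. g k l)"
    by (subst sum.Sigma) (auto intro!: sum.cong)
  then show ?thesis by (simp add: sum.triangle_reindex_eq)
qed

text \<open>By locality in t the inner product may be truncated. Regrouping by the total number
  \<open>j\<close> of contractions then leaves \<open>triple_left j\<close> and
  \<open>triple_right j\<close>.\<close>

lemma circ_assoc: "(a \<odot> b) \<odot> c = a \<odot> (b \<odot> c)"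
proof (rule ext)
  fix m :: nat
  have d: "k \<le> j \<Longrightarrow> m - k - (j - k) = m - j" for k j by arith
  have "((a \<odot> b) \<odot> c) m = (\<Sum>k\<le>m. mu_c k (\<Sum>l\<le>m. (tshift ^^ l) (mu_c l a b)) c (m - k))"
    unfolding circ_mu_c[of "a \<odot> b"]
    by (intro sum.cong refl mu_c_local circ_tshift) auto
  also have "\<dots> = (\<Sum>k\<le>m. \<Sum>l\<le>m. (tshift ^^ l) (mu_c k (mu_c l a b) c) (m - k))"
    by (simp only: biadditive_simps[OF biadditive_mu_c] tshift_funpow_mu_c sum_fun_apply)
  also have "\<dots> = (\<Sum>k\<le>m. \<Sum>l\<le>m - k. mu_c k (mu_c l a b) c (m - k - l))"
    by (intro sum.cong refl sum.mono_neutral_cong_right) (auto simp: tshift_funpow)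
  also have "\<dots> = (\<Sum>j\<le>m. \<Sum>k\<le>j. mu_c k (mu_c (j - k) a b) c (m - k - (j - k)))"
    by (rule triangle)
  also have "\<dots> = (\<Sum>j\<le>m. triple_left j a b c (m - j))"
    by (auto simp: triple_left_def sum_fun_apply d intro!: sum.cong)
  also have "\<dots> = (\<Sum>j\<le>m. \<Sum>k\<le>j. mu_c k a (mu_c (j - k) b c) (m - k - (j - k)))"
    by (auto simp: triple_left_right triple_right_def sum_fun_apply d intro!: sum.cong)
  also have "\<dots> = (\<Sum>k\<le>m. \<Sum>l\<le>m - k. mu_c k a (mu_c l b c) (m - k - l))"
    by (rule triangle[symmetric])
  also have "\<dots> = (\<Sum>k\<le>m. \<Sum>l\<le>m. (tshift ^^ l) (mu_c k a (mu_c l b c)) (m - k))"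
    by (intro sum.cong refl sum.mono_neutral_cong_left) (auto simp: tshift_funpow)
  also have "\<dots> = (\<Sum>k\<le>m. mu_c k a (\<Sum>l\<le>m. (tshift ^^ l) (mu_c l b c)) (m - k))"
    by (simp only: biadditive_simps[OF biadditive_mu_c] tshift_funpow_mu_c sum_fun_apply)
  also have "\<dots> = (a \<odot> (b \<odot> c)) m"
    unfolding circ_mu_c[of a "b \<odot> c"]
    by (intro sum.cong refl mu_c_local circ_tshift[symmetric]) auto
  finally show "((a \<odot> b) \<odot> c) m = (a \<odot> (b \<odot> c)) m" .
qed

end

section \<open>From invariance of omega and s to invariance of pi and symmetry of the
  curvature\<close>

section \<open>Symplectic connections in components\<close>

locale fedosov_geometry = fedosov q scG br n e r s nabla Omega
  for q :: "rat \<Rightarrow> 'r::comm_ring_1"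
    and scG :: "'r \<Rightarrow> 'g::ab_group_add \<Rightarrow> 'g" and br n e r s nabla Omega +
  assumes r_antisym: "i < n \<Longrightarrow> j < n \<Longrightarrow> r i j = - r j i"
    and nondeg: nondegenerate
    and sym_s: symmetric_s
    and cov: covariant_derivative
    and torsion: torsion_free
    and sympl: symplectic
    and parallel: s_parallel
    and closed: closed_two_forms
begin

lemma coord_hom: "module_hom scG (*) (coord i)"
proof -
  interpret R: module "(*) :: 'r \<Rightarrow> 'r \<Rightarrow> 'r"
    by unfold_locales (auto simp: algebra_simps)
  show ?thesis
    by unfold_locales (auto simp: coord_def representation_add[OF basis_independent] basis_span
        representation_scale[OF basis_independent] algebra_simps)
qed

lemmas coord_add = module_hom.add[OF coord_hom]
lemmas coord_diff = module_hom.diff[OF coord_hom]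
lemmas coord_scale = module_hom.scale[OF coord_hom]
lemmas coord_sum = module_hom.sum[OF coord_hom]

lemma coord_e: "i < n \<Longrightarrow> j < n \<Longrightarrow> coord i (e j) = (if i = j then 1 else 0)"
  using basis_inj by (auto simp: coord_def representation_basis[OF basis_independent] inj_on_def)

lemma expand: "x = (\<Sum>i<n. scG (coord i x) (e i))"
proof -
  have "(\<Sum>b\<in>e ` {..<n}. scG (representation (e ` {..<n}) x b) b) = x"
    by (rule sum_representation_eq[OF basis_independent]) (auto simp: basis_span)
  then show ?thesis by (simp add: sum.reindex[OF basis_inj] coord_def)
qed

lemma hom_expand:
  assumes "module_hom scG sc' h" shows "h x = (\<Sum>p<n. sc' (coord p x) (h (e p)))"
proof -
  interpret module_hom scG sc' h by fact
  have "h x = h (\<Sum>p<n. scG (coord p x) (e p))" using expand[of x] by simp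
  then show ?thesis by (simp add: sum scale)
qed

lemma nabla_hom_left: "module_hom scG scG (\<lambda>X. nabla X Y)"
  and nabla_hom: "module_hom scG scG (nabla X)"
  using cov by (auto simp: covariant_derivative_def)

definition conn :: "'g \<Rightarrow> nat \<Rightarrow> nat \<Rightarrow> 'r" where
  "conn X k l = coord k (nabla X (e l))"

definition struct :: "nat \<Rightarrow> nat \<Rightarrow> nat \<Rightarrow> 'r" where
  "struct k i j = coord k (br (e i) (e j))"

definition curvm :: "nat \<Rightarrow> nat \<Rightarrow> nat \<Rightarrow> nat \<Rightarrow> 'r" where
  "curvm i j k l = coord k (curv (e i) (e j) (e l))"

definition beta :: "nat \<Rightarrow> nat \<Rightarrow> nat \<Rightarrow> nat \<Rightarrow> 'r" where
  "beta i j k l = omega (e k) (curv (e i) (e j) (e l))"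

lemma coord_nabla: "coord k (nabla X Y) = (\<Sum>p<n. conn X k p * coord p Y)"
proof -
  have "nabla X Y = (\<Sum>p<n. scG (coord p Y) (nabla X (e p)))" by (rule hom_expand[OF nabla_hom])
  then show ?thesis by (simp add: coord_sum coord_scale conn_def mult.commute)
qed

lemma conn_expand: "conn X k l = (\<Sum>p<n. coord p X * conn (e p) k l)"
proof -
  have "nabla X (e l) = (\<Sum>p<n. scG (coord p X) (nabla (e p) (e l)))" by (rule hom_expand[OF nabla_hom_left])
  then show ?thesis by (simp add: coord_sum coord_scale conn_def)
qed

lemma conn_torsion: "conn (e i) k j - conn (e j) k i = struct k i j"
  using torsion by (simp add: torsion_free_def conn_def struct_def coord_diff[symmetric])

lemma struct_antisym: "struct k i j = - struct k j i"
  using conn_torsion[of i k j] conn_torsion[of j k i] by (metis minus_diff_eq)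

lemma curvm_conn: "curvm i j k l = (\<Sum>p<n. conn (e i) k p * conn (e j) p l)
  - (\<Sum>p<n. conn (e j) k p * conn (e i) p l) - (\<Sum>p<n. struct p i j * conn (e p) k l)"
  unfolding curvm_def curv_def coord_diff coord_nabla[of k "e i" "nabla (e j) (e l)"]
    coord_nabla[of k "e j" "nabla (e i) (e l)"] conn_def[symmetric]
    conn_expand[of "br (e i) (e j)"] struct_def[symmetric] ..

lemma br_hom_left: "module_hom scG scG (\<lambda>x. br x y)"
  and br_hom_right: "module_hom scG scG (br x)"
  by (rule br_linear_left br_linear_right)+

lemma struct_jacobi:
  "(\<Sum>k<n. struct k a b * struct l c k) + (\<Sum>k<n. struct k b c * struct l a k) + (\<Sum>k<n. struct k c a * struct l b k) = 0"
proof -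
  have *: "coord l (br x y) = (\<Sum>k<n. coord k y * coord l (br x (e k)))" for x y
  proof -
    have "br x y = (\<Sum>k<n. scG (coord k y) (br x (e k)))" by (rule hom_expand[OF br_hom_right])
    then show ?thesis by (simp add: coord_sum coord_scale)
  qed
  have "coord l (br (e c) (br (e a) (e b)) + br (e a) (br (e b) (e c)) + br (e b) (br (e c) (e a))) = 0"
    by (simp add: jacobi module_hom.zero[OF coord_hom])
  then show ?thesis unfolding coord_add
    by (simp add: *[of "e c" "br (e a) (e b)"] *[of "e a" "br (e b) (e c)"] *[of "e b" "br (e c) (e a)"] struct_def)
qed

subsection \<open>The symplectic form\<close>

lemma sum_delta_mult:
  fixes g :: "nat \<Rightarrow> 'r"
  shows "i < n \<Longrightarrow> (\<Sum>a<n. (if i = a then 1 else 0) * g a) = g i"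
    "i < n \<Longrightarrow> (\<Sum>a<n. (if a = i then 1 else 0) * g a) = g i"
  by (simp_all add: if_distrib[of "\<lambda>x. x * _"] cong: if_cong)

lemma inv_omega: "inverse_matrices r omega_mat"
  using nondeg unfolding nondegenerate_def omega_mat_def by (rule someI_ex)

lemma r_omega: "i < n \<Longrightarrow> k < n \<Longrightarrow> (\<Sum>j<n. r i j * omega_mat j k) = (if i = k then 1 else 0)"
  and omega_r: "i < n \<Longrightarrow> k < n \<Longrightarrow> (\<Sum>j<n. omega_mat i j * r j k) = (if i = k then 1 else 0)"
  using inv_omega by (auto simp: inverse_matrices_def)

text \<open>Evaluate the product of \<open>omega_mat\<close>, \<open>r\<close> and the transpose of
  \<open>omega_mat\<close> in the two possible ways.\<close>

lemma omega_mat_antisym: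
  assumes "i < n" "k < n" shows "omega_mat i k = - omega_mat k i"
proof -
  have 1: "(\<Sum>b<n. omega_mat i b * r b a) * omega_mat k a = (if i = a then 1 else 0) * omega_mat k a" if "a < n" for a
    using assms that by (simp only: omega_r)
  have "(\<Sum>a<n. (\<Sum>b<n. omega_mat i b * r b a) * omega_mat k a) = omega_mat k i"
    by (subst sum.cong[OF refl 1]) (simp_all add: sum_delta_mult assms del: mult_1)
  moreover have "(\<Sum>a<n. (\<Sum>b<n. omega_mat i b * r b a) * omega_mat k a)
    = (\<Sum>b<n. (\<Sum>a<n. r b a * omega_mat k a) * omega_mat i b)"
    unfolding sum_distrib_right by (subst sum.swap) (simp add: mult_ac)
  moreover have 2: "(\<Sum>a<n. r b a * omega_mat k a) * x = - ((if k = b then 1 else 0) * x)" if "b < n" for b x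
  proof -
    have "(\<Sum>a<n. r b a * omega_mat k a) = (\<Sum>a<n. - (omega_mat k a * r a b))"
      by (rule sum.cong) (use that in \<open>simp_all add: r_antisym[of b] mult.commute\<close>)
    then show ?thesis using omega_r[OF assms(2) that] by (simp add: sum_negf)
  qed
  moreover have "(\<Sum>b<n. (\<Sum>a<n. r b a * omega_mat k a) * omega_mat i b) = - omega_mat i k"
    by (subst sum.cong[OF refl 2]) (simp_all only: lessThan_iff sum_negf sum_delta_mult assms)
  ultimately show ?thesis by simp
qed

lemma omega_antisym: "omega x y = - omega y x"
  unfolding omega_def
  by (subst sum.swap, subst sum_negf[symmetric], rule sum.cong[OF refl], subst sum_negf[symmetric], rule sum.cong[OF refl])
    (subst omega_mat_antisym, simp_all add: mult_ac)

lemma omega_diff: "omega (x - x') y = omega x y - omega x' y" "omega y (x - x') = omega y x - omega y x'"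
  by (simp_all add: omega_def coord_diff right_diff_distrib left_diff_distrib sum_subtractf)

lemma omega_nabla: "omega (nabla X Y) Z = - omega Y (nabla X Z)"
proof -
  have "- omega (nabla X Y) Z = omega Y (nabla X Z)"
    using sympl by (simp add: symplectic_def nabla_bilinear_form_def)
  then show ?thesis by (metis minus_minus)
qed

lemma omega_curv: "omega (curv X Y Z) V = - omega Z (curv X Y V)"
  by (simp add: curv_def omega_diff omega_nabla)

text \<open>The curvature is skew for the antisymmetric form \<open>omega\<close>, so lowering its
  index with \<open>omega\<close> gives something symmetric. This is why the curvature can be
  encoded in a quadratic element.\<close>

lemma beta_sym: "beta i j k l = beta i j l k"
  unfolding beta_def using omega_curv[of "e i" "e j" "e k" "e l"] omega_antisym[of "e l" "curv (e i) (e j) (e k)"]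
  by simp

lemma omega_e: "l < n \<Longrightarrow> omega x (e l) = (\<Sum>a<n. omega_mat a l * coord a x)"
  unfolding omega_def
  by (rule sum.cong[OF refl]) (simp add: coord_e if_distrib[of "\<lambda>x. _ * x"] sum.delta cong: if_cong sum.cong_simp)

text \<open>Raising the lowered index again; the sign comes from the skewness used to move it. It
  supplies hypothesis \<open>F\<close> of \<open>commutator_quadratic\<close>.\<close>

lemma beta_r:
  assumes "k < n" "p < n" shows "(\<Sum>l<n. beta i j k l * r l p) = - curvm i j p k"
proof -
  have b: "beta i j k l = - (\<Sum>a<n. omega_mat a l * curvm i j a k)" if "l < n" for l
    unfolding beta_def curvm_def using omega_curv[of "e i" "e j" "e k" "e l"] omega_e[OF that, of "curv (e i) (e j) (e k)"]
    by (simp add: equation_minus_iff)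
  have "(\<Sum>l<n. beta i j k l * r l p) = - (\<Sum>l<n. \<Sum>a<n. omega_mat a l * r l p * curvm i j a k)"
    unfolding sum_negf[symmetric]
    by (rule sum.cong[OF refl]) (simp add: b sum_distrib_right sum_distrib_left sum_negf mult_ac)
  also have "(\<Sum>l<n. \<Sum>a<n. omega_mat a l * r l p * curvm i j a k)
    = (\<Sum>a<n. (\<Sum>l<n. omega_mat a l * r l p) * curvm i j a k)"
    unfolding sum_distrib_right by (rule sum.swap)
  also have "\<dots> = (\<Sum>a<n. (if a = p then 1 else 0) * curvm i j a k)"
    by (rule sum.cong[OF refl]) (use assms omega_r in auto)
  also have "\<dots> = curvm i j p k"
    using assms by (simp only: sum_delta_mult)
  finally show ?thesis .
qed

subsection \<open>Invariant tensors\<close>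

text \<open>For \<open>A = conn X\<close> this is the \<open>(i, j)\<close> component of \<open>\<nabla>\<^sub>X v\<close>.\<close>

definition defect :: "(nat \<Rightarrow> nat \<Rightarrow> 'r) \<Rightarrow> (nat \<Rightarrow> nat \<Rightarrow> 'r) \<Rightarrow> nat \<Rightarrow> nat \<Rightarrow> 'r" where
  "defect A v i j = (\<Sum>k<n. v k j * A i k) + (\<Sum>k<n. v i k * A j k)"

lemma defect_diff: "defect (\<lambda>i j. A i j - B i j) v i j = defect A v i j - defect B v i j"
  by (simp add: defect_def right_diff_distrib sum_subtractf)

lemma defect_sum: "defect (\<lambda>i j. \<Sum>p<m. c p * A p i j) v i j = (\<Sum>p<m. c p * defect (A p) v i j)"
proof -
  have "(\<Sum>k<n. v k j * (\<Sum>p<m. c p * A p i k)) = (\<Sum>p<m. c p * (\<Sum>k<n. v k j * A p i k))"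
    "(\<Sum>k<n. v i k * (\<Sum>p<m. c p * A p j k)) = (\<Sum>p<m. c p * (\<Sum>k<n. v i k * A p j k))"
    unfolding sum_distrib_left by (subst sum.swap, simp add: mult_ac)+
  then show ?thesis by (simp add: defect_def distrib_left sum.distrib)
qed

text \<open>Invariance moves \<open>A\<close> from one leg of \<open>v\<close> to the other at the
  cost of a sign.\<close>

lemma defect_mult:
  assumes A: "\<And>i j. i < n \<Longrightarrow> j < n \<Longrightarrow> defect A v i j = 0" and ij: "i < n" "j < n"
  shows "defect (\<lambda>i j. \<Sum>p<n. B i p * A p j) v i j =
    - (\<Sum>a<n. \<Sum>k<n. v a k * (B i a * A j k)) - (\<Sum>a<n. \<Sum>k<n. v k a * (A i k * B j a))"
proof -
  have 1: "(\<Sum>k<n. v k j * A a k) = - (\<Sum>k<n. v a k * A j k)" if "a < n" for a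
    using A[OF that ij(2)] by (simp add: defect_def eq_neg_iff_add_eq_0)
  have 2: "(\<Sum>k<n. v i k * A a k) = - (\<Sum>k<n. v k a * A i k)" if "a < n" for a
    using A[OF ij(1) that] by (simp add: defect_def eq_neg_iff_add_eq_0 add.commute)
  have "(\<Sum>k<n. v k j * (\<Sum>p<n. B i p * A p k)) = (\<Sum>a<n. B i a * (\<Sum>k<n. v k j * A a k))"
    unfolding sum_distrib_left by (subst sum.swap) (simp add: mult_ac)
  also have "\<dots> = - (\<Sum>a<n. \<Sum>k<n. v a k * (B i a * A j k))"
    unfolding sum_negf[symmetric]
    by (rule sum.cong[OF refl], subst 1) (simp_all add: sum_distrib_left sum_negf mult_ac)
  moreover have "(\<Sum>k<n. v i k * (\<Sum>p<n. B j p * A p k)) = (\<Sum>a<n. B j a * (\<Sum>k<n. v i k * A a k))"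
    unfolding sum_distrib_left by (subst sum.swap) (simp add: mult_ac)
  moreover have "\<dots> = - (\<Sum>a<n. \<Sum>k<n. v k a * (A i k * B j a))"
    unfolding sum_negf[symmetric]
    by (rule sum.cong[OF refl], subst 2) (simp_all add: sum_distrib_left sum_negf mult_ac)
  ultimately show ?thesis by (simp add: defect_def)
qed

text \<open>The matrices annihilating \<open>v\<close> form a Lie algebra: the mixed terms agree
  after the summation indices are renamed.\<close>

lemma defect_commutator:
  assumes A: "\<And>i j. i < n \<Longrightarrow> j < n \<Longrightarrow> defect A v i j = 0"
    and B: "\<And>i j. i < n \<Longrightarrow> j < n \<Longrightarrow> defect B v i j = 0" and ij: "i < n" "j < n"
  shows "defect (\<lambda>i j. (\<Sum>p<n. A i p * B p j) - (\<Sum>p<n. B i p * A p j)) v i j = 0"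
proof -
  have "(\<Sum>a<n. \<Sum>k<n. v k a * (B i k * A j a)) = (\<Sum>a<n. \<Sum>k<n. v a k * (B i a * A j k))"
    "(\<Sum>a<n. \<Sum>k<n. v k a * (A i k * B j a)) = (\<Sum>a<n. \<Sum>k<n. v a k * (A i a * B j k))"
    by (rule sum.swap)+
  moreover have "defect (\<lambda>i j. \<Sum>p<n. A i p * B p j) v i j =
    - (\<Sum>a<n. \<Sum>k<n. v a k * (A i a * B j k)) - (\<Sum>a<n. \<Sum>k<n. v k a * (B i k * A j a))"
    by (rule defect_mult[OF B ij])
  moreover have "defect (\<lambda>i j. \<Sum>p<n. B i p * A p j) v i j =
    - (\<Sum>a<n. \<Sum>k<n. v a k * (B i a * A j k)) - (\<Sum>a<n. \<Sum>k<n. v k a * (A i k * B j a))"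
    by (rule defect_mult[OF A ij])
  ultimately show ?thesis unfolding defect_diff by simp
qed

lemma defect_s: "i < n \<Longrightarrow> j < n \<Longrightarrow> defect (conn X) s i j = 0"
  using parallel unfolding s_parallel_def nabla_tensor_def defect_def conn_def by blast

text \<open>Invariance passes from a form to its inverse: the equation for \<open>omega_mat\<close>
  is contracted with \<open>r\<close> on both sides.\<close>

lemma defect_r:
  assumes "i < n" "j < n" shows "defect (conn X) r i j = 0"
proof -
  have inv: "(\<Sum>a<n. omega_mat a l * conn X a k) + (\<Sum>a<n. omega_mat k a * conn X a l) = 0" if "k < n" "l < n" for k l
  proof -
    have "omega (nabla X (e k)) (e l) = (\<Sum>a<n. omega_mat a l * conn X a k)"
      unfolding conn_def by (rule omega_e[OF that(2)])
    moreover have "omega (e k) (nabla X (e l)) = - (\<Sum>a<n. omega_mat a k * conn X a l)"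
      unfolding conn_def omega_antisym[of "e k"] omega_e[OF that(1)] ..
    moreover have "(\<Sum>a<n. omega_mat a k * conn X a l) = - (\<Sum>a<n. omega_mat k a * conn X a l)"
      unfolding sum_negf[symmetric] by (rule sum.cong[OF refl], subst omega_mat_antisym) (use that in simp_all)
    ultimately show ?thesis using omega_nabla[of X "e k" "e l"] by (simp add: eq_neg_iff_add_eq_0[symmetric])
  qed
  have 1: "(\<Sum>l<n. r i' l * (\<Sum>a<n. omega_mat l a * conn X a j')) = conn X i' j'" if "i' < n" for i' j'
  proof -
    have "(\<Sum>l<n. r i' l * (\<Sum>a<n. omega_mat l a * conn X a j')) = (\<Sum>a<n. (\<Sum>l<n. r i' l * omega_mat l a) * conn X a j')"
      unfolding sum_distrib_left sum_distrib_right by (subst sum.swap) (simp add: mult_ac)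
    also have "\<dots> = (\<Sum>a<n. (if i' = a then 1 else 0) * conn X a j')"
      by (rule sum.cong[OF refl]) (use that r_omega in auto)
    finally show ?thesis using that by (simp only: sum_delta_mult)
  qed
  have 2: "(\<Sum>l<n. (\<Sum>a<n. omega_mat a l * conn X a k) * r l j') = conn X j' k" if "j' < n" for k j'
  proof -
    have "(\<Sum>l<n. (\<Sum>a<n. omega_mat a l * conn X a k) * r l j') = (\<Sum>a<n. (\<Sum>l<n. omega_mat a l * r l j') * conn X a k)"
      unfolding sum_distrib_left sum_distrib_right by (subst sum.swap) (simp add: mult_ac)
    also have "\<dots> = (\<Sum>a<n. (if a = j' then 1 else 0) * conn X a k)"
      by (rule sum.cong[OF refl]) (use that omega_r in auto)
    finally show ?thesis using that by (simp only: sum_delta_mult)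
  qed
  have dist: "(\<Sum>k<n. r i k * (\<Sum>l<n. (T k l + T' k l) * r l j))
    = (\<Sum>k<n. r i k * (\<Sum>l<n. T k l * r l j)) + (\<Sum>k<n. \<Sum>l<n. r i k * T' k l * r l j)" for T T'
    by (simp add: distrib_right distrib_left sum.distrib sum_distrib_left mult.assoc)
  have "0 = (\<Sum>k<n. r i k * (\<Sum>l<n. ((\<Sum>a<n. omega_mat a l * conn X a k) + (\<Sum>a<n. omega_mat k a * conn X a l)) * r l j))"
    by (simp add: inv)
  also have "\<dots> = (\<Sum>k<n. r i k * (\<Sum>l<n. (\<Sum>a<n. omega_mat a l * conn X a k) * r l j))
    + (\<Sum>k<n. \<Sum>l<n. r i k * (\<Sum>a<n. omega_mat k a * conn X a l) * r l j)"
    by (rule dist)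
  also have "(\<Sum>k<n. \<Sum>l<n. r i k * (\<Sum>a<n. omega_mat k a * conn X a l) * r l j)
    = (\<Sum>l<n. (\<Sum>k<n. r i k * (\<Sum>a<n. omega_mat k a * conn X a l)) * r l j)"
    unfolding sum_distrib_right by (rule sum.swap)
  finally have "0 = (\<Sum>k<n. r i k * conn X j k) + (\<Sum>l<n. conn X i l * r l j)"
    using assms by (simp only: 1 2)
  then show ?thesis by (simp add: defect_def mult.commute add.commute)
qed

lemma defect_add_right: "defect A (\<lambda>i j. v i j + w i j) i j = defect A v i j + defect A w i j"
  by (simp add: defect_def distrib_right sum.distrib)

lemma defect_pi: "i < n \<Longrightarrow> j < n \<Longrightarrow> defect (conn X) pi_mat i j = 0"
  unfolding pi_mat_def[abs_def] defect_add_right by (simp add: defect_r defect_s)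

text \<open>By \<open>curvm_conn\<close> the curvature matrix is a commutator of connection matrices
  minus a linear combination of them, and all of these annihilate \<open>s\<close>.\<close>

lemma defect_curvm_s:
  assumes "k < n" "l < n" shows "defect (curvm i j) s k l = 0"
proof -
  have "curvm i j = (\<lambda>k l. ((\<Sum>p<n. conn (e i) k p * conn (e j) p l)
    - (\<Sum>p<n. conn (e j) k p * conn (e i) p l)) - (\<Sum>p<n. struct p i j * conn (e p) k l))"
    by (intro ext) (rule curvm_conn)
  then show ?thesis
    using assms by (simp add: defect_diff[of "\<lambda>k l. _ k l - _ k l"] defect_commutator[OF defect_s defect_s] defect_sum defect_s)
qed

lemma s_sym: "i < n \<Longrightarrow> j < n \<Longrightarrow> s i j = s j i"
  using sym_s by (simp add: symmetric_s_def)

end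

section \<open>The odd derivation D + L - delta and its square\<close>

section \<open>The Fedosov operator\<close>

locale fedosov_setup = fedosov_geometry q scG br n e r s nabla Omega +
  fedosov_algebra q scG br n e r s nabla Omega sc f u act
  for q :: "rat \<Rightarrow> 'r::comm_ring_1"
    and scG :: "'r \<Rightarrow> 'g::ab_group_add \<Rightarrow> 'g" and br n e r s nabla Omega
    and sc :: "'r \<Rightarrow> 'b::ab_group_add \<Rightarrow> 'b" and f u act
begin

text \<open>The derivation of the symmetric algebra induced by the dual of \<open>A\<close>, that
  is, a linear vector field with the sign of the dual representation.\<close>

definition rho :: "(nat \<Rightarrow> nat \<Rightarrow> 'r) \<Rightarrow> 'b weyl \<Rightarrow> 'b weyl" where
  "rho A a = (\<Sum>k<n. \<Sum>l<n. smul (- A k l) (ymul l (ins_sym k a)))"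

text \<open>The term \<open>- ins_sym i\<close> is included so that one operator \<open>E\<close>
  collects \<open>D + L - delta\<close>, and torsion-freeness enters through a single commutator
  formula.\<close>

definition nab :: "nat \<Rightarrow> 'b weyl \<Rightarrow> 'b weyl" where
  "nab i a = rho (conn (e i)) a + weyl_map (act (e i)) a - ins_sym i a"

text \<open>Exterior multiplication by the Chevalley-Eilenberg differential of the
  \<open>k\<close>-th generator.\<close>

definition dtheta :: "nat \<Rightarrow> 'b weyl \<Rightarrow> 'b weyl" where
  "dtheta k a = (\<Sum>i<n. \<Sum>j<n. smul (q (1/2) * - struct k i j) (theta i (theta j a)))"

definition dCE :: "'b weyl \<Rightarrow> 'b weyl" where
  "dCE a = (\<Sum>k<n. dtheta k (ins_asym k a))"

definition E :: "'b weyl \<Rightarrow> 'b weyl" where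
  "E a = (\<Sum>i<n. theta i (nab i a)) + dCE a"

lemma slicewise_minus:
  assumes "slicewise sc X" shows "slicewise sc (\<lambda>a. - X a)"
proof -
  have "slicewise sc (\<lambda>a. smul (- 1) (X a))" by (rule slicewise_comp[OF slicewise_smul assms])
  then show ?thesis by simp
qed

lemma additive_act: "additive (act X)"
  using module_hom.add[OF act_hom_right] by (simp add: additive_def)

lemma act_sc: "act X (sc c x) = sc c (act X x)"
  by (rule module_hom.scale[OF act_hom_right])

lemma slicewise_act: "slicewise sc (weyl_map (act X))"
  by (rule slicewise_weyl_map) (simp_all add: additive_act act_sc)

lemma slicewise_rho: "slicewise sc (rho A)"
  unfolding rho_def[abs_def]
  by (intro slicewise_sum[OF B.module_axioms] slicewise_comp[OF slicewise_smul] slicewise_comp[OF slice(3)] slice(4))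

lemma slicewise_nab: "slicewise sc (nab i)"
proof -
  have "slicewise sc (\<lambda>a. (rho (conn (e i)) a + weyl_map (act (e i)) a) + - ins_sym i a)"
    by (intro slicewise_add[OF B.module_axioms] slicewise_rho slicewise_act slicewise_minus slice(4))
  then show ?thesis by (simp add: nab_def[abs_def])
qed

lemma slicewise_dtheta: "slicewise sc (dtheta k)"
  unfolding dtheta_def[abs_def]
  by (intro slicewise_sum[OF B.module_axioms] slicewise_comp[OF slicewise_smul] slicewise_comp[OF slice(1)] slice(1))

lemma slicewise_dCE: "slicewise sc dCE"
  unfolding dCE_def[abs_def]
  by (intro slicewise_sum[OF B.module_axioms] slicewise_comp[OF slicewise_dtheta] slice(2))

lemma slicewise_E: "slicewise sc E"
  unfolding E_def[abs_def]
  by (intro slicewise_add[OF B.module_axioms] slicewise_dCE slicewise_sum[OF B.module_axioms] slicewise_comp[OF slice(1)] slicewise_nab)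

lemma additive_simps:
  assumes "additive X"
  shows "X (a + b) = X a + X b" "X (a - b) = X a - X b" "X (- a) = - X a" "X 0 = 0" "X (sum h I) = (\<Sum>i\<in>I. X (h i))"
  by (simp_all add: additive.add[OF assms] additive.diff[OF assms] additive.minus[OF assms] additive.zero[OF assms]
    additive.sum[OF assms])

lemmas rho_simps = additive_simps[OF slicewiseD(1)[OF slicewise_rho]] slicewiseD(3)[OF slicewise_rho]
lemmas nab_simps = additive_simps[OF slicewiseD(1)[OF slicewise_nab]] slicewiseD(3)[OF slicewise_nab]
lemmas dtheta_simps = additive_simps[OF slicewiseD(1)[OF slicewise_dtheta]] slicewiseD(3)[OF slicewise_dtheta]
lemmas dCE_simps = additive_simps[OF slicewiseD(1)[OF slicewise_dCE]] slicewiseD(3)[OF slicewise_dCE]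
lemmas E_simps = additive_simps[OF slicewiseD(1)[OF slicewise_E]] slicewiseD(3)[OF slicewise_E]
lemmas actw_simps = additive_simps[OF slicewiseD(1)[OF slicewise_act]] slicewiseD(3)[OF slicewise_act]
lemmas gen_simps = operator_zero operator_add operator_minus operator_diff operator_sum smul_commute
lemmas act_commute = weyl_map_commute[OF additive_act]

subsection \<open>Commutators\<close>

lemma rho_ins_sym:
  assumes "p < n"
  shows "rho A (ins_sym p a) = ins_sym p (rho A a) + (\<Sum>k<n. smul (A k p) (ins_sym k a))"
proof -
  have X: "(\<Sum>k<n. (\<Sum>l<n. smul (- A k l) (if p = l then ins_sym k a else 0))) = - (\<Sum>k<n. smul (A k p) (ins_sym k a))"
    unfolding sum_negf[symmetric]
    using assms by (intro sum.cong refl) (simp add: if_distrib[of "smul _"] sum.delta cong: if_cong)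
  have "ins_sym p (rho A a) = (\<Sum>k<n. \<Sum>l<n. smul (- A k l) (if p = l then ins_sym k a else 0)
      + smul (- A k l) (ymul l (ins_sym k (ins_sym p a))))"
    unfolding rho_def gen_simps ins_sym_ymul W.scale_right_distrib ins_sym_commute[of p] ..
  also have "\<dots> = (\<Sum>k<n. (\<Sum>l<n. smul (- A k l) (if p = l then ins_sym k a else 0))) + rho A (ins_sym p a)"
    by (simp only: rho_def sum.distrib)
  finally show ?thesis unfolding X by simp
qed

lemma rho_theta: "rho A (theta i a) = theta i (rho A a)"
  by (simp add: rho_def gen_simps theta_ymul theta_ins_sym)

lemma rho_ins_asym: "rho A (ins_asym i a) = ins_asym i (rho A a)"
  by (simp add: rho_def gen_simps ins_asym_ymul ins_asym_ins_sym)

lemma nab_theta: "nab i (theta j a) = theta j (nab i a)"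
  by (simp add: nab_def rho_theta gen_simps act_commute theta_ins_sym)

lemma nab_ins_asym: "nab i (ins_asym j a) = ins_asym j (nab i a)"
  by (simp add: nab_def rho_ins_asym gen_simps act_commute ins_asym_ins_sym)

lemma nab_dtheta: "nab i (dtheta k a) = dtheta k (nab i a)"
  by (simp add: dtheta_def nab_simps nab_theta)

lemma nab_dCE: "nab i (dCE a) = dCE (nab i a)"
  by (simp add: dCE_def nab_simps nab_dtheta nab_ins_asym)

lemma rho_act: "rho A (weyl_map (act X) a) = weyl_map (act X) (rho A a)"
  by (simp add: rho_def actw_simps act_commute)

lemma sum4_swap: "(\<Sum>k\<in>I. \<Sum>l\<in>I. \<Sum>p\<in>J. \<Sum>q\<in>J. g k l p q) = (\<Sum>p\<in>J. \<Sum>q\<in>J. \<Sum>k\<in>I. \<Sum>l\<in>I. (g k l p q :: 'x::comm_monoid_add))"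
proof -
  have "(\<Sum>k\<in>I. \<Sum>l\<in>I. \<Sum>p\<in>J. \<Sum>q\<in>J. g k l p q) = (\<Sum>k\<in>I. \<Sum>p\<in>J. \<Sum>q\<in>J. \<Sum>l\<in>I. g k l p q)"
    by (rule sum.cong[OF refl], subst sum.swap, rule sum.cong[OF refl], rule sum.swap)
  also have "\<dots> = (\<Sum>p\<in>J. \<Sum>q\<in>J. \<Sum>k\<in>I. \<Sum>l\<in>I. g k l p q)"
    by (subst sum.swap, rule sum.cong[OF refl], rule sum.swap)
  finally show ?thesis .
qed

lemma rho_rho: "rho A (rho B a) = (\<Sum>k<n. \<Sum>l<n. smul (\<Sum>p<n. B k p * A p l) (ymul l (ins_sym k a)))
   + (\<Sum>k<n. \<Sum>l<n. \<Sum>p<n. \<Sum>j<n. smul (A k l * B p j) (ymul l (ymul j (ins_sym k (ins_sym p a)))))"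
proof -
  have "rho A (rho B a) = (\<Sum>k<n. \<Sum>l<n. \<Sum>p<n. \<Sum>j<n. smul (A k l * B p j) (ymul l (if k = j then ins_sym p a else 0))
      + smul (A k l * B p j) (ymul l (ymul j (ins_sym k (ins_sym p a)))))"
    by (simp only: rho_def gen_simps ins_sym_ymul W.scale_right_distrib W.scale_sum_right W.scale_scale minus_mult_minus)
  also have "\<dots> = (\<Sum>k<n. \<Sum>l<n. \<Sum>p<n. \<Sum>j<n. smul (A k l * B p j) (ymul l (if k = j then ins_sym p a else 0)))
    + (\<Sum>k<n. \<Sum>l<n. \<Sum>p<n. \<Sum>j<n. smul (A k l * B p j) (ymul l (ymul j (ins_sym k (ins_sym p a)))))"
    by (simp add: sum.distrib)
  finally have 1: "rho A (rho B a) = (\<Sum>k<n. \<Sum>l<n. \<Sum>p<n. \<Sum>j<n. smul (A k l * B p j) (ymul l (if k = j then ins_sym p a else 0)))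
    + (\<Sum>k<n. \<Sum>l<n. \<Sum>p<n. \<Sum>j<n. smul (A k l * B p j) (ymul l (ymul j (ins_sym k (ins_sym p a)))))" .
  have 2: "(\<Sum>k<n. \<Sum>l<n. \<Sum>p<n. \<Sum>j<n. smul (A k l * B p j) (ymul l (if k = j then ins_sym p a else 0)))
    = (\<Sum>k<n. \<Sum>l<n. \<Sum>p<n. smul (A k l * B p k) (ymul l (ins_sym p a)))"
  proof (intro sum.cong refl)
    fix k l p assume "k \<in> {..<n}"
    then show "(\<Sum>j<n. smul (A k l * B p j) (ymul l (if k = j then ins_sym p a else 0))) = smul (A k l * B p k) (ymul l (ins_sym p a))"
      by (simp add: if_distrib[of "ymul l"] if_distrib[of "smul _"] gen_simps sum.delta cong: if_cong)
  qed
  have 3: "(\<Sum>k<n. \<Sum>l<n. \<Sum>p<n. smul (A k l * B p k) (ymul l (ins_sym p a)))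
    = (\<Sum>p<n. \<Sum>l<n. \<Sum>k<n. smul (A k l * B p k) (ymul l (ins_sym p a)))"
    by (subst sum.swap, subst (2) sum.swap, subst sum.swap, rule refl)
  show ?thesis unfolding 1 2 3 by (simp add: W.scale_sum_left mult.commute)
qed

text \<open>The second order part of \<open>rho_rho\<close> is symmetric in \<open>A\<close> and
  \<open>B\<close> and cancels; the normal ordering term remains.\<close>

lemma rho_commutator: "rho A (rho B a) - rho B (rho A a) =
  rho (\<lambda>k l. (\<Sum>p<n. A k p * B p l) - (\<Sum>p<n. B k p * A p l)) a"
proof -
  have "(\<Sum>k<n. \<Sum>l<n. \<Sum>p<n. \<Sum>j<n. smul (A k l * B p j) (ymul l (ymul j (ins_sym k (ins_sym p a)))))
    = (\<Sum>k<n. \<Sum>l<n. \<Sum>p<n. \<Sum>j<n. smul (B k l * A p j) (ymul l (ymul j (ins_sym k (ins_sym p a)))))"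
    by (subst sum4_swap) (intro sum.cong refl, subst ymul_commute, subst ins_sym_commute, simp add: mult.commute)
  then show ?thesis
    by (simp add: rho_rho) (simp add: rho_def W.scale_left_diff_distrib sum_subtractf)
qed

lemma rho_add: "rho (\<lambda>k l. A k l + B k l) a = rho A a + rho B a"
  unfolding rho_def minus_add_distrib W.scale_left_distrib sum.distrib ..

lemma rho_scaled_sum: "rho (\<lambda>k l. \<Sum>p<m. c p * A p k l) a = (\<Sum>p<m. smul (c p) (rho (A p) a))"
proof -
  have "(\<Sum>p<m. smul (c p) (rho (A p) a)) = (\<Sum>p<m. \<Sum>k<n. \<Sum>l<n. smul (- (c p * A p k l)) (ymul l (ins_sym k a)))"
    by (simp add: rho_def W.scale_sum_right)
  also have "\<dots> = (\<Sum>k<n. \<Sum>l<n. \<Sum>p<m. smul (- (c p * A p k l)) (ymul l (ins_sym k a)))"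
    by (subst sum.swap, rule sum.cong[OF refl], rule sum.swap)
  finally show ?thesis by (simp add: rho_def W.scale_sum_left sum_negf)
qed

lemma act_commutator: "weyl_map (act (e i)) (weyl_map (act (e j)) a) - weyl_map (act (e j)) (weyl_map (act (e i)) a)
  = (\<Sum>k<n. smul (struct k i j) (weyl_map (act (e k)) a))"
proof (intro ext)
  fix m M S
  have "act (br (e i) (e j)) x = (\<Sum>k<n. sc (struct k i j) (act (e k) x))" for x
    unfolding struct_def by (rule hom_expand[OF act_hom_left])
  then show "(weyl_map (act (e i)) (weyl_map (act (e j)) a) - weyl_map (act (e j)) (weyl_map (act (e i)) a)) m M S
    = (\<Sum>k<n. smul (struct k i j) (weyl_map (act (e k)) a)) m M S"
    by (simp add: sum_fun_apply weyl_map_def act_bracket[symmetric])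
qed

text \<open>Torsion-freeness turns the commutators of the connection terms with the
  \<open>- ins_sym\<close> terms into precisely the summand that completes
  \<open>nab k\<close>.\<close>

lemma nab_commutator:
  assumes "i < n" "j < n"
  shows "nab i (nab j a) - nab j (nab i a) = (\<Sum>k<n. smul (struct k i j) (nab k a)) + rho (curvm i j) a"
proof -
  have curv: "(\<lambda>k l. (\<Sum>p<n. conn (e i) k p * conn (e j) p l) - (\<Sum>p<n. conn (e j) k p * conn (e i) p l))
    = (\<lambda>k l. curvm i j k l + (\<Sum>p<n. struct p i j * conn (e p) k l))"
    by (simp add: fun_eq_iff curvm_conn)
  have rr: "rho (conn (e i)) (rho (conn (e j)) a) - rho (conn (e j)) (rho (conn (e i)) a)
    = rho (curvm i j) a + (\<Sum>k<n. smul (struct k i j) (rho (conn (e k)) a))"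
    unfolding rho_commutator curv rho_add rho_scaled_sum ..
  have tor: "(\<Sum>k<n. smul (conn (e j) k i) (ins_sym k a)) - (\<Sum>k<n. smul (conn (e i) k j) (ins_sym k a))
    = - (\<Sum>k<n. smul (struct k i j) (ins_sym k a))"
    unfolding conn_torsion[symmetric] W.scale_left_diff_distrib sum_subtractf by simp
  have "nab i (nab j a) - nab j (nab i a) =
     (rho (conn (e i)) (rho (conn (e j)) a) - rho (conn (e j)) (rho (conn (e i)) a))
   + (weyl_map (act (e i)) (weyl_map (act (e j)) a) - weyl_map (act (e j)) (weyl_map (act (e i)) a))
   + ((\<Sum>k<n. smul (conn (e j) k i) (ins_sym k a)) - (\<Sum>k<n. smul (conn (e i) k j) (ins_sym k a)))"
    unfolding nab_def rho_simps actw_simps gen_simps rho_act act_commute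
      rho_ins_sym[OF assms(1)] rho_ins_sym[OF assms(2)] ins_sym_commute[of j i]
    by (simp add: algebra_simps)
  then show ?thesis unfolding rr tor act_commutator
    by (simp add: nab_def W.scale_right_distrib W.scale_right_diff_distrib sum.distrib sum_subtractf algebra_simps)
qed

subsection \<open>Derivations\<close>

lemma rho_circ:
  assumes "\<And>i j. i < n \<Longrightarrow> j < n \<Longrightarrow> defect A pi_mat i j = 0"
  shows "rho A (a \<odot> b) = rho A a \<odot> b + a \<odot> rho A b"
proof (rule slicewise_circ2[OF slicewise_rho], rule mu_derivation[where X = "rho A" and x = A])
  show "rho A (weyl_mult f a b) = weyl_mult f (rho A a) b + weyl_mult f a (rho A b)" for a b
    by (simp add: rho_def ins_sym_weyl_mult[OF f_biadditive] gen_simps sum.distrib W.scale_right_distrib W.scale_right_diff_distrib sum_negf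
      biadditive_simps[OF biadditive_weyl_mult[OF f_biadditive]] weyl_mult_smul sum_subtractf
      ymul_weyl_mult_left[OF f_biadditive] ymul_weyl_mult_right[OF f_biadditive])
  show "additive (rho A)" by (rule slicewiseD(1)[OF slicewise_rho])
qed (use assms in \<open>simp_all add: rho_simps rho_ins_sym defect_def\<close>)

lemma act_circ: "weyl_map (act X) (a \<odot> b) = weyl_map (act X) a \<odot> b + a \<odot> weyl_map (act X) b"
proof (rule slicewise_circ2[OF slicewise_act], rule mu_twisted_derivation[where X = "weyl_map (act X)" and Y = "\<lambda>a. a"])
  fix a b :: "'b weyl"
  show "weyl_map (act X) (weyl_mult f a b) = weyl_mult f (weyl_map (act X) a) b + weyl_mult f a (weyl_map (act X) b)"
  proof (intro ext)
    fix m M and S :: "nat set"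
    have alt: "act X (alt k x) = alt k (act X x)" for k x
      by (simp add: alt_def additive_simps[OF additive_act])
    show "weyl_map (act X) (weyl_mult f a b) m M S =
      (weyl_mult f (weyl_map (act X) a) b + weyl_mult f a (weyl_map (act X) b)) m M S"
      by (cases "finite S") (simp_all add: weyl_mult_parts weyl_map_def additive.sum[OF additive_act]
        additive.zero[OF additive_act] case_prod_unfold alt act_derivation alt_add sum.distrib)
  qed
qed (simp_all add: actw_simps act_commute additive_weyl_map additive_act)

lemma nab_circ:
  shows "nab i (a \<odot> b) = nab i a \<odot> b + a \<odot> nab i b"
  unfolding nab_def by (simp add: rho_circ[OF defect_pi] act_circ ins_sym_circ circ_simps algebra_simps)

lemma dtheta_circ: "dtheta k a \<odot> b = dtheta k (a \<odot> b)" "a \<odot> dtheta k b = dtheta k (a \<odot> b)"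
  by (simp_all add: dtheta_def circ_simps circ_smul theta_circ_left theta_circ_right eps_eps)

lemma dCE_circ: "dCE (a \<odot> b) = dCE a \<odot> b + eps a \<odot> dCE b"
  by (simp add: dCE_def circ_simps dtheta_circ ins_asym_circ dtheta_simps sum.distrib)

lemma E_circ: "E (a \<odot> b) = E a \<odot> b + eps a \<odot> E b"
  unfolding E_def dCE_circ
  by (simp add: nab_circ gen_simps circ_simps theta_circ_left theta_circ_right eps_eps sum.distrib)

subsection \<open>Supports\<close>

text \<open>Membership in the actual Weyl algebra. The signs need it, because \<open>card\<close> of
  an infinite set is 0 and parity would fail there, and so does the unit, because products vanish on
  infinite sets.\<close>

definition supported :: "'c::zero weyl \<Rightarrow> bool" where
  "supported a \<longleftrightarrow> (\<forall>m M S. a m M S \<noteq> 0 \<longrightarrow> set_mset M \<subseteq> {..<n} \<and> S \<subseteq> {..<n})"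

lemma supportedD: "supported a \<Longrightarrow> a m M S \<noteq> 0 \<Longrightarrow> set_mset M \<subseteq> {..<n} \<and> S \<subseteq> {..<n}"
  by (simp add: supported_def)

lemma eps_theta:
  assumes "supported a" shows "eps (theta i a) = - theta i (eps a)"
proof (intro ext)
  fix m M S
  show "eps (theta i a) m M S = (- theta i (eps a)) m M S"
  proof (cases "i \<in> S \<and> a m M (S - {i}) \<noteq> 0")
    case True
    then have "S - {i} \<subseteq> {..<n}" using supportedD[OF assms] by blast
    then have "finite (S - {i})" by (rule finite_subset) simp
    then have "finite (insert i (S - {i}))" by simp
    then have "finite S" using True by (simp add: insert_absorb)
    then have "card S = Suc (card (S - {i}))" using True by (intro card.remove) auto
    then obtain c where "card S = Suc c" by blast
    then show ?thesis using True by (simp add: eps_def theta_def wedge_gen_def parity_def add.commute)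
  next
    case False
    then show ?thesis by (auto simp: eps_def theta_def wedge_gen_def parity_def)
  qed
qed

lemma eps_ins_asym:
  assumes "supported a" shows "eps (ins_asym i a) = - ins_asym i (eps a)"
proof (intro ext)
  fix m M S
  show "eps (ins_asym i a) m M S = (- ins_asym i (eps a)) m M S"
  proof (cases "i \<notin> S \<and> a m M (insert i S) \<noteq> 0")
    case True
    then have "insert i S \<subseteq> {..<n}" using supportedD[OF assms] by blast
    then have "finite S" using finite_subset[of _ "{..<n}"] by auto
    then have "card (insert i S) = Suc (card S)" using True by simp
    then show ?thesis using True by (simp add: eps_def ins_asym_def ext_insert_below parity_def add.commute)
  next
    case False
    then show ?thesis by (auto simp: eps_def ins_asym_def ext_insert_below parity_def)
  qed
qed

lemma supported_zero: "supported (0 :: 'c::ab_group_add weyl)"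
  by (simp add: supported_def)

lemma supported_add: "supported a \<Longrightarrow> supported b \<Longrightarrow> supported (a + b :: 'c::ab_group_add weyl)"
  by (simp add: supported_def) (metis add.right_neutral)

lemma supported_minus: "supported a \<Longrightarrow> supported (- a :: 'c::ab_group_add weyl)"
  by (simp add: supported_def)

lemma supported_diff: "supported a \<Longrightarrow> supported b \<Longrightarrow> supported (a - b :: 'c::ab_group_add weyl)"
  using supported_add[OF _ supported_minus] by fastforce

lemma supported_sum: "(\<And>i. i \<in> I \<Longrightarrow> supported (g i)) \<Longrightarrow> supported (\<Sum>i\<in>I. g i :: 'c::ab_group_add weyl)"
  by (induction I rule: infinite_finite_induct) (simp_all add: supported_zero supported_add)

lemma supported_map: "supported a \<Longrightarrow> h 0 = 0 \<Longrightarrow> supported (weyl_map h a)"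
  unfolding supported_def weyl_map_def by metis

lemma supported_theta: "supported a \<Longrightarrow> i < n \<Longrightarrow> supported (theta i a)"
  unfolding supported_def theta_def wedge_gen_def by (auto split: if_splits) blast+

lemma supported_ins_asym: "supported a \<Longrightarrow> supported (ins_asym i a)"
  unfolding supported_def ins_asym_def ext_insert_below by (auto split: if_splits) blast+

lemma supported_ymul:
  assumes "supported a" "i < n" shows "supported (ymul i a)"
  unfolding supported_def
proof (intro allI impI)
  fix m M S assume "ymul i a m M S \<noteq> 0"
  then have i: "i \<in># M" "a m (M - {#i#}) S \<noteq> 0" by (auto simp: ymul_def split: if_splits)
  then have "set_mset (M - {#i#}) \<subseteq> {..<n} \<and> S \<subseteq> {..<n}" using supportedD[OF assms(1)] by blast
  moreover have "set_mset M = insert i (set_mset (M - {#i#}))" using i(1) by (metis insert_DiffM set_mset_add_mset_insert)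
  ultimately show "set_mset M \<subseteq> {..<n} \<and> S \<subseteq> {..<n}" using assms(2) by auto
qed

lemma supported_ins_sym:
  assumes "supported a" shows "supported (ins_sym i a)"
  unfolding supported_def
proof (intro allI impI)
  fix m M S assume "ins_sym i a m M S \<noteq> 0"
  then have "a m (add_mset i M) S \<noteq> 0" by (auto simp: ins_sym_def)
  then show "set_mset M \<subseteq> {..<n} \<and> S \<subseteq> {..<n}" using supportedD[OF assms] by fastforce
qed

lemma supported_tshift: "supported a \<Longrightarrow> supported (tshift a)"
  by (auto simp: supported_def tshift_def)

lemma supported_div_t: "supported a \<Longrightarrow> supported (div_t a)"
  by (auto simp: supported_def div_t_def)

lemma supported_const: "supported (weyl_const \<xi>)"
  by (auto simp: supported_def weyl_const_def)

lemma supported_act: "supported a \<Longrightarrow> supported (weyl_map (act X) a)"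
  by (rule supported_map) (simp_all add: additive.zero[OF additive_act])

lemma supported_smul: "supported a \<Longrightarrow> supported (smul c a)"
  by (rule supported_map) simp_all

lemma supported_rho: "supported a \<Longrightarrow> supported (rho A a)"
  unfolding rho_def by (intro supported_sum supported_smul supported_ymul supported_ins_sym) auto

lemma supported_nab: "supported a \<Longrightarrow> supported (nab i a)"
  unfolding nab_def by (intro supported_diff supported_add supported_rho supported_act supported_ins_sym)

lemma supported_dtheta: "supported a \<Longrightarrow> supported (dtheta k a)"
  unfolding dtheta_def by (intro supported_sum supported_smul supported_theta) auto

lemma supported_dCE: "supported a \<Longrightarrow> supported (dCE a)"
  unfolding dCE_def by (intro supported_sum supported_dtheta supported_ins_asym)

lemma supported_E: "supported a \<Longrightarrow> supported (E a)"
  unfolding E_def by (intro supported_add supported_sum supported_dCE supported_theta supported_nab) auto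

lemma weyl_mult_nonzero:
  assumes "biadditive g" "weyl_mult g a b m M S \<noteq> 0"
  obtains p N T where "p \<le> m" "N \<subseteq># M" "T \<subseteq> S" "finite S" "a p N T \<noteq> 0" "b (m - p) (M - N) (S - T) \<noteq> 0"
proof -
  have S: "finite S" using assms(2) by (metis weyl_mult_infinite)
  then obtain x where x: "x \<in> parts (m, M, S)" "(case x of (p, N, T) \<Rightarrow> alt (ninv T (S - T)) (g (a p N T) (b (m - p) (M - N) (S - T)))) \<noteq> 0"
    using assms(2) unfolding weyl_mult_parts[OF S] by (meson sum.not_neutral_contains_not_neutral)
  obtain p N T where "x = (p, N, T)" by (cases x)
  with x S show thesis
    by (intro that[of p N T]) (auto simp: parts_def biadditive_simps[OF assms(1)])
qed

lemma supported_weyl_mult: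
  assumes "biadditive g" "supported a" "supported b" shows "supported (weyl_mult g a b)"
  unfolding supported_def
proof (intro allI impI)
  fix m M S assume "weyl_mult g a b m M S \<noteq> 0"
  then obtain p N T where p: "N \<subseteq># M" "T \<subseteq> S" "a p N T \<noteq> 0" "b (m - p) (M - N) (S - T) \<noteq> 0"
    using weyl_mult_nonzero[OF assms(1)] by metis
  have "set_mset N \<subseteq> {..<n}" "T \<subseteq> {..<n}" using supportedD[OF assms(2) p(3)] by auto
  moreover have "set_mset (M - N) \<subseteq> {..<n}" "S - T \<subseteq> {..<n}" using supportedD[OF assms(3) p(4)] by auto
  moreover have "set_mset M = set_mset N \<union> set_mset (M - N)" using p(1)
    by (metis set_mset_union subset_mset.add_diff_inverse)
  ultimately show "set_mset M \<subseteq> {..<n} \<and> S \<subseteq> {..<n}" using p(2) by auto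
qed

lemma supported_mu: "supported a \<Longrightarrow> supported b \<Longrightarrow> supported (mu k a b)"
proof (induction k arbitrary: a b)
  case 0
  then show ?case by (simp add: supported_weyl_mult[OF f_biadditive])
next
  case (Suc k)
  show ?case unfolding mu_P.simps
    by (intro supported_sum supported_smul Suc.IH supported_ins_sym Suc.prems)
qed

lemma supported_circ:
  assumes "supported a" "supported b" shows "supported (a \<odot> b)"
  unfolding supported_def
proof (intro allI impI)
  fix m M S assume "(a \<odot> b) m M S \<noteq> 0"
  then obtain k where "mu_c k a b (m - k) M S \<noteq> 0"
    unfolding circ_mu_c sum_fun_apply by (meson sum.not_neutral_contains_not_neutral)
  moreover have "supported (mu_c k a b)" unfolding mu_c_def by (intro supported_smul supported_mu assms)
  ultimately show "set_mset M \<subseteq> {..<n} \<and> S \<subseteq> {..<n}" using supportedD by blast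
qed

lemma eps_rho: "eps (rho A a) = rho A (eps a)"
  by (simp add: rho_def gen_simps eps_ymul eps_ins_sym)

lemma eps_nab: "eps (nab i a) = nab i (eps a)"
  by (simp add: nab_def gen_simps eps_rho eps_ins_sym act_commute)

lemma eps_dtheta:
  assumes "supported a" shows "eps (dtheta k a) = dtheta k (eps a)"
proof -
  have "eps (theta i (theta j a)) = theta i (theta j (eps a))" if "j < n" for i j
    using assms that by (simp add: eps_theta supported_theta gen_simps)
  then show ?thesis by (simp add: dtheta_def gen_simps)
qed

lemma eps_dCE: "supported a \<Longrightarrow> eps (dCE a) = - dCE (eps a)"
  by (simp add: dCE_def gen_simps eps_dtheta supported_ins_asym eps_ins_asym dtheta_simps sum_negf)

lemma eps_E: "supported a \<Longrightarrow> eps (E a) = - E (eps a)"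
  by (simp add: E_def gen_simps eps_dCE eps_theta supported_nab eps_nab sum_negf)

subsection \<open>The square\<close>

lemma half_double: "smul (q (1/2)) (a + a) = a"
proof -
  have "smul (q (1/2)) (a + a) = smul (q (1/2) + q (1/2)) a"
    by (simp only: W.scale_right_distrib W.scale_left_distrib)
  then show ?thesis by (simp add: q_add[symmetric] q_one)
qed

lemma double_zero: "a + a = 0 \<Longrightarrow> (a :: 'b weyl) = 0"
  using half_double[of a] by (metis W.scale_zero_right)

lemma theta_antisymmetrize:
  "(\<Sum>i<n. \<Sum>j<n. theta i (theta j (Z i j))) = smul (q (1/2)) (\<Sum>i<n. \<Sum>j<n. theta i (theta j (Z i j - Z j i)))"
proof -
  have "(\<Sum>i<n. \<Sum>j<n. theta i (theta j (Z j i))) = (\<Sum>j<n. \<Sum>i<n. theta i (theta j (Z j i)))"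
    by (rule sum.swap)
  also have "\<dots> = - (\<Sum>i<n. \<Sum>j<n. theta i (theta j (Z i j)))"
    unfolding sum_negf[symmetric] by (intro sum.cong refl) (rule theta_anticommute)
  finally show ?thesis using half_double[of "\<Sum>i<n. \<Sum>j<n. theta i (theta j (Z i j))"]
    by (simp add: gen_simps sum_subtractf)
qed

lemma theta_cycle: "theta a (theta b (theta c x)) = theta c (theta a (theta b x))"
proof -
  have "theta a (theta b (theta c x)) = theta a (- theta c (theta b x))"
    by (rule arg_cong[of _ _ "theta a"], rule theta_anticommute)
  also have "\<dots> = theta c (theta a (theta b x))"
    unfolding gen_simps by (subst theta_anticommute) simp
  finally show ?thesis .
qed

lemma dtheta_theta: "dtheta k (theta j a) = theta j (dtheta k a)"
  by (simp add: dtheta_def gen_simps theta_cycle[of _ _ j])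

lemma dtheta_commute: "dtheta k (dtheta l a) = dtheta l (dtheta k a)"
  unfolding dtheta_def[of l] by (simp add: dtheta_simps dtheta_theta)

lemma dCE_theta:
  assumes "j < n" shows "dCE (theta j a) = dtheta j a - theta j (dCE a)"
proof -
  have "(\<Sum>k<n. dtheta k (if k = j then a else 0)) = dtheta j a"
    using assms by (simp add: if_distrib[of "dtheta _"] dtheta_simps sum.delta cong: if_cong)
  then show ?thesis by (simp add: dCE_def ins_asym_theta dtheta_simps dtheta_theta gen_simps sum_subtractf)
qed

lemma ins_asym_dtheta:
  assumes "k < n"
  shows "ins_asym k (dtheta l a) = dtheta l (ins_asym k a) - (\<Sum>j<n. smul (struct l k j) (theta j a))"
proof -
  have "ins_asym k (dtheta l a) = (\<Sum>i<n. \<Sum>j<n. smul (q (1/2) * - struct l i j) (if k = i then theta j a else 0))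
    - (\<Sum>i<n. \<Sum>j<n. smul (q (1/2) * - struct l i j) (theta i (if k = j then a else 0))) + dtheta l (ins_asym k a)"
    by (simp only: dtheta_def gen_simps ins_asym_theta W.scale_right_diff_distrib sum_subtractf) (simp add: algebra_simps)
  moreover have "(\<Sum>i<n. \<Sum>j<n. smul (q (1/2) * - struct l i j) (theta i (if k = j then a else 0)))
    = (\<Sum>i<n. smul (q (1/2) * - struct l i k) (theta i a))"
    using assms by (intro sum.cong refl) (simp add: if_distrib[of "theta _"] if_distrib[of "smul _"] gen_simps sum.delta cong: if_cong)
  moreover have "(\<Sum>i<n. \<Sum>j<n. smul (q (1/2) * - struct l i j) (if k = i then theta j a else 0))
    = (\<Sum>j<n. smul (q (1/2) * - struct l k j) (theta j a))"
    using assms by (subst sum.swap, intro sum.cong refl) (simp add: if_distrib[of "smul _"] sum.delta cong: if_cong)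
  moreover have "(\<Sum>i<n. smul (q (1/2) * - struct l i k) (theta i a)) = - (\<Sum>i<n. smul (q (1/2) * - struct l k i) (theta i a))"
    unfolding sum_negf[symmetric] by (intro sum.cong refl, subst struct_antisym) simp
  moreover have "(\<Sum>j<n. smul (q (1/2) * - struct l k j) (theta j a)) - - (\<Sum>i<n. smul (q (1/2) * - struct l k i) (theta i a))
    = - (\<Sum>j<n. smul (struct l k j) (theta j a))"
  proof -
    have "smul (q (1/2) * - struct l k j) x + smul (q (1/2) * - struct l k j) x = - smul (struct l k j) x" for j x
    proof -
      have "smul (q (1/2) * - struct l k j) x = smul (q (1/2)) (- smul (struct l k j) x)" by simp
      then show ?thesis by (simp only: W.scale_right_distrib[symmetric] half_double)
    qed
    then show ?thesis by (simp only: sum_negf diff_minus_eq_add sum.distrib[symmetric])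
  qed
  ultimately show ?thesis by (simp only:) simp
qed

lemma sum3_rotate: "(\<Sum>a\<in>I. \<Sum>b\<in>J. \<Sum>c\<in>K. g a b c) = (\<Sum>c\<in>K. \<Sum>a\<in>I. \<Sum>b\<in>J. (g a b c :: 'x::comm_monoid_add))"
proof -
  have "(\<Sum>a\<in>I. \<Sum>b\<in>J. \<Sum>c\<in>K. g a b c) = (\<Sum>a\<in>I. \<Sum>c\<in>K. \<Sum>b\<in>J. g a b c)"
    by (rule sum.cong[OF refl]) (rule sum.swap)
  also have "\<dots> = (\<Sum>c\<in>K. \<Sum>a\<in>I. \<Sum>b\<in>J. g a b c)" by (rule sum.swap)
  finally show ?thesis .
qed

text \<open>A cyclic shift of three anticommuting generators is an even permutation. Hence three
  times the sum has the cyclic sums of \<open>J\<close> as coefficients, and 3 is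
  invertible.\<close>

lemma theta_cyclic:
  assumes J: "\<And>a b c. J a b c + J b c a + J c a b = 0"
  shows "(\<Sum>a<n. \<Sum>b<n. \<Sum>c<n. smul (J a b c) (theta a (theta b (theta c x)))) = 0"
proof -
  define Z where "Z = (\<Sum>a<n. \<Sum>b<n. \<Sum>c<n. smul (J a b c) (theta a (theta b (theta c x))))"
  note t = theta_cycle
  have 1: "Z = (\<Sum>a<n. \<Sum>b<n. \<Sum>c<n. smul (J b c a) (theta a (theta b (theta c x))))"
  proof -
    have "Z = (\<Sum>a<n. \<Sum>b<n. \<Sum>c<n. smul (J a b c) (theta c (theta a (theta b x))))"
      unfolding Z_def by (intro sum.cong refl arg_cong[of _ _ "smul _"]) (rule t)
    also have "\<dots> = (\<Sum>c<n. \<Sum>a<n. \<Sum>b<n. smul (J a b c) (theta c (theta a (theta b x))))"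
      by (rule sum3_rotate)
    finally show ?thesis .
  qed
  have 2: "Z = (\<Sum>a<n. \<Sum>b<n. \<Sum>c<n. smul (J c a b) (theta a (theta b (theta c x))))"
  proof -
    have "Z = (\<Sum>a<n. \<Sum>b<n. \<Sum>c<n. smul (J b c a) (theta c (theta a (theta b x))))"
      unfolding 1 by (intro sum.cong refl arg_cong[of _ _ "smul _"]) (rule t)
    also have "\<dots> = (\<Sum>c<n. \<Sum>a<n. \<Sum>b<n. smul (J b c a) (theta c (theta a (theta b x))))"
      by (rule sum3_rotate)
    finally show ?thesis .
  qed
  have three: "of_nat (Suc 2) = (1 + 1 + 1 :: 'r)" by simp
  have "Z + Z + Z = (\<Sum>a<n. \<Sum>b<n. \<Sum>c<n. smul (J a b c + J b c a + J c a b) (theta a (theta b (theta c x))))"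
    by (simp only: W.scale_left_distrib sum.distrib 1[symmetric] 2[symmetric] Z_def[symmetric])
  then have "smul (of_nat (Suc 2)) Z = smul (of_nat (Suc 2)) 0"
    by (simp only: three J W.scale_left_distrib W.scale_one W.scale_zero_left W.scale_zero_right sum.neutral_const)
  then show ?thesis unfolding Z_def[symmetric] by (rule smul_of_nat_cancel)
qed

text \<open>Terms in which both insertions reach \<open>a\<close> cancel, being symmetric in the
  two-forms and antisymmetric in the insertions. Terms in which an insertion hits a two-form vanish
  by the Jacobi identity.\<close>

lemma dCE_dCE: "dCE (dCE a) = 0"
proof -
  define Z where "Z = (\<Sum>k<n. \<Sum>l<n. dtheta k (dtheta l (ins_asym k (ins_asym l a))))"
  have "Z = (\<Sum>l<n. \<Sum>k<n. dtheta k (dtheta l (ins_asym k (ins_asym l a))))"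
    unfolding Z_def by (rule sum.swap)
  also have "\<dots> = - Z"
    unfolding Z_def sum_negf[symmetric]
    by (intro sum.cong refl, subst dtheta_commute, subst ins_asym_anticommute) (simp add: dtheta_simps)
  finally have "Z = - Z" .
  then have "Z + Z = 0" by (simp only: eq_neg_iff_add_eq_0)
  then have Z: "Z = 0" by (rule double_zero)
  have T: "(\<Sum>k<n. \<Sum>j<n. dtheta k (smul (struct l k j) (theta j x))) = 0" for l x
  proof -
    define J where "J = (\<lambda>a b c. q (1/2) * (\<Sum>k<n. struct k a b * struct l c k))"
    have "(\<Sum>k<n. \<Sum>j<n. dtheta k (smul (struct l k j) (theta j x)))
      = (\<Sum>k<n. \<Sum>j<n. \<Sum>a<n. \<Sum>b<n. smul (q (1/2) * (struct k a b * struct l j k)) (theta a (theta b (theta j x))))"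
      unfolding dtheta_def gen_simps W.scale_scale
      by (intro sum.cong refl) (subst struct_antisym[of l], simp add: mult_ac)
    also have "\<dots> = (\<Sum>a<n. \<Sum>b<n. \<Sum>k<n. \<Sum>j<n. smul (q (1/2) * (struct k a b * struct l j k)) (theta a (theta b (theta j x))))"
      by (rule sum4_swap)
    also have "\<dots> = (\<Sum>a<n. \<Sum>b<n. \<Sum>j<n. smul (J a b j) (theta a (theta b (theta j x))))"
      unfolding J_def sum_distrib_left W.scale_sum_left
      by (rule sum.cong[OF refl], rule sum.cong[OF refl], rule sum.swap)
    also have "\<dots> = 0"
    proof (rule theta_cyclic)
      fix a b c
      show "J a b c + J b c a + J c a b = 0"
        unfolding J_def distrib_left[symmetric] by (simp add: struct_jacobi)
    qed
    finally show ?thesis .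
  qed
  have "dCE (dCE a) = (\<Sum>k<n. \<Sum>l<n. dtheta k (ins_asym k (dtheta l (ins_asym l a))))"
    by (simp add: dCE_def gen_simps dtheta_simps)
  also have "\<dots> = Z - (\<Sum>k<n. \<Sum>l<n. \<Sum>j<n. dtheta k (smul (struct l k j) (theta j (ins_asym l a))))"
    unfolding Z_def sum_subtractf[symmetric] by (intro sum.cong refl) (simp add: ins_asym_dtheta dtheta_simps del: smul_commute)
  finally have 1: "dCE (dCE a) = Z - (\<Sum>k<n. \<Sum>l<n. \<Sum>j<n. dtheta k (smul (struct l k j) (theta j (ins_asym l a))))" .
  have 2: "(\<Sum>k<n. \<Sum>l<n. \<Sum>j<n. dtheta k (smul (struct l k j) (theta j (ins_asym l a))))
    = (\<Sum>l<n. \<Sum>k<n. \<Sum>j<n. dtheta k (smul (struct l k j) (theta j (ins_asym l a))))"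
    by (rule sum.swap)
  show ?thesis unfolding 1 2 Z by (simp only: T) simp
qed

text \<open>The anticommuting generators turn the second order part into commutators of the
  \<open>nab i\<close>. Their structure constant term is cancelled by \<open>dCE\<close> acting on
  the generators, so only the curvature is left.\<close>

lemma E_E: "E (E a) = smul (q (1/2)) (\<Sum>i<n. \<Sum>j<n. theta i (theta j (rho (curvm i j) a)))"
proof -
  have "E (E a) = (\<Sum>i<n. \<Sum>j<n. theta i (theta j (nab i (nab j a)))) + (\<Sum>j<n. dtheta j (nab j a))"
    by (simp add: E_def nab_simps gen_simps dCE_simps nab_theta nab_dCE dCE_theta dCE_dCE sum.distrib sum_subtractf)
  moreover have "(\<Sum>i<n. \<Sum>j<n. theta i (theta j (nab i (nab j a))))
    = smul (q (1/2)) (\<Sum>i<n. \<Sum>j<n. theta i (theta j (\<Sum>k<n. smul (struct k i j) (nab k a))))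
      + smul (q (1/2)) (\<Sum>i<n. \<Sum>j<n. theta i (theta j (rho (curvm i j) a)))"
    unfolding theta_antisymmetrize[of "\<lambda>i j. nab i (nab j a)"] W.scale_right_distrib[symmetric] sum.distrib[symmetric]
      gen_simps(7,13)[symmetric] additive.add[OF additive_operators(1), symmetric]
    by (intro arg_cong[of _ _ "smul _"] sum.cong refl) (simp add: nab_commutator)
  moreover have "smul (q (1/2)) (\<Sum>i<n. \<Sum>j<n. theta i (theta j (\<Sum>k<n. smul (struct k i j) (nab k a))))
    = - (\<Sum>k<n. dtheta k (nab k a))"
  proof -
    have "(\<Sum>k<n. dtheta k (nab k a)) = (\<Sum>i<n. \<Sum>j<n. \<Sum>k<n. smul (q (1/2) * - struct k i j) (theta i (theta j (nab k a))))"
      unfolding dtheta_def by (rule sum3_rotate[symmetric])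
    then show ?thesis by (simp add: gen_simps W.scale_sum_right sum_negf)
  qed
  ultimately show ?thesis by (simp only:) simp
qed

end

section \<open>The curvature as a commutator\<close>

context fedosov_setup begin

subsection \<open>Flat and linear elements\<close>

lemma ins_sym_const: "ins_sym i (weyl_const \<xi>) = (0 :: 'c::ab_group_add weyl)"
  by (simp add: ins_sym_def weyl_const_def fun_eq_iff)

lemma weyl_mult_const_right:
  assumes f: "biadditive g" and S: "finite S"
  shows "weyl_mult g a (weyl_const \<xi>) m M S = (\<Sum>p\<le>m. g (a (m - p) M S) (fps_nth \<xi> p))"
proof -
  have "weyl_mult (\<lambda>x y. g y x) (weyl_const \<xi>) a = weyl_mult (\<lambda>x y. g x y) (\<lambda>m M S. alt (0 * card S) (a m M S)) (weyl_const \<xi>)"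
    by (rule weyl_mult_swap[OF biadditive_flip[OF f]]) (auto simp: weyl_const_def split: if_splits)
  then show ?thesis using weyl_mult_const_left[OF biadditive_flip[OF f] S, of \<xi> a m M] by simp
qed

definition unit_w :: "'b weyl" where
  "unit_w = weyl_const (fps_const u)"

lemma supported_unit: "supported unit_w"
  unfolding unit_w_def by (rule supported_const)

lemma supported_infinite: "supported a \<Longrightarrow> infinite S \<Longrightarrow> a m M S = 0"
  using supportedD[of a m M S] finite_subset[of S "{..<n}"] by auto

lemma sum_atMost_0: "(\<Sum>p\<le>m. if p = 0 then h p else 0) = (h (0::nat) :: 'x::comm_monoid_add)"
  by (simp add: sum.delta)

lemma weyl_mult_unit:
  assumes "supported b" shows "weyl_mult f unit_w b = b" "weyl_mult f b unit_w = b"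
proof -
  have "weyl_mult f unit_w b m M S = b m M S \<and> weyl_mult f b unit_w m M S = b m M S" for m M S
  proof (cases "finite S")
    case True
    have u0: "f 0 x = 0" "f x 0 = 0" for x by (rule biadditive_simps[OF f_biadditive])+
    have u: "f (fps_nth (fps_const u) p) x = (if p = 0 then x else 0)" for p x
      by (cases p) (simp_all only: fps_nth_fps_const if_True if_False f_unit u0 refl nat.distinct)
    have u': "f x (fps_nth (fps_const u) p) = (if p = 0 then x else 0)" for p x
      by (cases p) (simp_all only: fps_nth_fps_const if_True if_False f_unit u0 refl nat.distinct)
    show ?thesis
      unfolding unit_w_def weyl_mult_const_left[OF f_biadditive True] weyl_mult_const_right[OF f_biadditive True] u u' sum_atMost_0
      by simp
  qed (simp add: supported_infinite[OF assms])
  then show "weyl_mult f unit_w b = b" "weyl_mult f b unit_w = b" by (intro ext, blast)+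
qed

lemma circ_first_order:
  assumes "\<And>k. mu (Suc (Suc k)) a b = 0"
  shows "a \<odot> b = weyl_mult f a b + tshift (smul (q (1/2)) (mu 1 a b))"
proof (rule ext)
  fix m
  have 0: "mu_c (Suc (Suc k)) a b = 0" for k
    unfolding mu_c_def assms by simp
  show "(a \<odot> b) m = (weyl_mult f a b + tshift (smul (q (1/2)) (mu 1 a b))) m"
  proof (cases m)
    case 0
    then show ?thesis by (simp add: circ_mu_c mu_c_def q_one tshift_def)
  next
    case (Suc k)
    have "(\<Sum>l\<le>k. mu_c (Suc l) a b (k - l)) = mu_c 1 a b k"
      by (cases k) (simp_all add: 0 sum.atMost_Suc_shift del: sum.atMost_Suc)
    then show ?thesis
      by (simp add: circ_mu_c Suc sum.atMost_Suc_shift tshift_def mu_c_def[of 0] mu_c_def[of "Suc 0"] q_one del: sum.atMost_Suc)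
  qed
qed

text \<open>An element whose symmetric derivatives vanish cannot be contracted with
  anything.\<close>

lemma circ_flat:
  assumes z: "\<And>i. i < n \<Longrightarrow> ins_sym i z = 0"
  shows "z \<odot> a = weyl_mult f z a" "a \<odot> z = weyl_mult f a z"
proof -
  have "mu (Suc k) z a = 0" "mu (Suc k) a z = 0" for k
    by (simp_all add: z biadditive_simps[OF biadditive_mu])
  then show "z \<odot> a = weyl_mult f z a" "a \<odot> z = weyl_mult f a z"
    by (simp_all only: circ_first_order One_nat_def W.scale_zero_right operator_zero add_0_right)
qed

lemma unit_circ: "supported b \<Longrightarrow> unit_w \<odot> b = b" "supported b \<Longrightarrow> b \<odot> unit_w = b"
proof -
  have "ins_sym i unit_w = 0" for i by (simp add: unit_w_def ins_sym_const)
  then show "supported b \<Longrightarrow> unit_w \<odot> b = b" "supported b \<Longrightarrow> b \<odot> unit_w = b"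
    by (simp_all add: circ_flat weyl_mult_unit)
qed

definition lin_gen :: "nat \<Rightarrow> 'b weyl" where
  "lin_gen k = ymul k unit_w"

lemma supported_lin_gen: "k < n \<Longrightarrow> supported (lin_gen k)"
  by (simp add: lin_gen_def supported_ymul supported_unit)

lemma ins_sym_lin_gen: "ins_sym i (lin_gen k) = (if i = k then unit_w else 0)"
  by (simp add: lin_gen_def ins_sym_ymul unit_w_def ins_sym_const operator_zero)

lemma lin_gen_circ:
  assumes "k < n" "supported b"
  shows "lin_gen k \<odot> b = ymul k b + tshift (smul (q (1/2)) (\<Sum>j<n. smul (pi_mat k j) (ins_sym j b)))"
    and "b \<odot> lin_gen k = ymul k b + tshift (smul (q (1/2)) (\<Sum>j<n. smul (pi_mat j k) (ins_sym j b)))"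
proof -
  have u0: "ins_sym i unit_w = 0" for i by (simp add: unit_w_def ins_sym_const)
  have ins_sym_if: "ins_sym i' (if i = k then unit_w else 0) = 0" for i i' by (simp add: u0 operator_zero)
  have 2: "mu (Suc (Suc l)) (lin_gen k) b = 0" "mu (Suc (Suc l)) b (lin_gen k) = 0" for l
    by (simp_all add: ins_sym_lin_gen ins_sym_if biadditive_simps[OF biadditive_mu])
  have w: "weyl_mult f (if i = k then unit_w else 0) (ins_sym j b) = (if i = k then ins_sym j b else 0)"
    "weyl_mult f (ins_sym j b) (if i = k then unit_w else 0) = (if i = k then ins_sym j b else 0)" for i j
    using supported_ins_sym[OF assms(2)]
    by (simp_all add: weyl_mult_unit biadditive_simps[OF biadditive_weyl_mult[OF f_biadditive]])
  have "mu 1 (lin_gen k) b = (\<Sum>i<n. \<Sum>j<n. if i = k then smul (pi_mat k j) (ins_sym j b) else 0)"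
    by (simp add: ins_sym_lin_gen w if_distrib[of "smul _"] cong: if_cong)
  then have 1: "mu 1 (lin_gen k) b = (\<Sum>j<n. smul (pi_mat k j) (ins_sym j b))"
    using assms(1) by (subst (asm) sum.swap) (simp add: sum.delta)
  have "mu 1 b (lin_gen k) = (\<Sum>i<n. \<Sum>j<n. if j = k then smul (pi_mat i j) (ins_sym i b) else 0)"
    by (simp add: ins_sym_lin_gen w if_distrib[of "smul _"] cong: if_cong)
  then have oneb: "mu 1 b (lin_gen k) = (\<Sum>j<n. smul (pi_mat j k) (ins_sym j b))"
    using assms(1) by (simp add: sum.delta)
  show "lin_gen k \<odot> b = ymul k b + tshift (smul (q (1/2)) (\<Sum>j<n. smul (pi_mat k j) (ins_sym j b)))"
    unfolding circ_first_order[OF 2(1)] 1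
    by (simp add: lin_gen_def ymul_weyl_mult_left[OF f_biadditive] weyl_mult_unit assms)
  show "b \<odot> lin_gen k = ymul k b + tshift (smul (q (1/2)) (\<Sum>j<n. smul (pi_mat j k) (ins_sym j b)))"
    unfolding circ_first_order[OF 2(2)] oneb
    by (simp add: lin_gen_def ymul_weyl_mult_right[OF f_biadditive] weyl_mult_unit assms)
qed

subsection \<open>The curvature as an inner derivation\<close>

text \<open>The symmetric part of \<open>\<pi>\<close> contributes to the anticommutator with a generator, the antisymmetric
  part to the commutator.\<close>

definition half_anticomm :: "nat \<Rightarrow> 'b weyl \<Rightarrow> 'b weyl" where
  "half_anticomm k b = ymul k b + tshift (smul (q (1/2)) (\<Sum>j<n. smul (s k j) (ins_sym j b)))"

definition half_comm :: "nat \<Rightarrow> 'b weyl \<Rightarrow> 'b weyl" where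
  "half_comm k b = tshift (smul (q (1/2)) (\<Sum>j<n. smul (r k j) (ins_sym j b)))"

lemma lin_gen_half_anticomm_half_comm:
  assumes "k < n" "supported b"
  shows "lin_gen k \<odot> b = half_anticomm k b + half_comm k b" "b \<odot> lin_gen k = half_anticomm k b - half_comm k b"
proof -
  have "(\<Sum>j<n. smul (pi_mat j k) (ins_sym j b)) = (\<Sum>j<n. smul (s k j) (ins_sym j b)) - (\<Sum>j<n. smul (r k j) (ins_sym j b))"
    unfolding sum_subtractf[symmetric] W.scale_left_diff_distrib[symmetric]
  proof (rule sum.cong[OF refl])
    fix j assume "j \<in> {..<n}"
    then have "pi_mat j k = s k j - r k j"
      using assms s_sym[of j k] r_antisym[of j k] by (simp add: pi_mat_def)
    then show "smul (pi_mat j k) (ins_sym j b) = smul (s k j - r k j) (ins_sym j b)" by simp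
  qed
  then show "b \<odot> lin_gen k = half_anticomm k b - half_comm k b"
    using lin_gen_circ(2)[OF assms] by (simp add: half_anticomm_def half_comm_def W.scale_right_diff_distrib operator_diff)
  show "lin_gen k \<odot> b = half_anticomm k b + half_comm k b"
    using lin_gen_circ(1)[OF assms]
    by (simp add: half_anticomm_def half_comm_def pi_mat_def W.scale_left_distrib W.scale_right_distrib sum.distrib operator_add add_ac)
qed

lemma supported_half_anticomm: "k < n \<Longrightarrow> supported b \<Longrightarrow> supported (half_anticomm k b)"
  unfolding half_anticomm_def by (intro supported_add supported_ymul supported_tshift supported_smul supported_sum supported_ins_sym)

lemma supported_half_comm: "supported b \<Longrightarrow> supported (half_comm k b)"
  unfolding half_comm_def by (intro supported_tshift supported_smul supported_sum supported_ins_sym)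

lemma half_anticomm_simps: "half_anticomm k (a + b) = half_anticomm k a + half_anticomm k b" "half_anticomm k (a - b) = half_anticomm k a - half_anticomm k b" "half_anticomm k (smul c a) = smul c (half_anticomm k a)"
  "half_anticomm k 0 = 0" "half_anticomm k (\<Sum>i\<in>I. g i) = (\<Sum>i\<in>I. half_anticomm k (g i))" "half_anticomm k (tshift a) = tshift (half_anticomm k a)"
proof -
  have "additive (half_anticomm k)"
    by (simp add: additive_def half_anticomm_def gen_simps W.scale_right_distrib sum.distrib add_ac)
  note [simp] = additive_simps[OF this]
  show "half_anticomm k (a + b) = half_anticomm k a + half_anticomm k b" "half_anticomm k (a - b) = half_anticomm k a - half_anticomm k b"
    "half_anticomm k 0 = 0" "half_anticomm k (\<Sum>i\<in>I. g i) = (\<Sum>i\<in>I. half_anticomm k (g i))" by simp_all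
  show "half_anticomm k (smul c a) = smul c (half_anticomm k a)"
    by (simp add: half_anticomm_def gen_simps W.scale_right_distrib W.scale_sum_right mult_ac)
  show "half_anticomm k (tshift a) = tshift (half_anticomm k a)"
    by (simp add: half_anticomm_def gen_simps tshift_commute)
qed

lemma half_comm_simps: "half_comm k (a + b) = half_comm k a + half_comm k b" "half_comm k (a - b) = half_comm k a - half_comm k b"
proof -
  have "additive (half_comm k)"
    by (simp add: additive_def half_comm_def gen_simps W.scale_right_distrib sum.distrib add_ac)
  note [simp] = additive_simps[OF this]
  show "half_comm k (a + b) = half_comm k a + half_comm k b" "half_comm k (a - b) = half_comm k a - half_comm k b" by simp_all
qed

text \<open>A Heisenberg relation: of the two summands of \<open>half_anticomm l\<close>, only the
  multiplication fails to commute with the derivatives.\<close>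

lemma half_comm_half_anticomm:
  assumes "l < n" shows "half_comm k (half_anticomm l b) = half_anticomm l (half_comm k b) + tshift (smul (q (1/2) * r k l) b)"
proof -
  have 1: "half_comm k (ymul l b) = ymul l (half_comm k b) + tshift (smul (q (1/2) * r k l) b)"
  proof -
    have "(\<Sum>j<n. smul (r k j) (if j = l then b else 0)) = smul (r k l) b"
      using assms by (simp add: if_distrib[of "smul _"] sum.delta cong: if_cong)
    then show ?thesis
      by (simp add: half_comm_def ins_sym_ymul W.scale_right_distrib sum.distrib gen_simps tshift_commute add_ac)
  qed
  have sm: "half_comm k (smul c a) = smul c (half_comm k a)" "half_comm k (tshift a) = tshift (half_comm k a)"
     "half_comm k (ins_sym j a) = ins_sym j (half_comm k a)" for c a j
    by (simp_all add: half_comm_def gen_simps tshift_commute W.scale_sum_right mult_ac ins_sym_commute[of j])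
  have "half_comm k (\<Sum>j<n. smul (s l j) (ins_sym j b)) = (\<Sum>j<n. smul (s l j) (ins_sym j (half_comm k b)))"
  proof -
    have "additive (half_comm k)" by (simp add: additive_def half_comm_simps)
    then show ?thesis by (simp add: additive.sum sm)
  qed
  then show ?thesis by (simp add: half_anticomm_def half_comm_simps 1 sm add_ac)
qed

text \<open>Left and right multiplication by a generator are \<open>half_anticomm\<close> plus and
  minus \<open>half_comm\<close>, so the commutator with a quadratic element consists of the mixed
  products. Among these the \<open>s\<close> terms vanish and the rest is the vector field
  \<open>rho F\<close>.\<close>

lemma commutator_quadratic:
  assumes sym: "\<And>k l. B k l = B l k" and F: "\<And>k p. k < n \<Longrightarrow> p < n \<Longrightarrow> (\<Sum>l<n. B k l * r l p) = - F p k"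
    and inv: "\<And>j p. j < n \<Longrightarrow> p < n \<Longrightarrow> defect F s j p = 0" and b: "supported b"
  shows "(\<Sum>k<n. \<Sum>l<n. smul (B k l) (ymul k (ymul l unit_w))) \<odot> b - b \<odot> (\<Sum>k<n. \<Sum>l<n. smul (B k l) (ymul k (ymul l unit_w)))
    = tshift (smul 2 (rho F b))"
proof -
  \<comment> \<open>The symmetric and the fibrewise product of two generators differ by a multiple
    of the unit, which drops out of commutators.\<close>
  have yy: "ymul k (ymul l unit_w) = lin_gen k \<odot> lin_gen l - tshift (smul (q (1/2) * pi_mat k l) unit_w)" if "k < n" "l < n" for k l
  proof -
    have "(\<Sum>j<n. smul (pi_mat k j) (if j = l then unit_w else 0)) = smul (pi_mat k l) unit_w"
      using that by (simp add: if_distrib[of "smul _"] sum.delta cong: if_cong)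
    then show ?thesis using lin_gen_circ(1)[OF that(1) supported_lin_gen[OF that(2)]]
      by (simp add: ins_sym_lin_gen) (simp add: lin_gen_def)
  qed
  have c: "ymul k (ymul l unit_w) \<odot> b - b \<odot> ymul k (ymul l unit_w)
    = (half_anticomm k (half_anticomm l b) + half_anticomm k (half_comm l b) + half_comm k (half_anticomm l b) + half_comm k (half_comm l b))
    - (half_anticomm l (half_anticomm k b) - half_anticomm l (half_comm k b) - half_comm l (half_anticomm k b) + half_comm l (half_comm k b))" if "k < n" "l < n" for k l
  proof -
    have "ymul k (ymul l unit_w) \<odot> b - b \<odot> ymul k (ymul l unit_w) = (lin_gen k \<odot> lin_gen l) \<odot> b - b \<odot> (lin_gen k \<odot> lin_gen l)"
      unfolding yy[OF that] by (simp add: circ_simps tshift_circ circ_smul unit_circ b)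
    also have "\<dots> = lin_gen k \<odot> (lin_gen l \<odot> b) - (b \<odot> lin_gen k) \<odot> lin_gen l" by (simp only: circ_assoc)
    finally show ?thesis
      using that b by (simp add: lin_gen_half_anticomm_half_comm supported_half_anticomm supported_half_comm supported_add supported_diff half_anticomm_simps half_comm_simps algebra_simps)
  qed
  have swap: "(\<Sum>k<n. \<Sum>l<n. smul (B k l) (h l k)) = (\<Sum>k<n. \<Sum>l<n. smul (B k l) (h k l))" for h :: "nat \<Rightarrow> nat \<Rightarrow> 'b weyl"
    by (subst sum.swap) (intro sum.cong refl, subst sym, rule refl)
  \<comment> \<open>A symmetric tensor contracted with an antisymmetric one. This removes the
    reordering term of \<open>half_comm_half_anticomm\<close>.\<close>
  have Br: "(\<Sum>k<n. \<Sum>l<n. B k l * r k l) = 0"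
  proof -
    have "(\<Sum>k<n. \<Sum>l<n. B k l * r k l) = (\<Sum>l<n. \<Sum>k<n. B k l * r k l)" by (rule sum.swap)
    also have "\<dots> = - (\<Sum>k<n. \<Sum>l<n. B k l * r k l)"
      unfolding sum_negf[symmetric]
    proof (intro sum.cong refl)
      fix x y assume "x \<in> {..<n}" "y \<in> {..<n}"
      then have "r y x = - r x y" by (intro r_antisym) auto
      then show "B y x * r y x = - (B x y * r x y)" by (simp add: sym[of y x])
    qed
    finally have "(\<Sum>k<n. \<Sum>l<n. B k l * r k l) + (\<Sum>k<n. \<Sum>l<n. B k l * r k l) = 0"
      by (simp only: eq_neg_iff_add_eq_0)
    then have "q (1/2) * ((\<Sum>k<n. \<Sum>l<n. B k l * r k l) + (\<Sum>k<n. \<Sum>l<n. B k l * r k l)) = 0" by (simp only: mult_zero_right)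
    then have "(q (1/2) + q (1/2)) * (\<Sum>k<n. \<Sum>l<n. B k l * r k l) = 0" by (simp only: distrib_left distrib_right)
    then show ?thesis by (simp add: q_add[symmetric] q_one)
  qed
  have NM: "(\<Sum>k<n. \<Sum>l<n. smul (B k l) (half_comm k (half_anticomm l b))) = (\<Sum>k<n. \<Sum>l<n. smul (B k l) (half_anticomm k (half_comm l b)))"
  proof -
    have "(\<Sum>k<n. \<Sum>l<n. smul (B k l) (half_comm k (half_anticomm l b))) = (\<Sum>k<n. \<Sum>l<n. smul (B k l) (half_anticomm l (half_comm k b))
        + smul (q (1/2) * (B k l * r k l)) (tshift b))"
      by (intro sum.cong refl) (simp add: half_comm_half_anticomm W.scale_right_distrib gen_simps mult_ac)
    also have "\<dots> = (\<Sum>k<n. \<Sum>l<n. smul (B k l) (half_anticomm l (half_comm k b))) + smul (q (1/2) * (\<Sum>k<n. \<Sum>l<n. B k l * r k l)) (tshift b)"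
      by (simp only: sum.distrib W.scale_sum_left sum_distrib_left)
    finally show ?thesis using swap[of "\<lambda>k l. half_anticomm k (half_comm l b)"] by (simp add: Br)
  qed
  have N: "(\<Sum>l<n. smul (B k l) (half_comm l b)) = tshift (smul (q (1/2)) (\<Sum>j<n. smul (- F j k) (ins_sym j b)))" if "k < n" for k
  proof -
    have "(\<Sum>l<n. smul (B k l) (half_comm l b)) = tshift (smul (q (1/2)) (\<Sum>l<n. \<Sum>j<n. smul (B k l * r l j) (ins_sym j b)))"
      by (simp add: half_comm_def W.scale_sum_right gen_simps mult_ac)
    also have "(\<Sum>l<n. \<Sum>j<n. smul (B k l * r l j) (ins_sym j b)) = (\<Sum>j<n. smul (\<Sum>l<n. B k l * r l j) (ins_sym j b))"
      unfolding W.scale_sum_left by (rule sum.swap)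
    also have "\<dots> = (\<Sum>j<n. smul (- F j k) (ins_sym j b))"
      by (intro sum.cong refl) (use F that in simp)
    finally show ?thesis .
  qed
  \<comment> \<open>Invariance of \<open>s\<close> makes \<open>G\<close> antisymmetric, while
    second derivatives are symmetric.\<close>
  have S: "(\<Sum>k<n. \<Sum>p<n. smul (s k p) (ins_sym p (\<Sum>j<n. smul (- F j k) (ins_sym j b)))) = 0"
  proof -
    define G where "G j p = (\<Sum>k<n. s k p * F j k)" for j p
    have G: "G j p + G p j = 0" if "j < n" "p < n" for j p
    proof -
      have "(\<Sum>k<n. s j k * F p k) = G p j" unfolding G_def
        by (rule sum.cong[OF refl]) (use s_sym[OF that(1)] in simp)
      then show ?thesis using inv[OF that] by (simp add: defect_def G_def)
    qed
    have "(\<Sum>k<n. \<Sum>p<n. smul (s k p) (ins_sym p (\<Sum>j<n. smul (- F j k) (ins_sym j b))))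
      = - (\<Sum>k<n. \<Sum>p<n. \<Sum>j<n. smul (s k p * F j k) (ins_sym p (ins_sym j b)))"
      by (simp add: gen_simps W.scale_sum_right sum_negf)
    moreover have "(\<Sum>k<n. \<Sum>p<n. \<Sum>j<n. smul (s k p * F j k) (ins_sym p (ins_sym j b)))
      = (\<Sum>p<n. \<Sum>j<n. smul (G j p) (ins_sym p (ins_sym j b)))"
      unfolding G_def W.scale_sum_left by (rule sum3_rotate[symmetric])
    moreover have "(\<Sum>p<n. \<Sum>j<n. smul (G j p) (ins_sym p (ins_sym j b))) = 0"
    proof (rule double_zero)
      have "(\<Sum>p<n. \<Sum>j<n. smul (G j p) (ins_sym p (ins_sym j b))) = (\<Sum>p<n. \<Sum>j<n. smul (G p j) (ins_sym p (ins_sym j b)))"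
        by (subst sum.swap) (intro sum.cong refl, subst ins_sym_commute, rule refl)
      then have "(\<Sum>p<n. \<Sum>j<n. smul (G j p) (ins_sym p (ins_sym j b))) + (\<Sum>p<n. \<Sum>j<n. smul (G j p) (ins_sym p (ins_sym j b)))
        = (\<Sum>p<n. \<Sum>j<n. smul (G j p + G p j) (ins_sym p (ins_sym j b)))"
        by (simp only: W.scale_left_distrib sum.distrib)
      also have "\<dots> = 0" by (intro sum.neutral ballI) (use G in simp)
      finally show "(\<Sum>p<n. \<Sum>j<n. smul (G j p) (ins_sym p (ins_sym j b))) + (\<Sum>p<n. \<Sum>j<n. smul (G j p) (ins_sym p (ins_sym j b))) = 0" .
    qed
    ultimately show ?thesis by (simp only: minus_zero)
  qed
  have MN: "(\<Sum>k<n. \<Sum>l<n. smul (B k l) (half_anticomm k (half_comm l b))) = tshift (smul (q (1/2)) (rho F b))"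
  proof -
    have "(\<Sum>k<n. \<Sum>l<n. smul (B k l) (half_anticomm k (half_comm l b))) = (\<Sum>k<n. half_anticomm k (\<Sum>l<n. smul (B k l) (half_comm l b)))"
      by (simp add: half_anticomm_simps)
    also have "\<dots> = (\<Sum>k<n. half_anticomm k (tshift (smul (q (1/2)) (\<Sum>j<n. smul (- F j k) (ins_sym j b)))))"
      by (intro sum.cong refl arg_cong[of _ _ "half_anticomm _"] N) simp
    also have "\<dots> = tshift (smul (q (1/2)) (\<Sum>k<n. half_anticomm k (\<Sum>j<n. smul (- F j k) (ins_sym j b))))"
    proof -
      have "(\<Sum>k<n. tshift (smul (q (1/2)) (half_anticomm k (X k)))) = tshift (smul (q (1/2)) (\<Sum>k<n. half_anticomm k (X k)))" for X
        by (simp only: W.scale_sum_right operator_sum)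
      then show ?thesis by (simp only: half_anticomm_simps(3,6))
    qed
    also have "(\<Sum>k<n. half_anticomm k (\<Sum>j<n. smul (- F j k) (ins_sym j b))) = rho F b
      + tshift (smul (q (1/2)) (\<Sum>k<n. \<Sum>p<n. smul (s k p) (ins_sym p (\<Sum>j<n. smul (- F j k) (ins_sym j b)))))"
    proof -
      have "(\<Sum>k<n. ymul k (\<Sum>j<n. smul (- F j k) (ins_sym j b))) = rho F b"
        unfolding rho_def gen_simps by (rule sum.swap)
      then show ?thesis by (simp only: half_anticomm_def sum.distrib) (simp only: gen_simps W.scale_sum_right)
    qed
    finally show ?thesis unfolding S by (simp add: gen_simps)
  qed
  have "(\<Sum>k<n. \<Sum>l<n. smul (B k l) (ymul k (ymul l unit_w))) \<odot> b - b \<odot> (\<Sum>k<n. \<Sum>l<n. smul (B k l) (ymul k (ymul l unit_w)))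
    = (\<Sum>k<n. \<Sum>l<n. smul (B k l) (ymul k (ymul l unit_w) \<odot> b - b \<odot> ymul k (ymul l unit_w)))"
    by (simp add: circ_simps circ_smul W.scale_right_diff_distrib sum_subtractf)
  also have "\<dots> = (\<Sum>k<n. \<Sum>l<n. smul (B k l) ((half_anticomm k (half_anticomm l b) + half_anticomm k (half_comm l b) + half_comm k (half_anticomm l b) + half_comm k (half_comm l b))
    - (half_anticomm l (half_anticomm k b) - half_anticomm l (half_comm k b) - half_comm l (half_anticomm k b) + half_comm l (half_comm k b))))"
    by (intro sum.cong refl arg_cong[of _ _ "smul _"] c) auto
  \<comment> \<open>By symmetry of \<open>B\<close> the two squares of each kind cancel, and the
    four mixed terms coincide by \<open>NM\<close>: four times 1/2 is the factor 2 of the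
    statement.\<close>
  also have "\<dots> = tshift (smul (q (1/2)) (rho F b)) + tshift (smul (q (1/2)) (rho F b)) + tshift (smul (q (1/2)) (rho F b))
     + tshift (smul (q (1/2)) (rho F b))"
    using swap[of "\<lambda>k l. half_anticomm k (half_anticomm l b)"] swap[of "\<lambda>k l. half_anticomm k (half_comm l b)"] swap[of "\<lambda>k l. half_comm k (half_anticomm l b)"] swap[of "\<lambda>k l. half_comm k (half_comm l b)"]
    by (simp add: W.scale_right_distrib W.scale_right_diff_distrib sum.distrib sum_subtractf NM MN)
  also have "\<dots> = tshift (smul (q (1/2) + q (1/2) + (q (1/2) + q (1/2))) (rho F b))"
    by (simp only: W.scale_left_distrib operator_add add.assoc)
  also have "q (1/2) + q (1/2) + (q (1/2) + q (1/2)) = 2"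
    by (simp add: q_add[symmetric] q_one)
  finally show ?thesis .
qed

text \<open>The curvature element \<open>curv_R\<close> with coefficients in the multiples of the
  unit; see \<open>jw_curv_R\<close>.\<close>

definition curv_w :: "'b weyl" where
  "curv_w = (\<Sum>i<n. \<Sum>j<n. theta i (theta j (smul (q (1/4)) (\<Sum>k<n. \<Sum>l<n. smul (beta i j k l) (ymul k (ymul l unit_w))))))"

text \<open>The factor 1/4 in the curvature, times the 2 of \<open>commutator_quadratic\<close>,
  matches the 1/2 in \<open>E_E\<close>.\<close>

lemma curv_w_commutator:
  assumes "supported b" shows "curv_w \<odot> b - b \<odot> curv_w = tshift (E (E b))"
proof -
  have 4: "q (1/4) * 2 = q (1/2)"
  proof -
    have "q (1/4) * 2 = q (1/4) + q (1/4)" by simp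
    then show ?thesis by (simp add: q_add[symmetric])
  qed
  have "curv_w \<odot> b - b \<odot> curv_w = (\<Sum>i<n. \<Sum>j<n. theta i (theta j (smul (q (1/4))
    ((\<Sum>k<n. \<Sum>l<n. smul (beta i j k l) (ymul k (ymul l unit_w))) \<odot> b - b \<odot> (\<Sum>k<n. \<Sum>l<n. smul (beta i j k l) (ymul k (ymul l unit_w)))))))"
    unfolding curv_w_def circ_simps(9,10) theta_circ_left theta_circ_right operator_minus eps_eps circ_smul
    by (simp only: sum_subtractf W.scale_right_diff_distrib gen_simps)
  also have "\<dots> = (\<Sum>i<n. \<Sum>j<n. theta i (theta j (smul (q (1/4)) (tshift (smul 2 (rho (curvm i j) b))))))"
    by (intro sum.cong refl arg_cong[of _ _ "theta _"] arg_cong[of _ _ "smul _"] commutator_quadratic assms beta_sym beta_r defect_curvm_s)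
  also have "\<dots> = tshift (E (E b))"
    by (simp add: E_E gen_simps tshift_commute W.scale_sum_right 4)
  finally show ?thesis .
qed

end

section \<open>Total degree, Bianchi identity, Koszul homotopy\<close>

section \<open>Filtration and homotopy\<close>

context fedosov_setup begin

abbreviation WF :: "nat \<Rightarrow> nat \<Rightarrow> 'c::ab_group_add weyl set" where
  "WF k l \<equiv> weyl_filt n k l"

lemma WFD: "a \<in> WF k l \<Longrightarrow> a m M S \<noteq> 0 \<Longrightarrow>
    set_mset M \<subseteq> {..<n} \<and> S \<subseteq> {..<n} \<and> card S = l \<and> k \<le> size M + 2 * m"
  by (simp add: weyl_filt_def)

lemma WFI: "(\<And>m M S. a m M S \<noteq> 0 \<Longrightarrow> set_mset M \<subseteq> {..<n} \<and> S \<subseteq> {..<n} \<and> card S = l \<and> k \<le> size M + 2 * m)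
    \<Longrightarrow> a \<in> WF k l"
  by (simp add: weyl_filt_def)

lemma WF_supported: "a \<in> WF k l \<Longrightarrow> supported a"
  by (simp add: supported_def weyl_filt_def)

lemma WFI': "supported a \<Longrightarrow> (\<And>m M S. a m M S \<noteq> 0 \<Longrightarrow> finite S \<Longrightarrow> card S = l \<and> k \<le> size M + 2 * m) \<Longrightarrow> a \<in> WF k l"
proof (rule WFI)
  fix m M S
  assume sup: "supported a" and a: "\<And>m M S. a m M S \<noteq> 0 \<Longrightarrow> finite S \<Longrightarrow> card S = l \<and> k \<le> size M + 2 * m"
    and nz: "a m M S \<noteq> 0"
  then have "finite S" using supported_infinite[OF sup] by blast
  then show "set_mset M \<subseteq> {..<n} \<and> S \<subseteq> {..<n} \<and> card S = l \<and> k \<le> size M + 2 * m"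
    using supportedD[OF sup nz] a[OF nz] by simp
qed

lemma WF_mono: "a \<in> WF k l \<Longrightarrow> k' \<le> k \<Longrightarrow> a \<in> WF k' l"
  by (rule WFI) (use WFD in force)

lemma WF_zero: "0 \<in> WF k l"
  by (simp add: weyl_filt_def)

lemma WF_add: "a \<in> WF k l \<Longrightarrow> b \<in> WF k l \<Longrightarrow> a + b \<in> WF k l"
proof (rule WFI)
  fix m M S assume ab: "a \<in> WF k l" "b \<in> WF k l" "(a + b) m M S \<noteq> 0"
  then have "a m M S \<noteq> 0 \<or> b m M S \<noteq> 0" by auto
  then show "set_mset M \<subseteq> {..<n} \<and> S \<subseteq> {..<n} \<and> card S = l \<and> k \<le> size M + 2 * m"
    using WFD[OF ab(1), of m M S] WFD[OF ab(2), of m M S] by argo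
qed

lemma WF_minus: "a \<in> WF k l \<Longrightarrow> - a \<in> WF k l"
  by (simp add: weyl_filt_def)

lemma WF_diff: "a \<in> WF k l \<Longrightarrow> b \<in> WF k l \<Longrightarrow> a - b \<in> WF k l"
  using WF_add[OF _ WF_minus] by fastforce

lemma WF_sum: "(\<And>i. i \<in> I \<Longrightarrow> g i \<in> WF k l) \<Longrightarrow> (\<Sum>i\<in>I. g i) \<in> WF k l"
  by (induction I rule: infinite_finite_induct) (simp_all add: WF_zero WF_add)

lemma WF_map: "a \<in> WF k l \<Longrightarrow> h 0 = 0 \<Longrightarrow> weyl_map h a \<in> WF k l"
proof (rule WFI)
  fix m M S assume a: "a \<in> WF k l" "h 0 = 0" "weyl_map h a m M S \<noteq> 0"
  then have "a m M S \<noteq> 0" by (auto simp: weyl_map_def)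
  then show "set_mset M \<subseteq> {..<n} \<and> S \<subseteq> {..<n} \<and> card S = l \<and> k \<le> size M + 2 * m"
    by (rule WFD[OF a(1)])
qed

lemma WF_smul: "a \<in> WF k l \<Longrightarrow> smul c a \<in> WF k l"
  by (rule WF_map) simp_all

lemma WF_theta:
  assumes "a \<in> WF k l" "i < n" shows "theta i a \<in> WF k (Suc l)"
proof (rule WFI')
  show "supported (theta i a)" by (rule supported_theta[OF WF_supported[OF assms(1)] assms(2)])
  fix m M S assume "theta i a m M S \<noteq> 0" "finite S"
  then have "i \<in> S" "a m M (S - {i}) \<noteq> 0" by (auto simp: theta_def wedge_gen_def split: if_splits)
  then show "card S = Suc l \<and> k \<le> size M + 2 * m"
    using WFD[OF assms(1)] card.remove[OF \<open>finite S\<close>, of i] by metis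
qed

lemma WF_ins_asym:
  assumes "a \<in> WF k (Suc l)" shows "ins_asym i a \<in> WF k l"
proof (rule WFI')
  show "supported (ins_asym i a)" by (rule supported_ins_asym[OF WF_supported[OF assms(1)]])
  fix m M S assume "ins_asym i a m M S \<noteq> 0" "finite S"
  then have "i \<notin> S" "a m M (insert i S) \<noteq> 0" by (auto simp: ins_asym_def ext_insert_below split: if_splits)
  then show "card S = l \<and> k \<le> size M + 2 * m"
    using WFD[OF assms(1)] card_insert_disjoint[OF \<open>finite S\<close>, of i] by (metis nat.inject)
qed

lemma ins_asym_WF_0:
  assumes "a \<in> WF k 0" shows "ins_asym i a = 0"
proof (intro ext)
  fix m M S
  have "a m M (insert i S) = 0"
  proof (rule ccontr)
    assume "a m M (insert i S) \<noteq> 0"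
    then have "card (insert i S) = 0" "insert i S \<subseteq> {..<n}" using WFD[OF assms] by blast+
    then show False using finite_subset[of "insert i S" "{..<n}"] by auto
  qed
  then show "ins_asym i a m M S = 0 m M S" by (simp add: ins_asym_def ext_insert_below)
qed

lemma WF_ymul:
  assumes "a \<in> WF k l" "i < n" shows "ymul i a \<in> WF (Suc k) l"
proof (rule WFI')
  show "supported (ymul i a)" by (rule supported_ymul[OF WF_supported[OF assms(1)] assms(2)])
  fix m M S assume "ymul i a m M S \<noteq> 0" "finite S"
  then have "i \<in># M" "a m (M - {#i#}) S \<noteq> 0" by (auto simp: ymul_def split: if_splits)
  then show "card S = l \<and> Suc k \<le> size M + 2 * m"
    using WFD[OF assms(1), of m "M - {#i#}" S] size_Suc_Diff1[of i M] by linarith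
qed

lemma WF_ins_sym:
  assumes "a \<in> WF k l" shows "ins_sym i a \<in> WF (k - 1) l"
proof (rule WFI')
  show "supported (ins_sym i a)" by (rule supported_ins_sym[OF WF_supported[OF assms(1)]])
  fix m M S assume "ins_sym i a m M S \<noteq> 0" "finite S"
  then have "a m (add_mset i M) S \<noteq> 0" by (auto simp: ins_sym_def)
  then show "card S = l \<and> k - 1 \<le> size M + 2 * m"
    using WFD[OF assms(1)] by fastforce
qed

lemma WF_div_t:
  assumes "a \<in> WF (k + 2) l" shows "div_t a \<in> WF k l"
proof (rule WFI)
  fix m M S assume "div_t a m M S \<noteq> 0"
  then have "a (Suc m) M S \<noteq> 0" by (simp add: div_t_def)
  then show "set_mset M \<subseteq> {..<n} \<and> S \<subseteq> {..<n} \<and> card S = l \<and> k \<le> size M + 2 * m"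
    using WFD[OF assms, of "Suc m" M S] by auto
qed

lemma WF_eps: "a \<in> WF k l \<Longrightarrow> eps a \<in> WF k l"
proof (rule WFI)
  fix m M S assume a: "a \<in> WF k l" "eps a m M S \<noteq> 0"
  then have "a m M S \<noteq> 0" by (auto simp: eps_def parity_def)
  then show "set_mset M \<subseteq> {..<n} \<and> S \<subseteq> {..<n} \<and> card S = l \<and> k \<le> size M + 2 * m"
    by (rule WFD[OF a(1)])
qed

lemma eps_WF: "a \<in> WF k l \<Longrightarrow> eps a = (if even l then a else - a)"
proof (intro ext)
  fix m M S assume a: "a \<in> WF k l"
  show "eps a m M S = (if even l then a else - a) m M S"
    using WFD[OF a, of m M S] by (cases "a m M S = 0") (auto simp: eps_def parity_def alt_def)
qed

lemma WF_weyl_mult: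
  assumes g: "biadditive g" and a: "a \<in> WF k l" and b: "b \<in> WF k' l'"
    and k: "K \<le> k + k'"
  shows "weyl_mult g a b \<in> WF K (l + l')"
proof (rule WFI')
  show "supported (weyl_mult g a b)" by (intro supported_weyl_mult g WF_supported[OF a] WF_supported[OF b])
  fix m M S assume "weyl_mult g a b m M S \<noteq> 0" "finite S"
  then obtain p N T where p: "p \<le> m" "N \<subseteq># M" "T \<subseteq> S" "a p N T \<noteq> 0" "b (m - p) (M - N) (S - T) \<noteq> 0"
    using weyl_mult_nonzero[OF g] by metis
  have "card T = l" "k \<le> size N + 2 * p" using WFD[OF a p(4)] by auto
  moreover have "card (S - T) = l'" "k' \<le> size (M - N) + 2 * (m - p)" using WFD[OF b p(5)] by auto
  moreover have "card S = card T + card (S - T)" using p(3) \<open>finite S\<close>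
    by (metis card_Diff_subset card_mono finite_subset le_add_diff_inverse)
  moreover have "size M = size N + size (M - N)" using p(2)
    by (metis size_union subset_mset.add_diff_inverse)
  ultimately show "card S = l + l' \<and> K \<le> size M + 2 * m" using p(1) k by linarith
qed

text \<open>Each application of the bidifferential operator lowers the symmetric degree by two;
  the truncated subtractions are harmless.\<close>

lemma WF_mu:
  assumes "a \<in> WF k l" "b \<in> WF k' l'"
  shows "mu p a b \<in> WF (k + k' - 2 * p) (l + l')"
  using assms
proof (induction p arbitrary: a b k k')
  case 0
  then show ?case by (simp add: WF_weyl_mult[OF f_biadditive 0])
next
  case (Suc p)
  have "mu p (ins_sym i a) (ins_sym j b) \<in> WF (k - 1 + (k' - 1) - 2 * p) (l + l')" for i j
    by (intro Suc.IH WF_ins_sym Suc.prems)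
  then have "mu p (ins_sym i a) (ins_sym j b) \<in> WF (k + k' - 2 * Suc p) (l + l')" for i j
    by (rule WF_mono) simp
  then show ?case unfolding mu_P.simps by (intro WF_sum WF_smul)
qed

lemma WF_circ:
  assumes "a \<in> WF k l" "b \<in> WF k' l'"
  shows "a \<odot> b \<in> WF (k + k') (l + l')"
proof (rule WFI)
  fix m M S assume "(a \<odot> b) m M S \<noteq> 0"
  then obtain p where p: "p \<le> m" "mu_c p a b (m - p) M S \<noteq> 0"
    unfolding circ_mu_c sum_fun_apply by (metis (no_types, lifting) atMost_iff sum.not_neutral_contains_not_neutral)
  have "mu_c p a b \<in> WF (k + k' - 2 * p) (l + l')"
    unfolding mu_c_def by (intro WF_smul WF_mu assms)
  from WFD[OF this p(2)] show "set_mset M \<subseteq> {..<n} \<and> S \<subseteq> {..<n} \<and> card S = l + l' \<and> k + k' \<le> size M + 2 * m"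
    using p(1) by auto
qed

lemma WF_rho:
  assumes "a \<in> WF k l" shows "rho A a \<in> WF k l"
  unfolding rho_def
proof (intro WF_sum WF_smul)
  fix i j assume "j \<in> {..<n}"
  then have "ymul j (ins_sym i a) \<in> WF (Suc (k - 1)) l"
    by (intro WF_ymul WF_ins_sym assms) auto
  then show "ymul j (ins_sym i a) \<in> WF k l" by (rule WF_mono) simp
qed

lemma WF_act: "a \<in> WF k l \<Longrightarrow> weyl_map (act X) a \<in> WF k l"
  by (rule WF_map) (simp_all add: additive.zero[OF additive_act])

lemma WF_dtheta: "a \<in> WF k l \<Longrightarrow> dtheta i a \<in> WF k (Suc (Suc l))"
  unfolding dtheta_def by (intro WF_sum WF_smul WF_theta) auto

lemma WF_dCE: "a \<in> WF k l \<Longrightarrow> dCE a \<in> WF k (Suc l)"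
proof (cases l)
  case 0
  assume "a \<in> WF k l"
  then have "dCE a = 0" using 0 by (simp add: dCE_def ins_asym_WF_0 dtheta_simps)
  then show ?thesis by (simp add: WF_zero)
next
  case (Suc l')
  assume "a \<in> WF k l"
  then show ?thesis unfolding dCE_def Suc by (intro WF_sum WF_dtheta WF_ins_asym)
qed

text \<open>\<open>E\<close> is split by its effect on the total degree: \<open>DL\<close> does not
  lower it, \<open>dl\<close> lowers it by at most one and is the part that the homotopy
  inverts.\<close>

definition DL :: "'b weyl \<Rightarrow> 'b weyl" where
  "DL a = (\<Sum>i<n. theta i (rho (conn (e i)) a + weyl_map (act (e i)) a)) + dCE a"

definition dl :: "'b weyl \<Rightarrow> 'b weyl" where
  "dl a = (\<Sum>i<n. theta i (ins_sym i a))"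

lemma E_DL: "E a = DL a - dl a"
  by (simp add: E_def DL_def dl_def nab_def gen_simps sum_subtractf sum.distrib)

lemma additive_dl: "additive dl"
  by (simp add: additive_def dl_def gen_simps sum.distrib)

lemma additive_DL: "additive DL"
proof -
  have "DL a = E a + dl a" for a by (simp add: E_DL)
  then show ?thesis using additive_dl by (simp add: additive_def E_simps)
qed

lemma WF_DL: "a \<in> WF k l \<Longrightarrow> DL a \<in> WF k (Suc l)"
  unfolding DL_def by (intro WF_add WF_sum WF_theta WF_rho WF_act WF_dCE) auto

lemma WF_dl: "a \<in> WF k l \<Longrightarrow> dl a \<in> WF (k - 1) (Suc l)"
  unfolding dl_def by (intro WF_sum WF_theta WF_ins_sym) auto

lemma WF_E: "a \<in> WF k l \<Longrightarrow> E a \<in> WF (k - 1) (Suc l)"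
  unfolding E_DL using WF_mono[OF WF_DL] by (intro WF_diff WF_dl) auto

lemma WF_unit: "unit_w \<in> WF 0 0"
  by (rule WFI) (auto simp: unit_w_def weyl_const_def split: if_splits)

lemma WF_curv: "curv_w \<in> WF 2 2"
proof -
  have "ymul k (ymul l unit_w) \<in> WF 2 0" if "k < n" "l < n" for k l
    using WF_ymul[OF WF_ymul[OF WF_unit]] that by (simp add: numeral_2_eq_2)
  then have "(\<Sum>k<n. \<Sum>l<n. smul (beta i j k l) (ymul k (ymul l unit_w))) \<in> WF 2 0" for i j
    by (intro WF_sum WF_smul) auto
  then have "theta i (theta j (smul (q (1/4)) (\<Sum>k<n. \<Sum>l<n. smul (beta i j k l) (ymul k (ymul l unit_w))))) \<in> WF 2 2"
    if "i < n" "j < n" for i j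
    using WF_theta[OF WF_theta[OF WF_smul]] that by (simp add: numeral_2_eq_2)
  then show ?thesis unfolding curv_w_def by (intro WF_sum) auto
qed

subsection \<open>The second Bianchi identity\<close>

lemma slice_zero: "slicewise sc X \<Longrightarrow> a m = 0 \<Longrightarrow> X a m = 0"
proof -
  assume X: "slicewise sc X" and a: "a m = 0"
  have "X a m = X 0 m" by (rule slicewiseD(2)[where a = a and m = m and b = 0 and m' = m, OF X]) (simp add: a)
  then show ?thesis by (simp add: additive.zero[OF slicewiseD(1)[OF X]])
qed

lemma curv_w_slice: "m \<noteq> 0 \<Longrightarrow> curv_w m = 0"
proof -
  assume "m \<noteq> 0"
  then have "unit_w m = 0" by (auto simp: unit_w_def weyl_const_def fun_eq_iff)
  then show ?thesis unfolding curv_w_def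
    by (simp add: sum_fun_apply slice_zero[OF slice(1)] slice_zero[OF slice(3)] slice_zero[OF slicewise_smul])
qed

text \<open>A derivative multiplies a coefficient by a positive multiplicity, which is invertible in
  the ground ring.\<close>

lemma ins_sym_eq_0:
  fixes a :: "'b weyl"
  assumes "supported a" "\<And>j. j < n \<Longrightarrow> ins_sym j a = 0" "M \<noteq> {#}" shows "a m M S = 0"
proof (rule ccontr)
  assume a: "a m M S \<noteq> 0"
  obtain j M' where M: "M = add_mset j M'" using assms(3) by (meson multiset_cases)
  then have "j < n" using supportedD[OF assms(1) a] by auto
  then have "(\<Sum>_\<in>{..count M' j}. a m M S) = 0" using fun_cong[OF fun_cong[OF fun_cong[OF assms(2)]], of j m M' S]
    by (simp add: ins_sym_def M)
  then have "sc (of_nat (Suc (count M' j))) (a m M S) = 0"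
    by (simp only: B.sum_constant_scale card_atMost)
  then have "sc (q (1 / of_nat (Suc (count M' j))) * of_nat (Suc (count M' j))) (a m M S) = 0"
    by (metis B.scale_scale B.scale_zero_right)
  moreover have "q (1 / of_nat (Suc (count M' j))) * of_nat (Suc (count M' j)) = 1"
    unfolding q_of_nat[symmetric] q_mult[symmetric] by (simp add: q_one del: of_nat_Suc)
  ultimately show False using a by (simp del: of_nat_Suc)
qed

text \<open>Contraction with \<open>omega_mat\<close> inverts \<open>r\<close>: by nondegeneracy, an
  element that commutes with all generators has vanishing symmetric derivatives.\<close>

lemma half_comm_eq_0:
  assumes "\<And>k. k < n \<Longrightarrow> half_comm k a = 0" "i < n" shows "ins_sym i a = 0"
proof -
  have 0: "(\<Sum>j<n. smul (r k j) (ins_sym j a)) = 0" if "k < n" for k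
  proof -
    have h: "smul (q (1/2)) (\<Sum>j<n. smul (r k j) (ins_sym j a)) = 0"
      using assms(1)[OF that] by (simp only: half_comm_def tshift_zero_iff)
    have "(\<Sum>j<n. smul (r k j) (ins_sym j a)) = smul (q (1/2)) (\<Sum>j<n. smul (r k j) (ins_sym j a))
        + smul (q (1/2)) (\<Sum>j<n. smul (r k j) (ins_sym j a))"
      by (simp only: W.scale_right_distrib[symmetric] half_double)
    then show ?thesis unfolding h by simp
  qed
  have "0 = (\<Sum>k<n. smul (omega_mat i k) (\<Sum>j<n. smul (r k j) (ins_sym j a)))"
    by (simp add: 0)
  also have "\<dots> = (\<Sum>k<n. \<Sum>j<n. smul (omega_mat i k * r k j) (ins_sym j a))"
    by (simp add: W.scale_sum_right)
  also have "\<dots> = (\<Sum>j<n. smul (\<Sum>k<n. omega_mat i k * r k j) (ins_sym j a))"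
    unfolding W.scale_sum_left by (rule sum.swap)
  also have "\<dots> = (\<Sum>j<n. if i = j then ins_sym j a else 0)"
    by (rule sum.cong[OF refl]) (use assms(2) omega_r in auto)
  also have "\<dots> = ins_sym i a" using assms(2) by (simp add: sum.delta)
  finally show ?thesis by simp
qed

text \<open>Since \<open>E\<close> commutes with \<open>E \<circ> E\<close>, which is the commutator
  with \<open>curv_w\<close> divided by t, the element \<open>E curv_w\<close> graded-commutes with
  everything. Commuting with the generators \<open>lin_gen k\<close> forces its symmetric
  derivatives to vanish.\<close>

lemma Bianchi: "E curv_w = 0"
proof -
  have sup: "supported curv_w" "supported (E curv_w)" using WF_supported[OF WF_curv] supported_E by blast+
  have eps: "eps curv_w = curv_w" using eps_WF[OF WF_curv] by simp
  have c: "E curv_w \<odot> b = eps b \<odot> E curv_w" if b: "supported b" for b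
  proof -
    have "E (curv_w \<odot> b - b \<odot> curv_w) = tshift (E (E (E b)))"
      unfolding curv_w_commutator[OF b] by (rule slicewise_tshift[OF slicewise_E])
    also have "\<dots> = curv_w \<odot> E b - E b \<odot> curv_w"
      by (rule curv_w_commutator[OF supported_E[OF b], symmetric])
    finally show ?thesis by (simp add: E_simps E_circ eps)
  qed
  have "half_comm k (E curv_w) = 0" if k: "k < n" for k
  proof -
    have "lin_gen k \<in> WF 1 0" unfolding lin_gen_def using WF_ymul[OF WF_unit k] by simp
    then have "eps (lin_gen k) = lin_gen k" by (simp add: eps_WF)
    then have "half_anticomm k (E curv_w) - half_comm k (E curv_w) = half_anticomm k (E curv_w) + half_comm k (E curv_w)"
      using c[OF supported_lin_gen[OF k]] lin_gen_half_anticomm_half_comm[OF k sup(2)] by simp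
    then have "half_comm k (E curv_w) + half_comm k (E curv_w) = 0"
      by (simp only: diff_conv_add_uminus add_left_cancel) (metis add.right_inverse)
    then show ?thesis by (rule double_zero)
  qed
  then have ins: "ins_sym j (E curv_w) = 0" if "j < n" for j
    using half_comm_eq_0 that by blast
  have "E curv_w m M S = 0" for m M S
  proof (cases "M = {#}")
    case False
    show ?thesis by (rule ins_sym_eq_0[OF sup(2) ins False])
  next
    \<comment> \<open>In symmetric degree 0, the order t^0 is excluded by total degree at least 1,
      and higher orders because \<open>curv_w\<close> lives in order t^0.\<close>
    case True
    show ?thesis
    proof (cases "m = 0")
      case m: True
      show ?thesis
        using WFD[OF WF_E[OF WF_curv], of m M S] True m by fastforce
    next
      case False
      then show ?thesis using slice_zero[where a = curv_w and m = m, OF slicewise_E] curv_w_slice by simp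
    qed
  qed
  then show ?thesis by (simp add: fun_eq_iff)
qed

subsection \<open>The homotopy\<close>

text \<open>The operator \<open>delta_inv\<close> is factored into this normalization and the Koszul
  operator \<open>kap\<close>, so that the anticommutator of \<open>dl\<close> and
  \<open>kap\<close> follows from the relations among generators alone.\<close>

definition nrm :: "'b weyl \<Rightarrow> 'b weyl" where
  "nrm a = (\<lambda>m M S. if size M + card S = 0 then 0 else sc (q (1 / of_nat (size M + card S))) (a m M S))"

definition kap :: "'b weyl \<Rightarrow> 'b weyl" where
  "kap a = (\<Sum>i<n. ymul i (ins_asym i a))"

definition dinv :: "'b weyl \<Rightarrow> 'b weyl" where
  "dinv a = kap (nrm a)"

definition low :: "'b weyl \<Rightarrow> 'b weyl" where
  "low a = (\<lambda>m M S. if M = {#} \<and> S = {} then a m M S else 0)"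

lemma additive_kap: "additive kap"
  by (simp add: additive_def kap_def gen_simps sum.distrib)

lemma additive_nrm: "additive nrm"
  by (auto simp: additive_def nrm_def fun_eq_iff B.scale_right_distrib)

lemma additive_dinv: "additive dinv"
  using additive_kap additive_nrm by (simp add: additive_def dinv_def)

lemma additive_low: "additive low"
  by (auto simp: additive_def low_def fun_eq_iff)

lemma WF_nrm: "a \<in> WF k l \<Longrightarrow> nrm a \<in> WF k l"
proof (rule WFI)
  fix m M S assume a: "a \<in> WF k l" "nrm a m M S \<noteq> 0"
  then have "a m M S \<noteq> 0" by (auto simp: nrm_def split: if_splits)
  then show "set_mset M \<subseteq> {..<n} \<and> S \<subseteq> {..<n} \<and> card S = l \<and> k \<le> size M + 2 * m"
    by (rule WFD[OF a(1)])
qed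

lemma supported_nrm: "supported a \<Longrightarrow> supported (nrm a)"
  unfolding supported_def nrm_def by (metis B.scale_zero_right)

lemma WF_dinv: "a \<in> WF k (Suc l) \<Longrightarrow> dinv a \<in> WF (Suc k) l"
  unfolding dinv_def kap_def by (intro WF_sum WF_ymul WF_ins_asym WF_nrm) auto

lemma dinv_WF_0: "a \<in> WF k 0 \<Longrightarrow> dinv a = 0"
  unfolding dinv_def kap_def using ins_asym_WF_0[OF WF_nrm] by (simp add: operator_zero)

text \<open>The mixed terms of the two compositions cancel; the exterior and the symmetric number
  operator remain.\<close>

lemma dl_kap: "dl (kap a) + kap (dl a) = (\<Sum>i<n. theta i (ins_asym i a)) + (\<Sum>i<n. ymul i (ins_sym i a))"
proof -
  have 1: "dl (kap a) = (\<Sum>i<n. theta i (ins_asym i a)) + (\<Sum>i<n. \<Sum>j<n. ymul j (theta i (ins_sym i (ins_asym j a))))"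
  proof -
    have "dl (kap a) = (\<Sum>i<n. \<Sum>j<n. theta i (if i = j then ins_asym j a else 0) + ymul j (theta i (ins_sym i (ins_asym j a))))"
      by (simp only: dl_def kap_def gen_simps ins_sym_ymul theta_ymul)
    also have "\<dots> = (\<Sum>i<n. \<Sum>j<n. theta i (if i = j then ins_asym j a else 0)) + (\<Sum>i<n. \<Sum>j<n. ymul j (theta i (ins_sym i (ins_asym j a))))"
      by (simp only: sum.distrib)
    moreover have "(\<Sum>i<n. \<Sum>j<n. theta i (if i = j then ins_asym j a else 0)) = (\<Sum>i<n. theta i (ins_asym i a))"
      by (intro sum.cong refl) (simp add: if_distrib[of "theta _"] gen_simps sum.delta cong: if_cong)
    ultimately show ?thesis by (simp only:)
  qed
  have 2: "kap (dl a) = (\<Sum>i<n. ymul i (ins_sym i a)) - (\<Sum>i<n. \<Sum>j<n. ymul j (theta i (ins_sym i (ins_asym j a))))"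
  proof -
    have "kap (dl a) = (\<Sum>j<n. \<Sum>i<n. ymul j (if j = i then ins_sym i a else 0) - ymul j (theta i (ins_sym i (ins_asym j a))))"
      by (simp only: dl_def kap_def gen_simps ins_asym_theta ins_asym_ins_sym)
    also have "\<dots> = (\<Sum>j<n. \<Sum>i<n. ymul j (if j = i then ins_sym i a else 0)) - (\<Sum>j<n. \<Sum>i<n. ymul j (theta i (ins_sym i (ins_asym j a))))"
      by (simp only: sum_subtractf)
    moreover have "(\<Sum>j<n. \<Sum>i<n. ymul j (if j = i then ins_sym i a else 0)) = (\<Sum>i<n. ymul i (ins_sym i a))"
      by (intro sum.cong refl) (simp add: if_distrib[of "ymul _"] gen_simps sum.delta cong: if_cong)
    moreover have "(\<Sum>j<n. \<Sum>i<n. ymul j (theta i (ins_sym i (ins_asym j a)))) = (\<Sum>i<n. \<Sum>j<n. ymul j (theta i (ins_sym i (ins_asym j a))))"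
      by (rule sum.swap)
    ultimately show ?thesis by (simp only:)
  qed
  show ?thesis unfolding 1 2 by simp
qed

text \<open>The sums count only generators with index below \<open>n\<close>, hence the condition on
  the support.\<close>

lemma number_operators:
  assumes "supported a"
  shows "((\<Sum>i<n. theta i (ins_asym i a)) + (\<Sum>i<n. ymul i (ins_sym i a))) m M S = sc (of_nat (size M + card S)) (a m M S)"
proof -
  have t: "theta i (ins_asym i a) m M S = (if i \<in> S then a m M S else 0)" for i
    using below_remove[of i S i] by (simp add: theta_def ins_asym_def wedge_gen_def ext_insert_below insert_absorb)
      (simp add: alt_def)
  have y: "ymul i (ins_sym i a) m M S = sc (of_nat (count M i)) (a m M S)" for i
  proof (cases "i \<in># M")
    case True
    then obtain M' where M: "M = add_mset i M'" by (meson multi_member_split)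
    show ?thesis
      by (simp add: ymul_def ins_sym_def M B.sum_constant_scale)
  next
    case False
    then have "count M i = 0" by (simp add: not_in_iff)
    then show ?thesis using False by (simp add: ymul_def)
  qed
  show ?thesis
  proof (cases "a m M S = 0")
    case True
    then show ?thesis by (simp add: sum_fun_apply t y cong: if_cong)
  next
    case False
    then have MS: "set_mset M \<subseteq> {..<n}" "S \<subseteq> {..<n}" using supportedD[OF assms] by auto
    have "(\<Sum>i<n. if i \<in> S then a m M S else 0) = (\<Sum>i\<in>S. a m M S)"
      using MS(2) by (simp add: sum.inter_restrict[symmetric] Int_absorb1)
    also have "\<dots> = sc (of_nat (card S)) (a m M S)" by (simp add: B.sum_constant_scale)
    moreover have "(\<Sum>i<n. sc (of_nat (count M i)) (a m M S)) = sc (of_nat (size M)) (a m M S)"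
    proof -
      have "size M = (\<Sum>i<n. count M i)"
        unfolding size_multiset_overloaded_eq
        by (rule sum.mono_neutral_left) (use MS(1) in \<open>auto simp: not_in_iff\<close>)
      then show ?thesis by (simp add: B.scale_sum_left)
    qed
    ultimately show ?thesis by (simp add: sum_fun_apply t y B.scale_left_distrib add.commute)
  qed
qed

text \<open>Exchanging a symmetric for an exterior generator keeps the sum of both degrees, on which
  the normalization depends.\<close>

lemma nrm_theta_ins_sym:
  assumes "supported a" shows "theta i (ins_sym i (nrm a)) = nrm (theta i (ins_sym i a))"
proof (intro ext)
  fix m M S
  show "theta i (ins_sym i (nrm a)) m M S = nrm (theta i (ins_sym i a)) m M S"
  proof (cases "i \<in> S \<and> a m (add_mset i M) (S - {i}) \<noteq> 0")
    case True
    then have "S - {i} \<subseteq> {..<n}" using supportedD[OF assms] by blast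
    then have "finite (S - {i})" by (rule finite_subset) simp
    then have "finite S" by simp
    then have c: "card S = Suc (card (S - {i}))" using True by (intro card.remove) auto
    have d: "size (add_mset i M) + card (S - {i}) = size M + card S" using c by simp
    show ?thesis using True
      unfolding theta_def wedge_gen_def ins_sym_def nrm_def d
      by (simp add: c B.scale_sum_right alt_def del: card_Diff_insert of_nat_Suc) 
  next
    case False
    then show ?thesis by (auto simp: theta_def wedge_gen_def ins_sym_def nrm_def)
  qed
qed

lemma nrm_ymul_ins_asym:
  assumes "supported a" shows "ymul i (ins_asym i (nrm a)) = nrm (ymul i (ins_asym i a))"
proof (intro ext)
  fix m M S
  show "ymul i (ins_asym i (nrm a)) m M S = nrm (ymul i (ins_asym i a)) m M S"
  proof (cases "i \<in># M \<and> i \<notin> S \<and> a m (M - {#i#}) (insert i S) \<noteq> 0")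
    case True
    then have "insert i S \<subseteq> {..<n}" using supportedD[OF assms] by blast
    then have "finite (insert i S)" by (rule finite_subset) simp
    then have c: "card (insert i S) = Suc (card S)" using True by simp
    have "size M = Suc (size (M - {#i#}))" using True by (simp add: size_Suc_Diff1)
    then have d: "size (M - {#i#}) + card (insert i S) = size M + card S" using c by linarith
    have z: "size M + card S \<noteq> 0" using True by auto
    show ?thesis using True z
      unfolding ymul_def ins_asym_def ext_insert_below nrm_def d
      by (simp add: alt_def)
  next
    case False
    then show ?thesis by (auto simp: ymul_def ins_asym_def ext_insert_below nrm_def)
  qed
qed

lemma supported_kap: "supported a \<Longrightarrow> supported (kap a)"
  unfolding kap_def by (intro supported_sum supported_ymul supported_ins_asym) auto

lemma nrm_dl: "supported a \<Longrightarrow> dl (nrm a) = nrm (dl a)"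
  unfolding dl_def by (simp add: nrm_theta_ins_sym additive.sum[OF additive_nrm])

lemma nrm_kap: "supported a \<Longrightarrow> kap (nrm a) = nrm (kap a)"
  unfolding kap_def by (simp add: nrm_ymul_ins_asym additive.sum[OF additive_nrm])

lemma homotopy:
  assumes "supported a" shows "dl (dinv a) + dinv (dl a) = a - low a"
proof (intro ext)
  fix m M S
  have sd: "supported (dl a)" unfolding dl_def using assms by (intro supported_sum supported_theta supported_ins_sym) auto
  have "(dl (dinv a) + dinv (dl a)) m M S = sc (of_nat (size M + card S)) (nrm a m M S)"
    unfolding dinv_def nrm_dl[OF assms, symmetric] dl_kap by (rule number_operators[OF supported_nrm[OF assms]])
  also have "\<dots> = (a - low a) m M S"
  \<comment> \<open>An infinite \<open>S\<close> also has \<open>card S = 0\<close>; such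
    coefficients vanish by the support condition.\<close>
  proof (cases "size M + card S = 0")
    case True
    then have M: "M = {#}" "card S = 0" by auto
    show ?thesis
    proof (cases "finite S")
      case True
      then show ?thesis using M by (simp add: nrm_def low_def)
    next
      case False
      then have "S \<noteq> {}" by auto
      then show ?thesis using supported_infinite[OF assms False] M by (simp add: nrm_def low_def)
    qed
  next
    case False
    then have "of_nat (size M + card S) * q (1 / of_nat (size M + card S)) = 1"
      unfolding q_of_nat[symmetric] q_mult[symmetric] by (simp add: q_one del: of_nat_add)
    moreover have "\<not> (M = {#} \<and> S = {})" using False by auto
    ultimately show ?thesis using False by (auto simp: nrm_def low_def simp del: of_nat_add)
  qed
  finally show "(dl (dinv a) + dinv (dl a)) m M S = (a - low a) m M S" .
qed

lemma kap_kap: "kap (kap a) = 0"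
proof -
  define Z where "Z = kap (kap a)"
  have Z: "Z = (\<Sum>i<n. \<Sum>j<n. ymul i (ymul j (ins_asym i (ins_asym j a))))"
    by (simp add: Z_def kap_def gen_simps ins_asym_ymul)
  also have "\<dots> = (\<Sum>j<n. \<Sum>i<n. ymul i (ymul j (ins_asym i (ins_asym j a))))"
    by (rule sum.swap)
  also have "\<dots> = - (\<Sum>i<n. \<Sum>j<n. ymul i (ymul j (ins_asym i (ins_asym j a))))"
    unfolding sum_negf[symmetric]
    by (intro sum.cong refl, subst ymul_commute, subst ins_asym_anticommute) (simp add: gen_simps)
  finally have "Z = - Z" unfolding Z[symmetric] .
  then have "Z + Z = 0" by (simp only: eq_neg_iff_add_eq_0)
  then show ?thesis unfolding Z_def by (rule double_zero)
qed

lemma dinv_dinv: "supported a \<Longrightarrow> dinv (dinv a) = 0"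
  by (simp add: dinv_def nrm_kap supported_nrm supported_kap) (simp add: nrm_kap[symmetric] supported_nrm supported_kap kap_kap additive.zero[OF additive_nrm])

lemma low_WF: "a \<in> WF k l \<Longrightarrow> 0 < l \<Longrightarrow> low a = 0"
proof (intro ext)
  fix m M S assume a: "a \<in> WF k l" "0 < l"
  have "a m {#} {} = 0" using WFD[OF a(1), of m "{#}" "{}"] a(2) by auto
  then show "low a m M S = 0 m M S" by (auto simp: low_def)
qed

lemma WF_all_zero:
  assumes "\<And>k. a \<in> WF k l" shows "a = 0"
proof (intro ext)
  fix m M S
  show "a m M S = 0 m M S"
    using WFD[OF assms[of "Suc (size M + 2 * m)"], of m M S] by fastforce
qed

text \<open>Each round through \<open>P\<close> and \<open>dinv\<close> gains one degree, so
  \<open>a\<close> lies in every step of the filtration.\<close>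

lemma contraction_zero:
  assumes a: "a \<in> WF 0 l" "a = dinv (P a)" and P: "\<And>k a. a \<in> WF k l \<Longrightarrow> P a \<in> WF k (Suc l)"
  shows "a = 0"
proof (rule WF_all_zero)
  fix k show "a \<in> WF k l"
  proof (induction k)
    case (Suc k)
    have "dinv (P a) \<in> WF (Suc k) l" by (rule WF_dinv[OF P[OF Suc]])
    then show ?case using a(2) by simp
  qed (rule a)
qed

end

section \<open>The Fedosov derivation and its total curvature\<close>

section \<open>Flat connections\<close>

text \<open>\<open>rh\<close> and \<open>Om\<close> stand for the images of \<open>\<varrho>\<close> and \<open>\<Omega>\<close> under \<open>c \<mapsto> c \<cdot> 1\<close>.\<close>

locale fedosov_connection = fedosov_setup q scG br n e r s nabla Omega sc f u act
  for q :: "rat \<Rightarrow> 'r::comm_ring_1"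
    and scG :: "'r \<Rightarrow> 'g::ab_group_add \<Rightarrow> 'g" and br n e r s nabla Omega
    and sc :: "'r \<Rightarrow> 'b::ab_group_add \<Rightarrow> 'b" and f u act +
  fixes rh :: "'b weyl" and Om :: "'b weyl"
  assumes WF_rh: "rh \<in> WF 2 1"
    and rh_central: "weyl_mult f rh b = weyl_mult f (eps b) rh"
    and WF_Om: "Om \<in> WF 2 2"
    and Om_central: "Om \<odot> b = b \<odot> Om"
    and E_Om: "E Om = 0"
begin

lemma supported_rh: "supported rh"
  by (rule WF_supported[OF WF_rh])

lemma eps_rh: "eps rh = - rh"
  using eps_WF[OF WF_rh] by simp

definition Br :: "'b weyl \<Rightarrow> 'b weyl" where
  "Br b = rh \<odot> b - eps b \<odot> rh"

definition adt :: "'b weyl \<Rightarrow> 'b weyl" where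
  "adt b = div_t (Br b)"

definition rr :: "'b weyl" where
  "rr = div_t (rh \<odot> rh)"

definition Dp :: "'b weyl \<Rightarrow> 'b weyl" where
  "Dp b = DL b + adt b"

definition DD :: "'b weyl \<Rightarrow> 'b weyl" where
  "DD b = Dp b - dl b"

text \<open>The element C of the overview: as \<open>E\<close> is \<open>DL - dl\<close>, its
  vanishing is the Fedosov equation.\<close>

definition Acurv :: "'b weyl" where
  "Acurv = curv_w + E rh + rr + Om"

lemma circ_at_0: "(a \<odot> b) 0 = weyl_mult f a b 0"
  by (simp add: circ_mu_c mu_c_def q_one)

text \<open>By \<open>rh_central\<close> the graded commutator has no part of order t^0, so
  \<open>div_t\<close> loses nothing.\<close>

lemma tshift_adt: "tshift (adt b) = Br b"
  unfolding adt_def by (rule tshift_div_t) (simp add: Br_def circ_at_0 rh_central)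

text \<open>An odd element with central coefficients equals minus itself squared away in the
  undeformed product: its square is its own negative, and 2 is invertible.\<close>

lemma tshift_rr: "tshift rr = rh \<odot> rh"
proof -
  have "weyl_mult f rh rh = - weyl_mult f rh rh"
    using rh_central[of rh] by (simp add: eps_rh biadditive_simps[OF biadditive_weyl_mult[OF f_biadditive]])
  then have "weyl_mult f rh rh + weyl_mult f rh rh = 0" by (simp only: eq_neg_iff_add_eq_0)
  then have "weyl_mult f rh rh = 0" by (rule double_zero)
  then show ?thesis unfolding rr_def by (intro tshift_div_t) (simp add: circ_at_0)
qed

lemma DD_E: "DD b = E b + adt b"
  by (simp add: DD_def Dp_def E_DL)

lemma E_tshift: "E (tshift a) = tshift (E a)"
  by (rule slicewise_tshift[OF slicewise_E])

lemma Br_tshift: "Br (tshift b) = tshift (Br b)"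
  by (simp add: Br_def tshift_circ tshift_commute gen_simps)

lemma additive_Br: "additive Br"
  by (simp add: additive_def Br_def circ_simps gen_simps)

lemma additive_adt: "additive adt"
proof -
  have "tshift (adt (a + b)) = tshift (adt a + adt b)" for a b
    by (simp only: tshift_adt operator_add additive.add[OF additive_Br])
  then show ?thesis by (simp add: additive_def)
qed

lemma additive_Dp: "additive Dp"
  using additive_adt additive_DL by (simp add: additive_def Dp_def)

lemma additive_DD: "additive DD"
  using additive_Dp additive_dl by (simp add: additive_def DD_def)

text \<open>Since \<open>tshift\<close> is injective, identities involving \<open>1 / t\<close> are proved after multiplication by \<open>t\<close>.\<close>

lemma tshift_DD: "tshift (DD b) = tshift (E b) + Br b"
  by (simp add: DD_E gen_simps tshift_adt)

lemma WF_Br: "b \<in> WF k l \<Longrightarrow> Br b \<in> WF (k + 2) (Suc l)"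
  unfolding Br_def using WF_circ[OF WF_rh, of b k l] WF_circ[OF WF_eps WF_rh, of b k l]
  by (intro WF_diff) (simp_all add: add.commute)

lemma WF_adt: "b \<in> WF k l \<Longrightarrow> adt b \<in> WF k (Suc l)"
  unfolding adt_def by (rule WF_div_t[OF WF_Br])

lemma WF_Dp: "b \<in> WF k l \<Longrightarrow> Dp b \<in> WF k (Suc l)"
  unfolding Dp_def by (intro WF_add WF_DL WF_adt)

lemma WF_DD: "b \<in> WF k l \<Longrightarrow> DD b \<in> WF (k - 1) (Suc l)"
  unfolding DD_def using WF_mono[OF WF_Dp] by (intro WF_diff WF_dl) auto

lemma WF_rr: "rr \<in> WF 2 2"
  unfolding rr_def using WF_circ[OF WF_rh WF_rh] by (intro WF_div_t) (simp only: one_add_one)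

lemma WF_Acurv: "Acurv \<in> WF 1 2"
proof -
  have "E rh \<in> WF 1 2" using WF_E[OF WF_rh] by (simp add: numeral_2_eq_2)
  then show ?thesis unfolding Acurv_def
    using WF_mono[OF WF_curv] WF_mono[OF WF_rr] WF_mono[OF WF_Om] by (intro WF_add) auto
qed

lemma DD_circ: "DD (a \<odot> b) = DD a \<odot> b + eps a \<odot> DD b"
proof -
  have "tshift (DD a \<odot> b + eps a \<odot> DD b) = tshift (DD a) \<odot> b + eps a \<odot> tshift (DD b)"
    by (simp only: operator_add tshift_circ)
  also have "\<dots> = tshift (DD (a \<odot> b))"
    unfolding tshift_DD by (simp add: circ_simps tshift_circ E_circ gen_simps Br_def eps_circ circ_assoc)
  finally show ?thesis by simp
qed

text \<open>The square of \<open>E\<close>, its anticommutator with \<open>Br\<close> and the square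
  of \<open>Br\<close> are the commutators with \<open>curv_w\<close>, \<open>E rh\<close> and
  \<open>rr\<close>, up to powers of t; \<open>Om\<close> may be added because it is
  central.\<close>

lemma DD_DD:
  assumes b: "supported b" shows "tshift (DD (DD b)) = Acurv \<odot> b - b \<odot> Acurv"
proof -
  have EBr: "E (Br b) + Br (E b) = E rh \<odot> b - b \<odot> E rh"
    by (simp add: Br_def E_simps E_circ eps_rh eps_E[OF b] eps_eps circ_simps)
  have BrBr: "Br (Br b) = (rh \<odot> rh) \<odot> b - b \<odot> (rh \<odot> rh)"
    by (simp add: Br_def eps_circ gen_simps eps_rh eps_eps circ_simps circ_assoc)
  have EE: "tshift (tshift (E (E b))) = tshift (curv_w \<odot> b - b \<odot> curv_w)"
    by (simp add: curv_w_commutator[OF b])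
  have "tshift (tshift (DD (DD b))) = tshift (tshift (E (DD b)) + Br (DD b))"
    by (simp only: tshift_DD)
  also have "\<dots> = tshift (E (tshift (DD b))) + Br (tshift (DD b))"
    by (simp only: operator_add E_tshift Br_tshift)
  also have "\<dots> = tshift (tshift (E (E b))) + tshift (E (Br b) + Br (E b)) + Br (Br b)"
    by (simp only: tshift_DD E_simps E_tshift Br_tshift additive.add[OF additive_Br] operator_add add_ac)
  also have "\<dots> = tshift (curv_w \<odot> b - b \<odot> curv_w) + tshift (E rh \<odot> b - b \<odot> E rh) + tshift (rr \<odot> b - b \<odot> rr)"
    unfolding EE EBr BrBr tshift_rr[symmetric] by (simp only: tshift_circ operator_diff)
  also have "\<dots> = tshift (Acurv \<odot> b - b \<odot> Acurv)"
    unfolding operator_add(6)[symmetric] Acurv_def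
    by (simp add: circ_simps Om_central)
  finally show ?thesis by simp
qed

text \<open>The Bianchi identity of the total curvature. Applying \<open>E\<close> yields
  commutators of \<open>rh\<close> with \<open>curv_w\<close> and \<open>E rh\<close>, which
  \<open>Br Acurv\<close> cancels; \<open>rr\<close> commutes with \<open>rh\<close> by
  associativity.\<close>

lemma DD_Acurv: "DD Acurv = 0"
proof -
  have "tshift (tshift (DD Acurv)) = tshift 0"
  proof -
    have ev: "eps Acurv = Acurv" using eps_WF[OF WF_Acurv] by simp
    have e: "tshift (E Acurv) = (curv_w \<odot> rh - rh \<odot> curv_w) + (E rh \<odot> rh - rh \<odot> E rh)"
    proof -
      have "tshift (E rr) = E rh \<odot> rh - rh \<odot> E rh"
        unfolding E_tshift[symmetric] tshift_rr by (simp add: E_circ eps_rh circ_simps)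
      then show ?thesis
        by (simp add: Acurv_def E_simps Bianchi E_Om gen_simps curv_w_commutator[OF supported_rh])
    qed
    have "tshift (rh \<odot> rr - rr \<odot> rh) = rh \<odot> tshift rr - tshift rr \<odot> rh"
      by (simp only: operator_diff tshift_circ)
    then have "tshift (rh \<odot> rr - rr \<odot> rh) = 0"
      by (simp add: tshift_rr circ_assoc)
    then have r: "rh \<odot> rr = rr \<odot> rh" by (simp add: tshift_zero_iff)
    have "Br Acurv = rh \<odot> Acurv - Acurv \<odot> rh" by (simp add: Br_def ev)
    then have "tshift (DD Acurv) = 0"
      unfolding tshift_DD e by (simp add: Acurv_def circ_simps r Om_central)
    then show ?thesis by simp
  qed
  then show ?thesis by (simp add: tshift_zero_iff)
qed

text \<open>The fixed point equation and the homotopy give \<open>dinv Acurv = 0\<close>. The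
  Bianchi identity then becomes \<open>Acurv = dinv (Dp Acurv)\<close>, which has only the zero
  solution.\<close>

lemma Acurv_zero:
  assumes "dinv rh = 0" "rh = dinv (curv_w + DL rh + rr + Om)" shows "Acurv = 0"
proof -
  have A: "Acurv = (curv_w + DL rh + rr + Om) - dl rh"
    by (simp add: Acurv_def E_DL)
  have "dinv Acurv = rh - dinv (dl rh)"
    unfolding A additive.diff[OF additive_dinv] using assms(2) by simp
  moreover have "dinv (dl rh) = rh"
    using homotopy[OF supported_rh] assms(1) low_WF[OF WF_rh] by (simp add: additive.zero[OF additive_dl])
  ultimately have dA: "dinv Acurv = 0" by simp
  have "dl Acurv = Dp Acurv" using DD_Acurv by (simp add: DD_def)
  moreover have "dinv (dl Acurv) = Acurv"
    using homotopy[OF WF_supported[OF WF_Acurv]] dA low_WF[OF WF_Acurv] by (simp add: additive.zero[OF additive_dl])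
  ultimately have "Acurv = dinv (Dp Acurv)" by simp
  have "Acurv \<in> WF 0 2" by (rule WF_mono[OF WF_Acurv]) simp
  from this \<open>Acurv = dinv (Dp Acurv)\<close> show ?thesis
    by (rule contraction_zero) (rule WF_Dp)
qed

text \<open>The fixed point condition on \<open>a\<close> amounts to \<open>dinv (DD a) = 0\<close>.
  As \<open>DD\<close> squares to zero, the homotopy makes \<open>DD a\<close> a fixed point of a
  linear contraction.\<close>

lemma flat_section:
  assumes flat: "Acurv = 0" and a: "a \<in> WF 0 0" "a - dinv (Dp a) = low a" shows "DD a = 0"
proof -
  have b: "DD a \<in> WF 0 1" using WF_DD[OF a(1)] by simp
  have "dinv (DD a) = dinv (Dp a) - dinv (dl a)"
    unfolding DD_def by (rule additive.diff[OF additive_dinv])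
  moreover have "dinv (dl a) = a - low a"
    using homotopy[OF WF_supported[OF a(1)]] dinv_WF_0[OF a(1)] by (simp add: additive.zero[OF additive_dl])
  ultimately have db: "dinv (DD a) = 0" using a(2) by (simp add: algebra_simps)
  have "tshift (DD (DD a)) = 0" unfolding DD_DD[OF WF_supported[OF a(1)]] flat by (simp add: circ_simps)
  then have "DD (DD a) = 0" by (simp add: tshift_zero_iff)
  then have "dl (DD a) = Dp (DD a)" by (simp add: DD_def[of "DD a"])
  moreover have "dinv (dl (DD a)) = DD a"
    using homotopy[OF WF_supported[OF b]] db low_WF[OF b] by (simp add: additive.zero[OF additive_dl])
  ultimately have "DD a = dinv (Dp (DD a))" by simp
  then show ?thesis by (rule contraction_zero[OF b]) (rule WF_Dp)
qed

text \<open>A flat difference without constant part is a fixed point of the contraction given by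
  \<open>Dp\<close> and \<open>dinv\<close>.\<close>

lemma flat_unique:
  assumes "a \<in> WF 0 0" "a' \<in> WF 0 0" "DD a = 0" "DD a' = 0" "low a = low a'" shows "a = a'"
proof -
  define c where "c = a - a'"
  have c: "c \<in> WF 0 0" unfolding c_def using assms by (intro WF_diff)
  have "DD c = 0" "low c = 0" unfolding c_def using assms
    by (simp_all add: additive.diff[OF additive_DD] additive.diff[OF additive_low])
  then have "dl c = Dp c" by (simp add: DD_def)
  moreover have "dinv (dl c) = c"
    using homotopy[OF WF_supported[OF c]] dinv_WF_0[OF c] \<open>low c = 0\<close> by (simp add: additive.zero[OF additive_dl])
  ultimately have "c = dinv (Dp c)" by simp
  then have "c = 0" by (rule contraction_zero[OF c]) (rule WF_Dp)
  then show ?thesis by (simp add: c_def)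
qed

end

section \<open>Change of coefficients\<close>

section \<open>Naturality in the coefficients\<close>

lemma ext_mult_map:
  assumes "additive h" "\<And>x y. h (g x y) = g' x (h y)"
  shows "(\<lambda>S. h (ext_mult g P Q S)) = ext_mult g' P (\<lambda>S. h (Q S))"
proof -
  interpret additive h by fact
  have h: "h (alt k x) = alt k (h x)" for k x by (simp add: alt_def minus)
  show ?thesis by (simp add: ext_mult_def ext_sign_alt sum h assms(2))
qed

lemma weyl_map_apply: "weyl_map h a m M S = h (a m M S)"
  by (simp add: weyl_map_def)

lemma weyl_map_sum: "additive h \<Longrightarrow> weyl_map h (\<Sum>i\<in>I. g i) = (\<Sum>i\<in>I. weyl_map h (g i))"
  by (rule additive.sum[OF additive_weyl_map])

lemma weyl_map_div_t: "weyl_map h (div_t a) = div_t (weyl_map h a)"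
  by (simp add: weyl_map_def div_t_def)

text \<open>Used for the map from scalars to multiples of the unit and for the embedding of the
  algebra into its unitization. Compatibility with products is left to the individual lemmas because
  the factors may carry different coefficient maps.\<close>

locale coefficient_map = fedosov q scG br n e r s nabla Omega + C: module sc + C': module sc'
  for q :: "rat \<Rightarrow> 'r::comm_ring_1"
    and scG :: "'r \<Rightarrow> 'g::ab_group_add \<Rightarrow> 'g" and br n e r s nabla Omega
    and sc :: "'r \<Rightarrow> 'b::ab_group_add \<Rightarrow> 'b" and sc' :: "'r \<Rightarrow> 'c::ab_group_add \<Rightarrow> 'c" +
  fixes h :: "'b \<Rightarrow> 'c"
  assumes h_add: "additive h" and h_sc: "h (sc c x) = sc' c (h x)"
begin

lemma map_weyl_mult: "weyl_map h (weyl_mult sc g a) = weyl_mult sc' g (weyl_map h a)"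
  using weyl_map_weyl_mult[of h sc sc' id h g a] by (simp add: h_add h_sc) (simp add: weyl_map_def)

lemmas map_gen = weyl_map_commute[OF h_add, symmetric] weyl_map_sum[OF h_add] additive.add[OF additive_weyl_map[OF h_add]]
  additive.diff[OF additive_weyl_map[OF h_add]] map_weyl_mult

lemma map_smul: "weyl_map h (weyl_map (sc c) a) = weyl_map (sc' c) (weyl_map h a)"
  by (simp add: weyl_map_def h_sc)

lemma map_delta: "weyl_map h (delta sc a) = delta sc' (weyl_map h a)"
  by (simp add: delta_def map_gen)

lemma map_delta_inv: "weyl_map h (delta_inv sc a) = delta_inv sc' (weyl_map h a)"
proof -
  have "weyl_map h (\<lambda>m M S. if size M + card S = 0 then 0 else sc (q (1 / of_nat (size M + card S))) (a m M S))
    = (\<lambda>m M S. if size M + card S = 0 then 0 else sc' (q (1 / of_nat (size M + card S))) (weyl_map h a m M S))"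
    by (auto simp: weyl_map_def fun_eq_iff h_sc additive.zero[OF h_add])
  then show ?thesis by (simp add: delta_inv_def map_gen)
qed

lemma map_nabla_sym: "weyl_map h (nabla_sym sc X a) = nabla_sym sc' X (weyl_map h a)"
  by (simp add: nabla_sym_def map_gen)

lemma map_delta_CE: "weyl_map h (\<lambda>m M. delta_CE sc (a m M)) = (\<lambda>m M. delta_CE sc' (weyl_map h a m M))"
proof (intro ext)
  fix m M S
  have "h (ext_mult sc (ce_gen k) (ext_insert k (a m M)) S) = ext_mult sc' (ce_gen k) (ext_insert k (weyl_map h a m M)) S" for k
  proof -
    have "(\<lambda>S. h (ext_insert k (a m M) S)) = ext_insert k (weyl_map h a m M)"
      using weyl_map_commute(2)[OF h_add, of k a] by (simp add: ins_asym_def weyl_map_def fun_eq_iff)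
    then show ?thesis using fun_cong[OF ext_mult_map[OF h_add, where g = sc and g' = sc', OF h_sc, of "ce_gen k" "ext_insert k (a m M)"], of S]
      by simp
  qed
  then show "weyl_map h (\<lambda>m M. delta_CE sc (a m M)) m M S = delta_CE sc' (weyl_map h a m M) S"
    unfolding weyl_map_apply[of h "\<lambda>m M. delta_CE sc (a m M)"]
    unfolding delta_CE_def sum_fun_apply additive.sum[OF h_add]
    by (intro sum.cong refl)
qed

lemma map_D_op: "weyl_map h (D_op sc a) = D_op sc' (weyl_map h a)"
  by (simp add: D_op_def map_gen map_nabla_sym map_delta_CE)

lemma map_mu_P:
  assumes "additive h1" "additive h2" "\<And>x y. h (g x y) = g' (h1 x) (h2 y)"
  shows "weyl_map h (mu_P g sc k a b) = mu_P g' sc' k (weyl_map h1 a) (weyl_map h2 b)"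
proof -
  have "weyl_map h (weyl_mult g a b) = weyl_mult g' (weyl_map h1 a) (weyl_map h2 b)" for a b
    by (rule weyl_map_weyl_mult) (rule h_add assms)+
  then show ?thesis
    by (induction k arbitrary: a b)
      (simp_all add: weyl_map_sum[OF h_add] map_smul weyl_map_commute[OF assms(1)] weyl_map_commute[OF assms(2)])
qed

lemma map_circ:
  assumes "additive h1" "additive h2" "\<And>x y. h (g x y) = g' (h1 x) (h2 y)"
  shows "weyl_map h (circ g sc a b) = circ g' sc' (weyl_map h1 a) (weyl_map h2 b)"
proof (intro ext)
  fix m M S
  have "h (mu_P g sc k a b p M S) = mu_P g' sc' k (weyl_map h1 a) (weyl_map h2 b) p M S" for k p
  proof -
    have "weyl_map h (mu_P g sc k a b) = mu_P g' sc' k (weyl_map h1 a) (weyl_map h2 b)"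
      by (rule map_mu_P) (rule assms)+
    then show ?thesis by (metis weyl_map_def)
  qed
  then show "weyl_map h (circ g sc a b) m M S = circ g' sc' (weyl_map h1 a) (weyl_map h2 b) m M S"
    unfolding weyl_map_apply[of h "circ g sc a b"] unfolding circ_def
    by (simp add: additive.sum[OF h_add] h_sc)
qed

end

section \<open>The defined operators in terms of generators, central elements, and fixed
  points\<close>

section \<open>The operators of the construction\<close>

context fedosov_setup begin

lemma biadditive_sc: "biadditive sc"
  by (rule biadditiveI) (simp_all add: B.scale_left_distrib B.scale_right_distrib)

lemma biadditive_times: "biadditive ((*) :: 'r \<Rightarrow> 'r \<Rightarrow> 'r)"
  by (rule biadditiveI) (simp_all add: distrib_left distrib_right)

lemma asym_gen_theta: "asym_gen i = theta i (weyl_const (1 :: 'r fps))"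
proof (intro ext)
  fix m M and S :: "nat set"
  show "asym_gen i m M S = theta i (weyl_const (1 :: 'r fps)) m M S"
  proof (cases "S = {i}")
    case True
    have "below i {i} = 0" by (simp add: below_def)
    then show ?thesis by (simp add: True asym_gen_def theta_def wedge_gen_def weyl_const_def)
  next
    case False
    then have "i \<in> S \<Longrightarrow> S - {i} \<noteq> {}" by auto
    then show ?thesis using False by (simp add: asym_gen_def theta_def wedge_gen_def weyl_const_def)
  qed
qed

lemma sym_gen_ymul: "sym_gen i = ymul i (weyl_const (1 :: 'r fps))"
proof (intro ext)
  fix m M and S :: "nat set"
  show "sym_gen i m M S = ymul i (weyl_const (1 :: 'r fps)) m M S"
  proof (cases "i \<in># M")
    case True
    then obtain M' where "M = add_mset i M'" by (meson multi_member_split)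
    then show ?thesis by (simp add: sym_gen_def ymul_def weyl_const_def)
  next
    case False
    then have "M \<noteq> {#i#}" by auto
    then show ?thesis using False by (simp add: sym_gen_def ymul_def)
  qed
qed

lemma one_weyl_mult: "supported a \<Longrightarrow> weyl_mult sc (weyl_const 1) a = a"
proof (intro ext)
  fix m M S assume a: "supported a"
  show "weyl_mult sc (weyl_const 1) a m M S = a m M S"
  proof (cases "finite S")
    case True
    have "sc (fps_nth 1 p) x = (if p = 0 then x else 0)" for p x by simp
    then show ?thesis unfolding weyl_mult_const_left[OF biadditive_sc True] by (simp only: sum_atMost_0 diff_zero)
  qed (simp add: supported_infinite[OF a])
qed

lemma asym_gen_mult: "supported a \<Longrightarrow> weyl_mult sc (asym_gen i) a = theta i a"
  by (simp add: asym_gen_theta theta_weyl_mult_left[OF biadditive_sc] one_weyl_mult)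

lemma sym_gen_mult: "supported a \<Longrightarrow> weyl_mult sc (sym_gen i) a = ymul i a"
  by (simp add: sym_gen_ymul ymul_weyl_mult_left[OF biadditive_sc] one_weyl_mult)

lemma delta_dl: "supported a \<Longrightarrow> delta sc a = dl a"
  by (simp add: delta_def dl_def asym_gen_mult supported_ins_sym)

lemma delta_inv_dinv: "supported a \<Longrightarrow> delta_inv sc a = dinv a"
  by (simp only: delta_inv_def dinv_def kap_def nrm_def[symmetric] sym_gen_mult supported_ins_asym supported_nrm)

lemma scaled_weyl_mult: "weyl_mult sc (weyl_map ((*) c) g) a = smul c (weyl_mult sc g a)"
  using weyl_map_weyl_mult[of "sc c" sc sc "(*) c" id g a] by (simp add: additive_sc) (simp add: weyl_map_def)

lemma nabla_sym_rho: "supported a \<Longrightarrow> nabla_sym sc X a = rho (conn X) a"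
  by (simp add: nabla_sym_def nabla_gen_def rho_def biadditive_simps[OF biadditive_weyl_mult[OF biadditive_sc]]
      scaled_weyl_mult sym_gen_mult supported_ins_sym conn_def)

definition ext_one :: "'r ext" where
  "ext_one = (\<lambda>S. if S = {} then 1 else 0)"

lemma ext_one_mult:
  assumes "biadditive g" "finite S" shows "ext_mult g ext_one P S = g 1 (P S)"
proof -
  have "ext_mult g ext_one P S = (\<Sum>T\<in>Pow S. if T = {} then g 1 (P S) else 0)"
    unfolding ext_mult_def
    by (rule sum.cong) (auto simp: ext_one_def biadditive_simps[OF assms(1)] ext_sign_alt ninv_def)
  then show ?thesis using assms(2) by (simp add: sum.delta)
qed

lemma ext_gen_wedge: "ext_gen i = wedge_gen i ext_one"
proof (rule ext)
  fix S :: "nat set"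
  show "ext_gen i S = wedge_gen i ext_one S"
  proof (cases "S = {i}")
    case True
    have "below i {i} = 0" by (simp add: below_def)
    then show ?thesis by (simp add: True ext_gen_def wedge_gen_def ext_one_def)
  next
    case False
    then have "i \<in> S \<Longrightarrow> S - {i} \<noteq> {}" by auto
    then show ?thesis using False by (simp add: ext_gen_def wedge_gen_def ext_one_def)
  qed
qed

lemma ext_gen_mult:
  fixes g :: "'r \<Rightarrow> 'x::ab_group_add \<Rightarrow> 'y::ab_group_add"
  assumes "finite S" "biadditive g" shows "ext_mult g (ext_gen i) P S = wedge_gen i (\<lambda>S. g 1 (P S)) S"
  unfolding ext_gen_wedge ext_mult_wedge_left[OF assms(2)]
  by (simp add: wedge_gen_def ext_one_mult assms)

lemma ext_mult_assoc_finite: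
  assumes "finite S"
  shows "ext_mult sc (ext_mult (*) (ext_gen i) (ext_gen j)) P S = wedge_gen i (wedge_gen j P) S"
proof -
  have g: "ext_mult (*) (ext_gen i) (ext_gen j) = wedge_gen i (wedge_gen j ext_one)"
  proof (rule ext)
    fix S
    show "ext_mult (*) (ext_gen i) (ext_gen j) S = wedge_gen i (wedge_gen j ext_one) S"
    proof (cases "finite S")
      case True
      then show ?thesis by (simp add: ext_gen_mult biadditive_times) (simp add: ext_gen_wedge)
    next
      case False
      have "finite S" if "S - {i} - {j} = {}"
        by (rule finite_subset[of S "{i, j}"]) (use that in auto)
      then have "S - {i} - {j} \<noteq> {}" using False by blast
      then show ?thesis using False by (auto simp: ext_mult_infinite wedge_gen_def ext_one_def)
    qed
  qed
  show ?thesis unfolding g ext_mult_wedge_left[OF biadditive_sc]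
    using assms by (simp add: wedge_gen_def ext_one_mult[OF biadditive_sc])
qed

lemma ext_mult_linear:
  "ext_mult sc (\<lambda>S. \<Sum>i\<in>I. \<Sum>j\<in>J. c i j * Q i j S) P S = (\<Sum>i\<in>I. \<Sum>j\<in>J. sc (c i j) (ext_mult sc (Q i j) P S))"
proof -
  have alt: "alt k (sc c x) = sc c (alt k x)" for k c x by (simp add: alt_def)
  have "ext_mult sc (\<lambda>S. \<Sum>i\<in>I. \<Sum>j\<in>J. c i j * Q i j S) P S
    = (\<Sum>T\<in>Pow S. \<Sum>i\<in>I. \<Sum>j\<in>J. sc (c i j) (alt (ninv T (S - T)) (sc (Q i j T) (P (S - T)))))"
    unfolding ext_mult_def ext_sign_alt
    by (rule sum.cong[OF refl]) (simp add: B.scale_sum_left alt_sum B.scale_scale[symmetric] alt del: B.scale_scale)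
  also have "\<dots> = (\<Sum>i\<in>I. \<Sum>j\<in>J. \<Sum>T\<in>Pow S. sc (c i j) (alt (ninv T (S - T)) (sc (Q i j T) (P (S - T)))))"
    by (subst sum.swap, rule sum.cong[OF refl], rule sum.swap)
  finally show ?thesis by (simp add: ext_mult_def ext_sign_alt B.scale_sum_right)
qed

lemma delta_CE_dCE:
  assumes "supported a" shows "(\<lambda>m M. delta_CE sc (a m M)) = dCE a"
proof (intro ext)
  fix m M S
  have "ext_mult sc (ce_gen k) (ext_insert k (a m M)) S = dtheta k (ins_asym k a) m M S" for k
  proof (cases "finite S")
    case True
    show ?thesis
      unfolding ce_gen_def ext_two_def ext_mult_linear
      by (simp add: ext_mult_assoc_finite[OF True] dtheta_def sum_fun_apply smul_apply struct_def theta_def ins_asym_def)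
  next
    case False
    then show ?thesis
      by (simp add: ext_mult_infinite supported_infinite[OF supported_dtheta[OF supported_ins_asym[OF assms]]])
  qed
  then show "delta_CE sc (a m M) S = dCE a m M S"
    by (simp add: delta_CE_def dCE_def sum_fun_apply)
qed

lemma D_op_rho:
  assumes "supported a" shows "D_op sc a = (\<Sum>i<n. theta i (rho (conn (e i)) a)) + dCE a"
  by (simp add: D_op_def delta_CE_dCE assms nabla_sym_rho asym_gen_mult supported_rho)

lemma D_op_DL:
  assumes "supported a"
  shows "D_op sc a + (\<Sum>i<n. weyl_mult sc (asym_gen i) (weyl_map (act (e i)) a)) = DL a"
  by (simp add: D_op_rho DL_def assms asym_gen_mult supported_act gen_simps sum.distrib)

subsection \<open>Central coefficients\<close>

definition jw :: "'r weyl \<Rightarrow> 'b weyl" where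
  "jw z = weyl_map (\<lambda>c. sc c u) z"

lemma j_map: "coefficient_map q scG br n e ((*) :: 'r \<Rightarrow> 'r \<Rightarrow> 'r) sc (\<lambda>c. sc c u)"
proof -
  interpret R: module "(*) :: 'r \<Rightarrow> 'r \<Rightarrow> 'r"
    by unfold_locales (auto simp: algebra_simps)
  show ?thesis
    by (unfold_locales) (simp_all add: additive_def B.scale_left_distrib)
qed

lemma additive_j: "additive (\<lambda>c. sc c u)"
  by (simp add: additive_def B.scale_left_distrib)

lemma act_unit: "act X u = 0"
  using act_derivation[of X u u] by (simp add: f_unit)

lemma act_jw: "weyl_map (act X) (jw z) = 0"
  by (simp add: jw_def weyl_map_def act_sc act_unit fun_eq_iff)

lemma WF_jw: "z \<in> WF k l \<Longrightarrow> jw z \<in> WF k l"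
  unfolding jw_def by (rule WF_map) simp_all

lemma supported_jw: "supported z \<Longrightarrow> supported (jw z)"
  unfolding jw_def by (rule supported_map) simp_all

text \<open>Multiples of the unit commute with all coefficients, so only the Koszul sign is
  left.\<close>

lemma jw_central:
  assumes "\<And>m M S. z m M S \<noteq> 0 \<Longrightarrow> card S = k"
  shows "weyl_mult f (jw z) b = weyl_mult f (\<lambda>m M S. alt (k * card S) (b m M S)) (jw z)"
proof -
  have "weyl_mult f (jw z) b = weyl_mult (\<lambda>x y. f y x) (\<lambda>m M S. alt (k * card S) (b m M S)) (jw z)"
    by (rule weyl_mult_swap[OF f_biadditive]) (simp add: jw_def weyl_map_def, metis B.scale_zero_left assms)
  also have "\<dots> = weyl_mult f (\<lambda>m M S. alt (k * card S) (b m M S)) (jw z)"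
  proof -
    have "f (sc c u) x = f x (sc c u)" for c x by (simp add: f_sc_left f_sc_right f_unit)
    then show ?thesis by (simp add: weyl_mult_def ext_mult_def jw_def weyl_map_def)
  qed
  finally show ?thesis .
qed

lemma jw_one_form:
  assumes "z \<in> WF k 1" shows "weyl_mult f (jw z) b = weyl_mult f (eps b) (jw z)"
proof -
  have "weyl_mult f (jw z) b = weyl_mult f (\<lambda>m M S. alt (1 * card S) (b m M S)) (jw z)"
    by (rule jw_central) (use WFD[OF assms] in blast)
  then show ?thesis by (simp add: eps_def parity_def)
qed

lemma jw_even_form:
  assumes "z \<in> WF k l" "even l" shows "weyl_mult f (jw z) b = weyl_mult f b (jw z)"
proof -
  have "weyl_mult f (jw z) b = weyl_mult f (\<lambda>m M S. alt (l * card S) (b m M S)) (jw z)"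
    by (rule jw_central) (use WFD[OF assms(1)] in blast)
  then show ?thesis using assms(2) by (simp add: alt_def)
qed

definition Om_R :: "'r weyl" where
  "Om_R = (\<lambda>m M. if M = {#} then Omega m else 0)"

lemma WF_Om_R: "Om_R \<in> WF 2 2"
proof (rule WFI)
  fix m M S assume "Om_R m M S \<noteq> 0"
  then have "M = {#}" "Omega m S \<noteq> 0" by (auto simp: Om_R_def split: if_splits)
  \<comment> \<open>\<open>Omega\<close> starts in order t, which alone contributes total degree
    2.\<close>
  moreover have "m \<noteq> 0"
  proof
    assume "m = 0"
    then show False using closed \<open>Omega m S \<noteq> 0\<close> by (simp add: closed_two_forms_def)
  qed
  ultimately show "set_mset M \<subseteq> {..<n} \<and> S \<subseteq> {..<n} \<and> card S = 2 \<and> 2 \<le> size M + 2 * m"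
    using closed by (auto simp: closed_two_forms_def)
qed

lemma ins_sym_Om: "ins_sym i (jw Om_R) = 0"
  by (simp add: jw_def ins_sym_def weyl_map_def Om_R_def fun_eq_iff)

lemma Om_central: "jw Om_R \<odot> b = b \<odot> jw Om_R"
  by (simp only: circ_flat[OF ins_sym_Om] jw_even_form[OF WF_Om_R even_numeral])

text \<open>The action kills the unit and there is no symmetric part, so only \<open>dCE\<close>
  could contribute, and \<open>Omega\<close> is closed.\<close>

lemma E_Om: "E (jw Om_R) = 0"
proof -
  interpret j: coefficient_map q scG br n e r s nabla Omega "(*) :: 'r \<Rightarrow> 'r \<Rightarrow> 'r" sc "\<lambda>c. sc c u"
    by (rule j_map)
  have "(\<lambda>m M. delta_CE (*) (Om_R m M)) = 0"
  proof (intro ext)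
    fix m M S
    have "delta_CE (*) (0 :: 'r ext) S = 0"
      by (simp add: delta_CE_def ext_mult_def sum_fun_apply ext_insert_below ext_sign_alt cong: if_cong)
    then show "delta_CE (*) (Om_R m M) S = 0 m M S"
      using closed by (simp add: closed_two_forms_def Om_R_def)
  qed
  then have "(\<lambda>m M. delta_CE sc (jw Om_R m M)) = 0"
    unfolding jw_def j.map_delta_CE[symmetric] by (simp add: weyl_map_def fun_eq_iff)
  then have "dCE (jw Om_R) = 0"
    using delta_CE_dCE[OF supported_jw[OF WF_supported[OF WF_Om_R]]] by simp
  then show ?thesis by (simp add: E_def nab_def rho_def ins_sym_Om act_jw gen_simps)
qed

lemma connection_jw: 
  assumes "z \<in> WF 2 1"
  shows "fedosov_connection q scG br n e r s nabla Omega sc f u act (jw z) (jw Om_R)"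
  by unfold_locales (use assms in \<open>simp_all add: WF_jw jw_one_form[OF assms] WF_Om_R Om_central E_Om\<close>)

lemma jw_curv_R: "jw curv_R = curv_w"
proof -
  interpret j: coefficient_map q scG br n e r s nabla Omega "(*) :: 'r \<Rightarrow> 'r \<Rightarrow> 'r" sc "\<lambda>c. sc c u"
    by (rule j_map)
  have tr: "weyl_map (\<lambda>c. sc c u) (weyl_mult (*) a b) = weyl_mult sc a (jw b)" for a b
    unfolding jw_def by (rule j.map_weyl_mult)
  have u: "weyl_map (\<lambda>c. sc c u) (weyl_const 1) = unit_w"
    by (auto simp: unit_w_def weyl_const_def weyl_map_def fun_eq_iff)
  have a: "jw (asym_gen j) = theta j unit_w" for j
    unfolding jw_def asym_gen_theta weyl_map_commute(1)[OF additive_j, symmetric] u by (rule refl)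
  have assoc: "weyl_mult sc (weyl_mult (*) a b) c = weyl_mult sc a (weyl_mult sc b c)" for a b c
    by (rule weyl_mult_assoc[OF biadditive_sc biadditive_sc]) simp
  have "jw (weyl_map ((*) c) (weyl_mult (*) (weyl_mult (*) (sym_gen k) (sym_gen l)) (weyl_mult (*) (asym_gen i) (asym_gen j))))
    = smul c (ymul k (ymul l (theta i (theta j unit_w))))" if "i < n" "j < n" "k < n" "l < n" for c i j k l
  proof -
    have "jw (weyl_map ((*) c) (weyl_mult (*) (weyl_mult (*) (sym_gen k) (sym_gen l)) (weyl_mult (*) (asym_gen i) (asym_gen j))))
      = smul c (weyl_mult sc (sym_gen k) (weyl_mult sc (sym_gen l) (weyl_mult sc (asym_gen i) (theta j unit_w))))"
      unfolding jw_def j.map_smul tr assoc unfolding jw_def[symmetric] tr[folded jw_def] a by (rule refl)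
    then show ?thesis using that
      by (simp add: asym_gen_mult sym_gen_mult supported_theta supported_ymul supported_unit)
  qed
  note * = this
  have "jw curv_R = (\<Sum>k<n. \<Sum>l<n. \<Sum>i<n. \<Sum>j<n. smul (q (1/4) * beta i j k l) (ymul k (ymul l (theta i (theta j unit_w)))))"
    unfolding curv_R_def jw_def weyl_map_sum[OF additive_j] beta_def
    unfolding jw_def[symmetric] by (intro sum.cong refl) (simp add: *)
  also have "\<dots> = (\<Sum>i<n. \<Sum>j<n. \<Sum>k<n. \<Sum>l<n. smul (q (1/4) * beta i j k l) (ymul k (ymul l (theta i (theta j unit_w)))))"
    by (rule sum4_swap)
  also have "\<dots> = curv_w"
    unfolding curv_w_def gen_simps W.scale_sum_right W.scale_scale theta_ymul by (rule refl)
  finally show ?thesis .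
qed

lemma jw_fedosov_equation:
  assumes "is_varrho z"
  shows "dl (jw z) = curv_w + DL (jw z) + div_t (jw z \<odot> jw z) + jw Om_R"
proof -
  interpret j: coefficient_map q scG br n e r s nabla Omega "(*) :: 'r \<Rightarrow> 'r \<Rightarrow> 'r" sc "\<lambda>c. sc c u"
    by (rule j_map)
  have z: "z \<in> WF 2 1" "delta (*) z = curv_R + D_op (*) z + div_t (circ (*) (*) z z) + Om_R"
    using assms by (simp_all add: is_varrho_def Om_R_def)
  have sup: "supported (jw z)" by (rule supported_jw[OF WF_supported[OF z(1)]])
  have "dl (jw z) = jw (delta (*) z)"
    using delta_dl[OF sup] by (simp add: jw_def j.map_delta)
  also have "\<dots> = jw curv_R + jw (D_op (*) z) + jw (div_t (circ (*) (*) z z)) + jw Om_R"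
    unfolding z(2) jw_def by (simp only: additive.add[OF additive_weyl_map[OF additive_j]])
  also have "jw (D_op (*) z) = DL (jw z)"
    using D_op_rho[OF sup] by (simp add: jw_def j.map_D_op) (simp add: DL_def jw_def[symmetric] act_jw)
  also have "jw (div_t (circ (*) (*) z z)) = div_t (jw z \<odot> jw z)"
  proof -
    have "weyl_map (\<lambda>c. sc c u) (circ (*) (*) z z) = jw z \<odot> jw z"
      unfolding jw_def by (rule j.map_circ[OF additive_j additive_j]) (simp add: f_sc_left f_sc_right f_unit mult.commute)
    then show ?thesis by (simp add: jw_def weyl_map_div_t)
  qed
  finally show ?thesis unfolding jw_curv_R .
qed

subsection \<open>Fixed points of contractions\<close>

text \<open>Completeness for the filtration by total degree.\<close>

lemma WF_limit:
  assumes x: "\<And>k. x k \<in> WF d l" and step: "\<And>k. x (Suc k) - x k \<in> WF k l"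
  shows "\<exists>y\<in>WF d l. \<forall>k. y - x k \<in> WF k l"
proof -
  have le: "x (k + j) - x k \<in> WF k l" for k j
  proof (induction j)
    case (Suc j)
    have "x (k + Suc j) - x k = (x (Suc (k + j)) - x (k + j)) + (x (k + j) - x k)" by simp
    then show ?case using WF_mono[OF step[of "k + j"], of k] Suc by (simp only: WF_add le_add1)
  qed (simp add: zero_fun_def[symmetric] WF_zero)
  \<comment> \<open>A coefficient of total degree d is stationary from \<open>x (Suc d)\<close>
    on.\<close>
  define y where "y = (\<lambda>m M S. x (Suc (size M + 2 * m)) m M S)"
  show ?thesis
  proof (intro bexI allI)
    show "y \<in> WF d l" by (rule WFI) (use WFD[OF x] in \<open>auto simp: y_def\<close>)
    fix k
    show "y - x k \<in> WF k l"
    proof (rule WFI)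
      fix m M S assume nz: "(y - x k) m M S \<noteq> 0"
      then have "x (Suc (size M + 2 * m)) m M S \<noteq> 0 \<or> x k m M S \<noteq> 0" by (auto simp: y_def)
      then have 1: "set_mset M \<subseteq> {..<n} \<and> S \<subseteq> {..<n} \<and> card S = l" using WFD[OF x] by blast
      have "\<not> Suc (size M + 2 * m) \<le> k"
      proof
        assume "Suc (size M + 2 * m) \<le> k"
        then obtain j where "k = Suc (size M + 2 * m) + j" using le_Suc_ex by blast
        then have "(x k - x (Suc (size M + 2 * m))) m M S = 0"
          using WFD[OF le[of "Suc (size M + 2 * m)" j], of m M S] by fastforce
        then show False using nz by (simp add: y_def)
      qed
      then show "set_mset M \<subseteq> {..<n} \<and> S \<subseteq> {..<n} \<and> card S = l \<and> k \<le> size M + 2 * m" using 1 by simp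
    qed
  qed
qed

text \<open>The Banach fixed point theorem for the ultrametric of the filtration.\<close>

lemma contraction_fixpoint:
  assumes P: "\<And>a. a \<in> WF d l \<Longrightarrow> P a \<in> WF d l"
    and c: "\<And>k a b. a \<in> WF d l \<Longrightarrow> b \<in> WF d l \<Longrightarrow> a - b \<in> WF k l \<Longrightarrow> P a - P b \<in> WF (Suc k) l"
  obtains y where "y \<in> WF d l" "P y = y"
proof -
  define x where "x k = (P ^^ k) 0" for k
  have x: "x k \<in> WF d l" for k
    by (induction k) (simp_all add: x_def zero_fun_def[symmetric] WF_zero P)
  have xS: "x (Suc k) = P (x k)" for k by (simp add: x_def)
  have step: "x (Suc k) - x k \<in> WF k l" for k
  proof (induction k)
    case 0
    show ?case by (intro WF_diff WF_mono[OF x]) simp_all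
  next
    case (Suc k)
    show ?case using c[OF x x Suc] unfolding xS .
  qed
  obtain y where y: "y \<in> WF d l" "\<And>k. y - x k \<in> WF k l" using WF_limit[of x d l, OF x step] by blast
  have "P y - y \<in> WF k l" for k
  proof -
    have "P y - x (Suc k) \<in> WF (Suc k) l" using c[OF y(1) x y(2)] by (simp add: x_def)
    then have "(P y - x (Suc k)) - (y - x (Suc k)) \<in> WF (Suc k) l" by (rule WF_diff[OF _ y(2)])
    then show ?thesis using WF_mono[of _ "Suc k" l k] by simp
  qed
  then have "P y - y = 0" by (rule WF_all_zero)
  then show thesis using that y(1) by simp
qed

lemma contraction_unique:
  assumes c: "\<And>k a b. a \<in> WF d l \<Longrightarrow> b \<in> WF d l \<Longrightarrow> a - b \<in> WF k l \<Longrightarrow> P a - P b \<in> WF (Suc k) l"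
    and x: "x \<in> WF d l" "P x = x" and y: "y \<in> WF d l" "P y = y"
  shows "x = y"
proof -
  have "x - y \<in> WF k l" for k
  proof (induction k)
    case 0
    show ?case by (intro WF_diff WF_mono[OF x(1)] WF_mono[OF y(1)]) simp_all
  next
    case (Suc k)
    have "P x - P y \<in> WF (Suc k) l" by (rule c[OF x(1) y(1) Suc])
    then show ?case unfolding x(2) y(2) .
  qed
  then have "x - y = 0" by (rule WF_all_zero)
  then show ?thesis by simp
qed

definition fedosov_map :: "'b weyl \<Rightarrow> 'b weyl" where
  "fedosov_map a = dinv (curv_w + DL a + div_t (a \<odot> a) + jw Om_R)"

text \<open>The factor of total degree at least 2 makes up for the 2 lost by dividing by t.\<close>

lemma WF_square: "a \<in> WF 2 1 \<Longrightarrow> b \<in> WF k 1 \<Longrightarrow> div_t (a \<odot> b) \<in> WF k 2 \<and> div_t (b \<odot> a) \<in> WF k 2"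
  using WF_circ[of a 2 1 b k 1] WF_circ[of b k 1 a 2 1]
  by (intro conjI WF_div_t) (simp_all only: one_add_one add.commute)

lemma WF_fedosov_map: "a \<in> WF 2 1 \<Longrightarrow> fedosov_map a \<in> WF 2 1"
proof -
  assume a: "a \<in> WF 2 1"
  have "DL a \<in> WF 2 2" using WF_DL[OF a] by (simp only: Suc_1)
  then have "curv_w + DL a + div_t (a \<odot> a) + jw Om_R \<in> WF 2 (Suc 1)"
    unfolding Suc_1 using WF_square[OF a a] by (intro WF_add WF_curv WF_jw WF_Om_R) auto
  from WF_dinv[OF this] show ?thesis unfolding fedosov_map_def by (rule WF_mono) simp
qed

lemma div_t_diff: "div_t (a - b) = div_t a - div_t b" "div_t (a + b) = div_t a + div_t b" for a b :: "'c::ab_group_add weyl"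
  by (simp_all add: div_t_def fun_eq_iff)

text \<open>The difference of the squares is written as
  \<open>(a - b) \<odot> a + b \<odot> (a - b)\<close>, which keeps the filtration of
  \<open>a - b\<close>; the gain of one comes from \<open>dinv\<close>.\<close>

lemma fedosov_map_contraction:
  assumes a: "a \<in> WF 2 1" and b: "b \<in> WF 2 1" and ab: "a - b \<in> WF k 1"
  shows "fedosov_map a - fedosov_map b \<in> WF (Suc k) 1"
proof -
  have sq: "div_t (a \<odot> a) - div_t (b \<odot> b) = div_t ((a - b) \<odot> a) + div_t (b \<odot> (a - b))"
    by (simp add: circ_simps div_t_diff)
  have "fedosov_map a - fedosov_map b = dinv (DL (a - b) + (div_t (a \<odot> a) - div_t (b \<odot> b)))"
    unfolding fedosov_map_def additive.diff[OF additive_dinv, symmetric] additive.diff[OF additive_DL]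
    by (rule arg_cong[of _ _ dinv]) (simp add: algebra_simps)
  moreover have "DL (a - b) + (div_t (a \<odot> a) - div_t (b \<odot> b)) \<in> WF k (Suc 1)"
    unfolding sq Suc_1 using WF_DL[OF ab] WF_square[OF a ab] WF_square[OF b ab]
    by (intro WF_add) (simp_all only: Suc_1)
  ultimately show ?thesis using WF_dinv by simp
qed

end

section \<open>Construction of the Fedosov element\<close>

section \<open>Existence and uniqueness of the Fedosov element\<close>

context fedosov_geometry begin

text \<open>The ground ring with zero action, the instance in which \<open>varrho\<close> is
  constructed; there \<open>jw\<close> is the identity.\<close>

lemma setup_R: "fedosov_setup q scG br n e r s nabla Omega ((*) :: 'r \<Rightarrow> 'r \<Rightarrow> 'r) (*) 1 (\<lambda>_ _. 0)"
proof -
  interpret R: module "(*) :: 'r \<Rightarrow> 'r \<Rightarrow> 'r"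
    by unfold_locales (auto simp: algebra_simps)
  show ?thesis
    apply unfold_locales
              apply (rule biadditiveI; simp only: distrib_left distrib_right)
             apply (rule mult.assoc)
            apply (rule mult.left_commute)
           apply simp_all
    done
qed

lemma is_varrho_varrho: "is_varrho varrho"
proof -
  interpret R: fedosov_setup q scG br n e r s nabla Omega "(*) :: 'r \<Rightarrow> 'r \<Rightarrow> 'r" "(*)" 1 "\<lambda>_ _. 0"
    by (rule setup_R)
  have jw: "R.jw z = z" for z by (simp add: R.jw_def weyl_map_def)
  \<comment> \<open>For uniqueness: the gauge condition and the homotopy turn every solution into a
    fixed point.\<close>
  have fix_eq: "R.fedosov_map z = z" if z: "is_varrho z" for z
  proof -
    have WF: "z \<in> weyl_filt n 2 1" and d: "delta_inv (*) z = 0" using z by (simp_all add: is_varrho_def)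
    have "R.dinv z = 0" using R.delta_inv_dinv[OF R.WF_supported[OF WF]] d by simp
    then have "R.dinv (R.dl z) = z"
      using R.homotopy[OF R.WF_supported[OF WF]] R.low_WF[OF WF] by (simp add: additive.zero[OF R.additive_dl])
    moreover have "R.dl z = R.curv_w + R.DL z + div_t (circ (*) (*) z z) + R.Om_R"
      using R.jw_fedosov_equation[OF z] unfolding jw .
    ultimately show ?thesis unfolding R.fedosov_map_def jw by simp
  qed
  obtain y where y: "y \<in> weyl_filt n 2 1" "R.fedosov_map y = y"
    by (rule R.contraction_fixpoint[of 2 1 R.fedosov_map, OF R.WF_fedosov_map R.fedosov_map_contraction])
  interpret Y: fedosov_connection q scG br n e r s nabla Omega "(*) :: 'r \<Rightarrow> 'r \<Rightarrow> 'r" "(*)" 1 "\<lambda>_ _. 0" "R.jw y" "R.jw R.Om_R"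
    by (rule R.connection_jw[OF y(1)])
  have sup: "R.supported y" by (rule R.WF_supported[OF y(1)])
  have eq: "y = R.dinv (R.curv_w + R.DL y + div_t (circ (*) (*) y y) + R.Om_R)"
    using y(2)[symmetric] unfolding R.fedosov_map_def jw .
  \<comment> \<open>The gauge condition is automatic for a fixed point, because \<open>dinv\<close>
    squares to zero.\<close>
  have d0: "R.dinv y = 0"
    by (subst eq, rule R.dinv_dinv) (intro R.supported_add R.WF_supported[OF R.WF_curv] R.WF_supported[OF R.WF_DL[OF y(1)]]
      R.supported_div_t R.supported_circ sup R.WF_supported[OF R.WF_Om_R])
  have rr: "Y.rr = div_t (circ (*) (*) y y)" unfolding Y.rr_def unfolding jw by (rule refl)
  have "Y.Acurv = 0"
  proof (rule Y.Acurv_zero)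
    show "R.dinv (R.jw y) = 0" unfolding jw by (rule d0)
    show "R.jw y = R.dinv (R.curv_w + R.DL (R.jw y) + Y.rr + R.jw R.Om_R)" unfolding rr unfolding jw by (rule eq)
  qed
  then have "R.curv_w + R.E y + div_t (circ (*) (*) y y) + R.Om_R = 0"
    unfolding Y.Acurv_def unfolding rr unfolding jw .
  then have "(R.curv_w + R.DL y + div_t (circ (*) (*) y y) + R.Om_R) - R.dl y = 0"
    by (simp only: R.E_DL add_diff_eq diff_add_eq)
  then have "R.dl y = R.curv_w + R.DL y + div_t (circ (*) (*) y y) + R.Om_R"
    by (simp only: right_minus_eq)
  moreover have "R.curv_w = curv_R" using R.jw_curv_R by (simp add: jw)
  moreover have "R.DL y = D_op (*) y"
  proof -
    have z: "weyl_map (\<lambda>_. 0 :: 'r) y = 0" by (simp add: weyl_map_def fun_eq_iff)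
    show ?thesis unfolding R.DL_def z add_0_right R.D_op_rho[OF sup] by (rule refl)
  qed
  ultimately have "is_varrho y"
    unfolding is_varrho_def using y(1) R.delta_dl[OF sup] R.delta_inv_dinv[OF sup] d0 by (simp add: R.Om_R_def)
  moreover have "z = y" if "is_varrho z" for z
    by (rule R.contraction_unique[of 2 1 R.fedosov_map, OF R.fedosov_map_contraction])
      (use that fix_eq y in \<open>auto simp: is_varrho_def\<close>)
  ultimately show ?thesis unfolding varrho_def by (rule theI)
qed

end

section \<open>Flat sections as sums of Neumann series\<close>

section \<open>Flat sections\<close>

lemma (in fedosov) circ_zero:
  assumes "module sc" "biadditive g" shows "circ g sc 0 b = 0" "circ g sc a 0 = 0"
proof -
  interpret M: module sc by fact
  have sz: "weyl_map (sc c) 0 = 0" for c by (simp add: weyl_map_def fun_eq_iff)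
  have "mu_P g sc k 0 b = 0" "mu_P g sc k a 0 = 0" for k a b
  proof -
    show "mu_P g sc k 0 b = 0" by (induction k arbitrary: b)
      (simp_all add: biadditive_simps[OF biadditive_weyl_mult[OF assms(2)]] operator_zero sz)
    show "mu_P g sc k a 0 = 0" by (induction k arbitrary: a)
      (simp_all add: biadditive_simps[OF biadditive_weyl_mult[OF assms(2)]] operator_zero sz)
  qed
  then show "circ g sc 0 b = 0" "circ g sc a 0 = 0" by (simp_all add: circ_def fun_eq_iff)
qed

lemma asym_part_homogeneous:
  assumes "a \<in> weyl_filt n d l" shows "asym_part k a = (if k = l then a else 0)"
  using assms by (auto simp: asym_part_def weyl_filt_def fun_eq_iff)

text \<open>Only the pair of degrees (1, 0) survives in the double sum, and its Koszul sign is
  trivial.\<close>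

lemma (in fedosov) ad_op_one_form:
  assumes M: "module sc" and z: "z \<in> weyl_filt n d 1" and b: "b \<in> weyl_filt n d' 0"
  shows "ad_op sc z b = circ sc sc z b - circ (\<lambda>x c. sc c x) sc b z"
proof -
  interpret M: module sc by fact
  have bi: "biadditive sc" by (rule biadditiveI) (simp_all add: M.scale_left_distrib M.scale_right_distrib)
  note 0 = circ_zero[OF M bi] circ_zero[OF M biadditive_flip[OF bi]]
  let ?X = "circ sc sc z b - circ (\<lambda>x c. sc c x) sc b z"
  have t: "circ sc sc (asym_part k z) (asym_part l b)
     - weyl_map (\<lambda>x. if even (k * l) then x else - x) (circ (\<lambda>x c. sc c x) sc (asym_part l b) (asym_part k z))
     = (if k = 1 then if l = 0 then ?X else 0 else 0)" for k l
    unfolding asym_part_homogeneous[OF z] asym_part_homogeneous[OF b]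
    by (auto simp: 0) (auto simp: weyl_map_def fun_eq_iff)
  have "ad_op sc z b = (\<Sum>k\<le>n. if k = 1 then ?X else 0)"
    unfolding ad_op_def t by (rule sum.cong[OF refl]) (simp add: sum.delta)
  also have "\<dots> = ?X"
  \<comment> \<open>For \<open>n = 0\<close> the degree 1 is outside the range of summation, but
    then there are no one-forms and \<open>z\<close> vanishes.\<close>
  proof (cases "n = 0")
    case True
    have "z = 0"
    proof (intro ext)
      fix m M S
      show "z m M S = 0 m M S"
      proof (rule ccontr)
        assume "z m M S \<noteq> 0 m M S"
        then have "S \<subseteq> {..<n}" "card S = 1" using z by (simp_all add: weyl_filt_def)
        then show False using True by simp
      qed
    qed
    then have "?X = 0" unfolding \<open>z = 0\<close> 0 by simp
    then show ?thesis by (simp only: if_cancel sum.neutral_const)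
  qed (simp add: sum.delta)
  finally show ?thesis .
qed

context fedosov_connection begin

lemma low_const: "low (weyl_const \<xi>) = weyl_const \<xi>"
  by (auto simp: low_def weyl_const_def fun_eq_iff)

lemma low_sigma: "low a = weyl_const (sigma a)"
  by (auto simp: low_def weyl_const_def sigma_def fun_eq_iff)

lemma low_dinv: "low (dinv a) = 0"
  by (simp add: low_def dinv_def kap_def sum_fun_apply ymul_def fun_eq_iff)

lemma WF_const: "weyl_const \<xi> \<in> WF 0 0"
  by (rule WFI) (auto simp: weyl_const_def split: if_splits)

lemma WF_dinv_Dp: "a \<in> WF k 0 \<Longrightarrow> dinv (Dp a) \<in> WF (Suc k) 0"
  by (intro WF_dinv WF_Dp)

lemma dinv_Dp_simps: "dinv (Dp (a + b)) = dinv (Dp a) + dinv (Dp b)" "dinv (Dp (a - b)) = dinv (Dp a) - dinv (Dp b)"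
  "dinv (Dp (\<Sum>k\<in>I. g k)) = (\<Sum>k\<in>I. dinv (Dp (g k)))"
  by (simp_all add: additive.add[OF additive_dinv] additive.add[OF additive_Dp] additive.diff[OF additive_dinv]
    additive.diff[OF additive_Dp] additive.sum[OF additive_dinv] additive.sum[OF additive_Dp])

text \<open>The term \<open>X k\<close> has total degree at least \<open>k\<close>, so cutting the
  sum off at the total degree of a coefficient is exact. The tails lie in ever higher filtration,
  and the equation holds modulo each of them.\<close>

lemma neumann_series:
  assumes X: "X 0 = weyl_const \<xi>" "\<And>k. X (Suc k) = dinv (Dp (X k))"
    and t: "\<And>m M S. t m M S = (\<Sum>k\<le>size M + 2 * m. X k m M S)"
  shows "t \<in> WF 0 0" "t = weyl_const \<xi> + dinv (Dp t)"
proof -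
  have WX: "X k \<in> WF k 0" for k
    by (induction k) (simp_all add: X WF_const WF_dinv_Dp)
  have rest: "t - (\<Sum>k\<le>N. X k) \<in> WF (Suc N) 0" for N
  proof (rule WFI)
    fix m M S assume nz: "(t - (\<Sum>k\<le>N. X k)) m M S \<noteq> 0"
    have "\<not> size M + 2 * m \<le> N"
    proof
      assume le: "size M + 2 * m \<le> N"
      have "(\<Sum>k\<le>N. X k m M S) = (\<Sum>k\<le>size M + 2 * m. X k m M S)"
      proof (rule sum.mono_neutral_right)
        show "\<forall>k\<in>{..N} - {..size M + 2 * m}. X k m M S = 0"
          using WFD[OF WX] by fastforce
      qed (use le in auto)
      then show False using nz t by (simp add: sum_fun_apply)
    qed
    moreover obtain k where "X k m M S \<noteq> 0"
    proof -
      have "(\<Sum>k\<le>size M + 2 * m. X k m M S) \<noteq> 0 \<or> (\<Sum>k\<le>N. X k m M S) \<noteq> 0"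
        using nz t by (auto simp: sum_fun_apply)
      then show thesis using that by (meson sum.not_neutral_contains_not_neutral)
    qed
    ultimately show "set_mset M \<subseteq> {..<n} \<and> S \<subseteq> {..<n} \<and> card S = 0 \<and> Suc N \<le> size M + 2 * m"
      using WFD[OF WX, of k m M S] by auto
  qed
  have "t = (t - (\<Sum>k\<le>0. X k)) + X 0" by simp
  then show tW: "t \<in> WF 0 0" using WF_add[OF WF_mono[OF rest[of 0]] WX[of 0]] by (metis le0)
  have "t - (weyl_const \<xi> + dinv (Dp t)) \<in> WF N 0" for N
  proof -
    have "(\<Sum>k\<le>N. X k) + X (Suc N) = weyl_const \<xi> + (\<Sum>k\<le>N. dinv (Dp (X k)))"
    proof -
      have "(\<Sum>k\<le>N. X k) + X (Suc N) = X 0 + (\<Sum>k\<le>N. X (Suc k))"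
        using sum.atMost_Suc_shift[of X N] by simp
      then show ?thesis by (simp only: X)
    qed
    then have "t - (weyl_const \<xi> + dinv (Dp t)) = (t - (\<Sum>k\<le>N. X k)) - X (Suc N) - dinv (Dp (t - (\<Sum>k\<le>N. X k)))"
      by (simp add: dinv_Dp_simps algebra_simps)
    moreover have "t - (\<Sum>k\<le>N. X k) \<in> WF N 0"
      by (rule WF_mono[OF rest[of N]]) simp
    moreover have "X (Suc N) \<in> WF N 0"
      by (rule WF_mono[OF WX[of "Suc N"]]) simp
    moreover have "dinv (Dp (t - (\<Sum>k\<le>N. X k))) \<in> WF N 0"
      by (rule WF_mono[OF WF_dinv_Dp[OF rest[of N]]]) simp
    ultimately show ?thesis by (simp only: WF_diff)
  qed
  then have "t - (weyl_const \<xi> + dinv (Dp t)) = 0" by (rule WF_all_zero)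
  then show "t = weyl_const \<xi> + dinv (Dp t)" by simp
qed

definition flat :: "'b weyl \<Rightarrow> bool" where
  "flat a \<longleftrightarrow> a \<in> WF 0 0 \<and> DD a = 0"

lemma flat_eqI: "flat a \<Longrightarrow> flat b \<Longrightarrow> sigma a = sigma b \<Longrightarrow> a = b"
  by (rule flat_unique) (simp_all add: flat_def low_sigma)

lemma flat_add: "flat a \<Longrightarrow> flat b \<Longrightarrow> flat (a + b)"
  by (simp add: flat_def WF_add additive.add[OF additive_DD])

lemma flat_circ: "flat a \<Longrightarrow> flat b \<Longrightarrow> flat (a \<odot> b)"
  using WF_circ[of a 0 0 b 0 0] by (simp add: flat_def DD_circ circ_simps)

lemma neumann_flat:
  assumes "Acurv = 0" and t: "t \<in> WF 0 0" "t = weyl_const \<xi> + dinv (Dp t)"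
  shows "flat t" "sigma t = \<xi>"
proof -
  have low: "low t = weyl_const \<xi>"
    using arg_cong[OF t(2), of low] by (simp add: additive.add[OF additive_low] low_const low_dinv)
  have "t m {#} {} = fps_nth \<xi> m" for m
    using fun_cong[OF fun_cong[OF fun_cong[OF low, of m], of "{#}"], of "{}"] by (simp add: low_def weyl_const_def)
  then show "sigma t = \<xi>" by (simp add: sigma_def fps_eq_iff)
  have "t - dinv (Dp t) = low t" unfolding low using t(2) by (simp add: eq_diff_eq diff_eq_eq)
  then show "flat t" using flat_section[OF assms(1) t(1)] t(1) by (simp add: flat_def)
qed

text \<open>Scalar power series are central and annihilated by the Fedosov derivation; fibrewise
  multiplication by them realizes the action of \<open>R[[t]]\<close>, which is how bilinearity is
  obtained.\<close>

lemma flat_central: "flat (jw (weyl_const c))" "jw (weyl_const c) \<odot> b = b \<odot> jw (weyl_const c)"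
proof -
  have W: "(weyl_const c :: 'r weyl) \<in> WF 0 0" by (rule WFI) (auto simp: weyl_const_def split: if_splits)
  have s: "ins_sym i (jw (weyl_const c)) = 0" for i
    by (simp add: jw_def ins_sym_def weyl_map_def weyl_const_def fun_eq_iff)
  show cen: "jw (weyl_const c) \<odot> b = b \<odot> jw (weyl_const c)" for b
    by (simp only: circ_flat[OF s] jw_even_form[OF W even_zero])
  have W': "jw (weyl_const c) \<in> WF 0 0" by (rule WF_jw[OF W])
  have "Br (jw (weyl_const c)) = 0"
    using eps_WF[OF W'] by (simp add: Br_def cen)
  then have "adt (jw (weyl_const c)) = 0" by (simp add: adt_def div_t_def fun_eq_iff)
  moreover have "E (jw (weyl_const c)) = 0"
    by (simp add: E_def nab_def rho_def dCE_def s act_jw gen_simps ins_asym_WF_0[OF W'] dtheta_simps)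
  ultimately show "flat (jw (weyl_const c))" using W' by (simp add: flat_def DD_E)
qed

lemma sigma_central: "fps_nth (sigma (jw (weyl_const c) \<odot> b)) m = (\<Sum>p\<le>m. sc (fps_nth c p) (fps_nth (sigma b) (m - p)))"
proof -
  have s: "ins_sym i (jw (weyl_const c)) = 0" for i
    by (simp add: jw_def ins_sym_def weyl_map_def weyl_const_def fun_eq_iff)
  have j: "jw (weyl_const c) = weyl_const (Abs_fps (\<lambda>p. sc (fps_nth c p) u))"
    by (auto simp: jw_def weyl_map_def weyl_const_def fun_eq_iff)
  have "f (sc x u) y = sc x y" for x y by (simp add: f_sc_left f_unit)
  then show ?thesis unfolding circ_flat(1)[OF s]
    by (simp add: j sigma_def weyl_mult_const_left[OF f_biadditive])
qed

lemma weyl_mult_low: "weyl_mult f a b m {#} {} = (\<Sum>p\<le>m. f (a p {#} {}) (b (m - p) {#} {}))"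
  by (simp add: weyl_mult_sum_ext sum_fun_apply ext_mult_def ext_sign_alt ninv_def)

lemma sigma_circ_0: "fps_nth (sigma (a \<odot> b)) 0 = f (fps_nth (sigma a) 0) (fps_nth (sigma b) 0)"
  by (simp add: sigma_def circ_mu_c mu_c_def q_one weyl_mult_low)

lemma sigma_circ_1: "fps_nth (sigma (a \<odot> b)) 1 =
    f (fps_nth (sigma a) 0) (fps_nth (sigma b) 1) + f (fps_nth (sigma a) 1) (fps_nth (sigma b) 0)
    + sc (q (1/2)) (\<Sum>i<n. \<Sum>j<n. sc (pi_mat i j) (f (a 0 {#i#} {}) (b 0 {#j#} {})))"
proof -
  have "(a \<odot> b) 1 {#} {} = mu_c 0 a b 1 {#} {} + mu_c 1 a b 0 {#} {}"
    by (simp add: circ_mu_c)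
  moreover have "mu_c 1 a b 0 {#} {} = sc (q (1/2)) (\<Sum>i<n. \<Sum>j<n. sc (pi_mat i j) (f (a 0 {#i#} {}) (b 0 {#j#} {})))"
    by (simp add: mu_c_def smul_apply sum_fun_apply weyl_mult_low ins_sym_def)
  moreover have "mu_c 0 a b 1 {#} {} = f (a 0 {#} {}) (b 1 {#} {}) + f (a 1 {#} {}) (b 0 {#} {})"
    by (simp add: mu_c_def q_one weyl_mult_low)
  ultimately show ?thesis by (simp add: sigma_def)
qed

text \<open>Compare, in \<open>DD t = 0\<close>, the coefficients of \<open>e^i\<close> with no
  symmetric part at order t^0: \<open>dl\<close> contributes the linear part and \<open>DL\<close>
  the action.\<close>

lemma flat_linear_part:
  assumes t: "t \<in> WF 0 0" "t = weyl_const \<xi> + dinv (Dp t)" "DD t = 0" and i: "i < n"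
  shows "t 0 {#i#} {} = act (e i) (t 0 {#} {})"
proof -
  have b0: "below j {j} = 0" for j by (simp add: below_def)
  have th: "theta j a 0 {#} {i} = (if j = i then a 0 {#} {} else 0)" for j and a :: "'b weyl"
    by (simp add: theta_def wedge_gen_def b0)
  have "dl t 0 {#} {i} = (\<Sum>j<n. if j = i then ins_sym j t 0 {#} {} else 0)"
    unfolding dl_def sum_fun_apply th ..
  also have "\<dots> = t 0 {#i#} {}" using i by (simp add: sum.delta ins_sym_def)
  finally have 1: "dl t 0 {#} {i} = t 0 {#i#} {}" .
  have "rho A t 0 {#} {} = 0" for A
    by (simp add: rho_def sum_fun_apply smul_apply ymul_def)
  moreover have "dCE t = 0" by (simp add: dCE_def ins_asym_WF_0[OF t(1)] dtheta_simps)
  ultimately have 2: "DL t 0 {#} {i} = act (e i) (t 0 {#} {})"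
    using i by (simp add: DL_def sum_fun_apply th sum.delta weyl_map_def)
  have c: "Br (weyl_const \<xi>) = 0"
  proof -
    have "eps (weyl_const \<xi> :: 'b weyl) = weyl_const \<xi>" using eps_WF[OF WF_const] by simp
    then show ?thesis
      by (simp add: Br_def circ_flat[OF ins_sym_const] rh_central)
  qed
  have "Br t = Br (dinv (Dp t))"
    using arg_cong[OF t(2), of Br] by (simp add: additive.add[OF additive_Br] c)
  \<comment> \<open>The constant part is central, so \<open>Br t\<close> has total degree at least
    3. The coefficient at t^1 and \<open>e^i\<close> has total degree 2, hence \<open>adt\<close>
    does not contribute.\<close>
  then have "Br t \<in> WF (Suc 0 + 2) (Suc 0)"
    using WF_Br[OF WF_dinv_Dp[OF t(1)]] by simp
  then have "Br t 1 {#} {i} = 0" using WFD[of "Br t" "Suc 0 + 2" "Suc 0" 1 "{#}" "{i}"] by fastforce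
  then have 3: "adt t 0 {#} {i} = 0" by (simp add: adt_def div_t_def)
  have "(Dp t - dl t) 0 {#} {i} = 0" using t(3) by (simp add: DD_def)
  then show ?thesis using 1 2 3 by (simp add: Dp_def)
qed

end

section \<open>The unitization and transfer back to the algebra\<close>

section \<open>Unitization and the deformed product\<close>

definition unit_scale :: "('r::comm_ring_1 \<Rightarrow> 'a \<Rightarrow> 'a) \<Rightarrow> 'r \<Rightarrow> 'r \<times> 'a \<Rightarrow> 'r \<times> 'a" where
  "unit_scale sc c x = (c * fst x, sc c (snd x))"

definition unit_mult :: "('r::comm_ring_1 \<Rightarrow> 'a \<Rightarrow> 'a) \<Rightarrow> 'r \<times> 'a \<Rightarrow> 'r \<times> 'a \<Rightarrow> 'r \<times> 'a::ring" where
  "unit_mult sc x y = (fst x * fst y, sc (fst x) (snd y) + sc (fst y) (snd x) + snd x * snd y)"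

definition unit_act :: "('g \<Rightarrow> 'a \<Rightarrow> 'a) \<Rightarrow> 'g \<Rightarrow> 'r::comm_ring_1 \<times> 'a \<Rightarrow> 'r \<times> 'a" where
  "unit_act act X x = (0, act X (snd x))"

locale fedosov_star = fedosov_geometry q scG br n e r s nabla Omega + lie_algebra_action scG br scA act
  for q :: "rat \<Rightarrow> 'r::comm_ring_1"
    and scG :: "'r \<Rightarrow> 'g::ab_group_add \<Rightarrow> 'g" and br n e r s nabla Omega
    and scA :: "'r \<Rightarrow> 'a::ring \<Rightarrow> 'a" and act
begin

lemma setup_unitization:
  "fedosov_setup q scG br n e r s nabla Omega (unit_scale scA) (unit_mult scA) (1, 0) (unit_act act)"
proof -
  interpret B: module "unit_scale scA"
    by unfold_locales (simp_all add: unit_scale_def prod_eq_iff A.scale_left_distrib A.scale_right_distrib distrib_left distrib_right mult.assoc)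
  have additive_act: "act X (a + b) = act X a + act X b" "act (X + Y) a = act X a + act Y a"
    "act X (scA c a) = scA c (act X a)" "act (scG c X) a = scA c (act X a)" "act X 0 = 0" for X Y a b c
    using module_hom.add[OF act_linear_right] module_hom.add[OF act_linear_left] module_hom.scale[OF act_linear_right]
      module_hom.scale[OF act_linear_left] module_hom.zero[OF act_linear_right] by auto
  show ?thesis
  proof unfold_locales
    show "biadditive (unit_mult scA)"
      by (rule biadditiveI) (simp_all add: unit_mult_def A.scale_left_distrib A.scale_right_distrib distrib_left distrib_right add_ac)
  qed (simp_all add: unit_scale_def unit_mult_def unit_act_def prod_eq_iff additive_act act_bracket act_derivation
      A.scale_left_distrib A.scale_right_distrib distrib_left distrib_right scA_mult_left[symmetric] scA_mult_right[symmetric] mult_ac add_ac)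
qed

sublocale U: fedosov_setup q scG br n e r s nabla Omega "unit_scale scA" "unit_mult scA" "(1, 0)" "unit_act act"
  by (rule setup_unitization)

lemma WF_varrho: "varrho \<in> weyl_filt n 2 1"
  using is_varrho_varrho by (simp add: is_varrho_def)

sublocale U: fedosov_connection q scG br n e r s nabla Omega "unit_scale scA" "unit_mult scA" "(1, 0)" "unit_act act"
  "U.jw varrho" "U.jw U.Om_R"
  by (rule U.connection_jw[OF WF_varrho])

lemma Acurv_eq_0: "U.Acurv = 0"
  unfolding U.Acurv_def U.rr_def U.E_DL U.jw_fedosov_equation[OF is_varrho_varrho] by simp

definition iota :: "'a \<Rightarrow> 'r \<times> 'a" where
  "iota a = (0, a)"

lemma iota_inject: "iota a = iota b \<longleftrightarrow> a = b"
  by (simp add: iota_def)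

lemma additive_iota: "additive iota"
  by (simp add: additive_def iota_def)

lemma iota_map: "coefficient_map q scG br n e scA (unit_scale scA) iota"
  by unfold_locales (simp_all add: iota_def unit_scale_def)

sublocale i: coefficient_map q scG br n e r s nabla Omega scA "unit_scale scA" iota
  by (rule iota_map)

lemma weyl_map_iota_inject: "weyl_map iota a = weyl_map iota b \<longleftrightarrow> a = b"
  by (auto simp: weyl_map_def fun_eq_iff iota_inject)

lemma WF_iota: "a \<in> weyl_filt n k l \<longleftrightarrow> weyl_map iota a \<in> weyl_filt n k l"
  by (simp add: weyl_filt_def weyl_map_def iota_def zero_prod_def)

text \<open>The two scalar actions that appear in \<open>ad_op\<close> both become the product of
  the unitization.\<close>

lemma iota_taylor_inner:
  assumes a: "a \<in> weyl_filt n k 0"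
  shows "weyl_map iota (taylor_inner scA act a) = U.Dp (weyl_map iota a)"
proof -
  have W: "weyl_map iota a \<in> weyl_filt n k 0" using a WF_iota by blast
  have act: "weyl_map iota (weyl_map (act X) a) = weyl_map (unit_act act X) (weyl_map iota a)" for X
    by (simp add: weyl_map_def iota_def unit_act_def)
  have "weyl_map iota (D_op scA a + L_op scA act a) = U.DL (weyl_map iota a)"
    using U.D_op_DL[OF U.WF_supported[OF W]] by (simp add: L_op_def i.map_gen i.map_D_op act)
  moreover have "weyl_map iota (div_t (ad_op scA varrho a)) = U.adt (weyl_map iota a)"
  proof -
    have 1: "weyl_map iota (circ scA scA varrho a) = circ (unit_mult scA) (unit_scale scA) (U.jw varrho) (weyl_map iota a)"
      unfolding U.jw_def by (rule i.map_circ[OF U.additive_j additive_iota]) (simp add: iota_def unit_mult_def unit_scale_def)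
    have 2: "weyl_map iota (circ (\<lambda>x c. scA c x) scA a varrho) = circ (unit_mult scA) (unit_scale scA) (weyl_map iota a) (U.jw varrho)"
      unfolding U.jw_def by (rule i.map_circ[OF additive_iota U.additive_j]) (simp add: iota_def unit_mult_def unit_scale_def)
    have "U.Br (weyl_map iota a) = weyl_map iota (ad_op scA varrho a)"
      unfolding ad_op_one_form[OF A.module_axioms WF_varrho a] additive.diff[OF additive_weyl_map[OF additive_iota]] 1 2
      using U.eps_WF[OF W] by (simp add: U.Br_def)
    then show ?thesis by (simp add: U.adt_def weyl_map_div_t)
  qed
  ultimately show ?thesis
    unfolding taylor_inner_def U.Dp_def by (simp only: additive.add[OF additive_weyl_map[OF additive_iota]])
qed

text \<open>\<open>delta_inv\<close> annihilates antisymmetric degree 0, so only one composition of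
  the anticommutator is left.\<close>

lemma iota_taylor_step:
  assumes a: "a \<in> weyl_filt n k 0"
  shows "weyl_map iota (taylor_step scA act a) = U.dinv (U.Dp (weyl_map iota a))"
proof -
  have W: "weyl_map iota a \<in> weyl_filt n k 0" using a WF_iota by blast
  have "weyl_map iota (delta_inv scA a) = weyl_map iota 0"
    unfolding i.map_delta_inv U.delta_inv_dinv[OF U.WF_supported[OF W]] U.dinv_WF_0[OF W]
    by (simp add: additive.zero[OF additive_weyl_map[OF additive_iota]])
  then have "delta_inv scA a = 0" by (simp only: weyl_map_iota_inject)
  moreover have "weyl_map iota (taylor_inner scA act 0) = weyl_map iota 0"
    using iota_taylor_inner[of 0 0] by (simp add: U.WF_zero additive.zero[OF additive_weyl_map[OF additive_iota]] additive.zero[OF U.additive_Dp])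
  then have "taylor_inner scA act 0 = 0" by (simp only: weyl_map_iota_inject)
  moreover have "weyl_map iota (delta_inv scA (taylor_inner scA act a)) = U.dinv (U.Dp (weyl_map iota a))"
    unfolding i.map_delta_inv iota_taylor_inner[OF a] by (rule U.delta_inv_dinv[OF U.WF_supported[OF U.WF_Dp[OF W]]])
  ultimately show ?thesis by (simp add: taylor_step_def)
qed

definition iota_fps :: "'a fps \<Rightarrow> ('r \<times> 'a) fps" where
  "iota_fps \<xi> = Abs_fps (\<lambda>m. iota (fps_nth \<xi> m))"

lemma iota_fps_nth: "fps_nth (iota_fps \<xi>) m = iota (fps_nth \<xi> m)"
  by (simp add: iota_fps_def)

lemma iota_fps_inject: "iota_fps \<xi> = iota_fps \<eta> \<longleftrightarrow> \<xi> = \<eta>"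
  by (simp add: fps_eq_iff iota_fps_nth iota_inject)

definition T :: "'a fps \<Rightarrow> ('r \<times> 'a) weyl" where
  "T \<xi> = weyl_map iota (tau scA act \<xi>)"

lemma T_neumann: "T \<xi> \<in> weyl_filt n 0 0" "T \<xi> = weyl_const (iota_fps \<xi>) + U.dinv (U.Dp (T \<xi>))"
proof -
  define X where "X k = weyl_map iota ((taylor_step scA act ^^ k) (weyl_const \<xi>))" for k
  have X0: "X 0 = weyl_const (iota_fps \<xi>)"
    by (auto simp: X_def weyl_map_def weyl_const_def fun_eq_iff iota_fps_nth iota_def zero_prod_def)
  have W: "(taylor_step scA act ^^ k) (weyl_const \<xi>) \<in> weyl_filt n k 0" for k
  proof (induction k)
    case 0
    show ?case using X0 U.WF_const by (simp add: WF_iota X_def)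
  next
    case (Suc k)
    then show ?case
      using iota_taylor_step[OF Suc] U.WF_dinv_Dp Suc by (simp add: WF_iota)
  qed
  have XS: "X (Suc k) = U.dinv (U.Dp (X k))" for k
    using iota_taylor_step[OF W[of k]] by (simp add: X_def)
  have t: "T \<xi> m M S = (\<Sum>k\<le>size M + 2 * m. X k m M S)" for m M S
  proof -
    \<comment> \<open>The k-th iterate has total degree at least \<open>k\<close>, so
      \<open>Sum_any\<close> reduces to the finite sum required by
      \<open>neumann_series\<close>.\<close>
    have "{k. (taylor_step scA act ^^ k) (weyl_const \<xi>) m M S \<noteq> 0} \<subseteq> {..size M + 2 * m}"
      using U.WFD[OF W] by fastforce
    then have "tau scA act \<xi> m M S = (\<Sum>k\<le>size M + 2 * m. (taylor_step scA act ^^ k) (weyl_const \<xi>) m M S)"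
      unfolding tau_def by (intro Sum_any.expand_superset) auto
    then show ?thesis by (simp add: T_def X_def weyl_map_apply additive.sum[OF additive_iota])
  qed
  show "T \<xi> \<in> weyl_filt n 0 0" "T \<xi> = weyl_const (iota_fps \<xi>) + U.dinv (U.Dp (T \<xi>))"
    by (rule U.neumann_series[of X "iota_fps \<xi>" "T \<xi>", OF X0 XS t])+
qed

lemmas T_flat = U.neumann_flat[OF Acurv_eq_0 T_neumann]

abbreviation wprod (infixl \<open>\<odot>\<close> 70) where
  "a \<odot> b \<equiv> circ (unit_mult scA) (unit_scale scA) a b"

lemma iota_star: "iota_fps (star scA act \<xi> \<eta>) = sigma (T \<xi> \<odot> T \<eta>)"
proof -
  have "weyl_map iota (circ (*) scA (tau scA act \<xi>) (tau scA act \<eta>)) = T \<xi> \<odot> T \<eta>"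
    unfolding T_def by (rule i.map_circ[OF additive_iota additive_iota]) (simp add: iota_def unit_mult_def)
  then have "weyl_map iota (circ (*) scA (tau scA act \<xi>) (tau scA act \<eta>)) m {#} {} = (T \<xi> \<odot> T \<eta>) m {#} {}" for m
    by simp
  then show ?thesis
    by (simp add: fps_eq_iff iota_fps_nth star_def sigma_def weyl_map_apply)
qed

lemma T_eqI: "U.flat a \<Longrightarrow> sigma a = iota_fps \<xi> \<Longrightarrow> a = T \<xi>"
  by (rule U.flat_eqI) (simp_all add: T_flat)

text \<open>Flat elements are closed under the fibrewise product and determined by
  \<open>sigma\<close>, whose value on the product is the star product by definition.\<close>

lemma T_star: "T (star scA act \<xi> \<eta>) = T \<xi> \<odot> T \<eta>"
  by (rule T_eqI[symmetric]) (simp_all add: U.flat_circ T_flat iota_star)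

lemma T_inject: "T \<xi> = T \<eta> \<longleftrightarrow> \<xi> = \<eta>"
  using T_flat(2) iota_fps_inject by metis

lemma T_add: "T (\<xi> + \<eta>) = T \<xi> + T \<eta>"
proof (rule T_eqI[symmetric])
  have "sigma (T \<xi> + T \<eta>) = sigma (T \<xi>) + sigma (T \<eta>)"
    by (simp add: sigma_def fps_eq_iff)
  then show "sigma (T \<xi> + T \<eta>) = iota_fps (\<xi> + \<eta>)"
    by (simp add: T_flat fps_eq_iff iota_fps_nth additive.add[OF additive_iota])
qed (simp add: U.flat_add T_flat)

lemma T_scale: "T (fps_scale scA c \<xi>) = U.jw (weyl_const c) \<odot> T \<xi>"
proof (rule T_eqI[symmetric])
  show "sigma (U.jw (weyl_const c) \<odot> T \<xi>) = iota_fps (fps_scale scA c \<xi>)"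
    by (simp add: fps_eq_iff U.sigma_central T_flat iota_fps_nth fps_scale_def additive.sum[OF additive_iota] i.h_sc)
qed (simp add: U.flat_circ U.flat_central T_flat)

text \<open>For constant arguments the order t part of \<open>sigma (T _)\<close> vanishes, so only
  the single contraction of the linear parts remains.\<close>

lemma star_first_order:
  "fps_nth (star scA act (fps_const \<xi>) (fps_const \<eta>)) 1
    = scA (q (1/2)) (\<Sum>i<n. \<Sum>j<n. scA (pi_mat i j) (act (e i) \<xi> * act (e j) \<eta>))"
proof -
  have lin: "T (fps_const x) 0 {#i#} {} = iota (act (e i) x)" if "i < n" for x i
  proof -
    have "T (fps_const x) 0 {#} {} = iota x"
      using arg_cong[OF T_flat(2)[of "fps_const x"], of "\<lambda>z. fps_nth z 0"] by (simp add: sigma_def iota_fps_nth)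
    then show ?thesis
      using U.flat_linear_part[OF T_neumann _ that, of "fps_const x"] T_flat(1)[of "fps_const x"]
      by (simp add: U.flat_def unit_act_def iota_def)
  qed
  have mult: "unit_mult scA (iota x) (iota y) = iota (x * y)" for x y
    by (simp add: unit_mult_def iota_def)
  have zero: "unit_mult scA x 0 = 0" "unit_mult scA 0 x = 0" for x
    by (simp_all add: unit_mult_def zero_prod_def)
  have "iota (fps_nth (star scA act (fps_const \<xi>) (fps_const \<eta>)) 1)
    = unit_scale scA (q (1/2)) (\<Sum>i<n. \<Sum>j<n. unit_scale scA (pi_mat i j) (iota (act (e i) \<xi> * act (e j) \<eta>)))"
    unfolding iota_fps_nth[symmetric] iota_star U.sigma_circ_1 T_flat(2)
    by (simp add: iota_fps_nth zero lin mult additive.zero[OF additive_iota])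
  also have "\<dots> = iota (scA (q (1/2)) (\<Sum>i<n. \<Sum>j<n. scA (pi_mat i j) (act (e i) \<xi> * act (e j) \<eta>)))"
    by (simp add: i.h_sc additive.sum[OF additive_iota])
  finally show ?thesis by (simp only: iota_inject)
qed

lemma star_zeroth_order: "fps_nth (star scA act \<xi> \<eta>) 0 = fps_nth \<xi> 0 * fps_nth \<eta> 0"
proof -
  have "iota (fps_nth (star scA act \<xi> \<eta>) 0) = iota (fps_nth \<xi> 0 * fps_nth \<eta> 0)"
    unfolding iota_fps_nth[symmetric] iota_star U.sigma_circ_0 T_flat(2)
    by (simp add: iota_fps_nth) (simp add: unit_mult_def iota_def)
  then show ?thesis by (simp only: iota_inject)
qed

text \<open>Bilinearity and associativity are pulled back along the injective \<open>T\<close>,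
  which turns \<open>star\<close> into the fibrewise product and scalar series into central
  factors.\<close>

lemma star_deformation: "associative_deformation scA (star scA act)"
  unfolding associative_deformation_def
proof (intro conjI allI)
  fix \<xi> \<eta> \<zeta> :: "'a fps" and c :: "'r fps"
  show "star scA act (\<xi> + \<eta>) \<zeta> = star scA act \<xi> \<zeta> + star scA act \<eta> \<zeta>"
    "star scA act \<xi> (\<eta> + \<zeta>) = star scA act \<xi> \<eta> + star scA act \<xi> \<zeta>"
    by (subst T_inject[symmetric], simp only: T_star T_add U.circ_simps)+
  show "star scA act (fps_scale scA c \<xi>) \<eta> = fps_scale scA c (star scA act \<xi> \<eta>)"
    by (subst T_inject[symmetric]) (simp only: T_star T_scale U.circ_assoc)
  show "star scA act \<xi> (fps_scale scA c \<eta>) = fps_scale scA c (star scA act \<xi> \<eta>)"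
    by (subst T_inject[symmetric]) (simp only: T_star T_scale U.circ_assoc[symmetric] U.flat_central(2)[symmetric, of "T \<xi>"])
  show "star scA act (star scA act \<xi> \<eta>) \<zeta> = star scA act \<xi> (star scA act \<eta> \<zeta>)"
    by (subst T_inject[symmetric]) (simp only: T_star U.circ_assoc)
  show "fps_nth (star scA act \<xi> \<eta>) 0 = fps_nth \<xi> 0 * fps_nth \<eta> 0"
    by (rule star_zeroth_order)
qed

end

theorem theorem3p6:
  fixes q :: "rat \<Rightarrow> 'r::comm_ring_1"
    and scG :: "'r \<Rightarrow> 'g::ab_group_add \<Rightarrow> 'g"
    and br :: "'g \<Rightarrow> 'g \<Rightarrow> 'g"
    and n :: nat
    and e :: "nat \<Rightarrow> 'g"
    and r s :: "nat \<Rightarrow> nat \<Rightarrow> 'r"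
    and nabla :: "'g \<Rightarrow> 'g \<Rightarrow> 'g"
    and Omega :: "nat \<Rightarrow> 'r ext"
    and scA :: "'r \<Rightarrow> 'a::ring \<Rightarrow> 'a"
    and act :: "'g \<Rightarrow> 'a \<Rightarrow> 'a"
  assumes "fedosov q scG br n e"
    and "fedosov.classical_r_matrix q scG br n e r"
    and "fedosov.nondegenerate n r"
    and "fedosov.symmetric_s n s"
    and "fedosov.covariant_derivative scG nabla"
    and "fedosov.torsion_free br nabla"
    and "fedosov.symplectic scG n e r nabla"
    and "fedosov.s_parallel scG n e s nabla"
    and "fedosov.closed_two_forms q scG br n e Omega"
    and "lie_algebra_action scG br scA act"
  shows "associative_deformation scA (fedosov.star q scG br n e r s nabla Omega scA act) \<and>
    (\<forall>\<xi> \<eta>.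
       fps_nth (fedosov.star q scG br n e r s nabla Omega scA act (fps_const \<xi>) (fps_const \<eta>)) 0
         = \<xi> * \<eta> \<and>
       fps_nth (fedosov.star q scG br n e r s nabla Omega scA act (fps_const \<xi>) (fps_const \<eta>)) 1
         = scA (q (1/2)) (\<Sum>i<n. \<Sum>j<n.
             scA (fedosov.pi_mat r s i j) (act (e i) \<xi> * act (e j) \<eta>)))"
proof -
  interpret fedosov q scG br n e r s nabla Omega by (rule assms(1))
  interpret lie_algebra_action scG br scA act by (rule assms(10))
  have antisym: "r i j = - r j i" if "i < n" "j < n" for i j
    using assms(2) that unfolding classical_r_matrix_def by blast
  interpret fedosov_star q scG br n e r s nabla Omega scA act
    by unfold_locales (erule (1) antisym, (rule assms)+)
  show ?thesis
    using star_deformation star_zeroth_order star_first_order by simp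
qed

end
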